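(* Let $G$ be a connected Lie subgroup of $\mathrm{Iso}_\circ(\mathrm{dS}^{1,2})\simeq SO_\circ(1,3)$ which acts on the Einstein universe $\mathbb{E}\mathrm{in}^{1,2}=\mathrm{dS}^{1,2}\cup\partial\mathrm{dS}^{1,2}$ with cohomogeneity one. Then either $G$ fixes a point in $\mathbb{E}\mathrm{in}^{1,2}$, or it is conjugate to $SO(3)$, or it is $\mathrm{Iso}_\circ(\mathrm{dS}^{1,2})$.
   Context: $\mathbb{R}^{2,3}$ is $\mathbb{R}^5$ with a quadratic form $\mathfrak q$ of signature $(2,3)$ (2 minus signs, 3 plus signs); $\mathbb{E}\mathrm{in}^{1,2}\subset\mathbb{P}(\mathbb{R}^{2,3})$ is the projectivization of the set of nonzero null vectors, with its induced Lorentzian conformal structure and the action of $SO_\circ(2,3)$ (identity component of $O(2,3)$). Fix a timelike line $\ell\leq\mathbb{R}^{2,3}$ (i.e. $\mathfrak q<0$ on $\ell\setminus 0$), so $\ell^\perp\approx\mathbb{R}^{1,3}$. The identity component of the stabilizer of $\ell$ in $SO_\circ(2,3)$ is $SO_\circ(1,3)$, acting on $\ell^\perp$ and trivially on $\ell$. It preserves the spacelike hypersphere $\mathbb{S}^2=\mathbb{P}(\ell^\perp)\cap\mathbb{E}\mathrm{in}^{1,2}$, denoted $\partial\mathrm{dS}^{1,2}$, and its complement, which is conformally equivalent to the de Sitter space $\mathrm{dS}^{1,2}=\{v\in\mathbb{R}^{1,3}:\mathfrak{q}_{1,3}(v)=1\}$, on which $SO_\circ(1,3)$ acts as the identity component $\mathrm{Iso}_\circ(\mathrm{dS}^{1,2})$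 of the isometry group. $SO(3)\subset SO_\circ(1,3)$ denotes the maximal compact subgroup (stabilizer of a timelike line of $\mathbb{R}^{1,3}$). An action is of cohomogeneity one if it admits a codimension one orbit. Lie subgroups are not assumed closed. *)

theory Defs
  imports "HOL-Analysis.Analysis"
begin

section \<open>Smooth maps and immersed submanifolds\<close>

primrec Ck_on :: "nat \<Rightarrow> 'a::euclidean_space set \<Rightarrow> ('a \<Rightarrow> 'b::real_normed_vector) \<Rightarrow> bool" where
  "Ck_on 0 S F = continuous_on S F"
| "Ck_on (Suc n) S F = (F differentiable_on S \<and>
     (\<forall>v. Ck_on n S (\<lambda>x. frechet_derivative F (at x) v)))"

definition smooth_on :: "'a::euclidean_space set \<Rightarrow> ('a \<Rightarrow> 'b::real_normed_vector) \<Rightarrow> bool" where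
  "smooth_on S F \<longleftrightarrow> open S \<and> (\<forall>n. Ck_on n S F)"

text \<open>
  The dimension of a manifold is a natural number that is not known in advance (it may be 0), so
  the role of \<open>\<real>\<^sup>k\<close> is played by a linear subspace \<open>V\<close> of dimension \<open>k\<close> of a Euclidean space, and
  the domain of a local parametrization is \<open>N \<inter> V\<close> with \<open>N\<close> open. A map that is smooth on \<open>N \<inter> V\<close>
  extends to an open set of the big space by composing with the orthogonal projection to \<open>V\<close>, so
  it is no restriction to take it smooth on \<open>N\<close>. Only its behaviour along \<open>V\<close> matters.
\<close>

definition immersion_on :: "'a::euclidean_space set \<Rightarrow> 'a set \<Rightarrow> ('a \<Rightarrow> 'a) \<Rightarrow> bool" where
  "immersion_on V N \<phi> \<longleftrightarrow>
     smooth_on N \<phi> \<and> (\<forall>x\<in>N \<inter> V. \<forall>v\<in>V. frechet_derivative \<phi> (at x) v = 0 \<longrightarrow> v = 0)"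

text \<open>
  Points of the projective space \<open>P('a)\<close> are the lines \<open>span {v}\<close>, \<open>v \<noteq> 0\<close>. A map to \<open>P('a)\<close> is
  smooth if it locally lifts to a smooth map \<open>F\<close> to \<open>'a - {0}\<close>; the tangent space at \<open>span {F x}\<close>
  is a copy of \<open>'a\<close> modulo \<open>span {F x}\<close>, hence the form of the injectivity condition.
\<close>

definition proj_immersion_on :: "'a::euclidean_space set \<Rightarrow> 'a set \<Rightarrow> ('a \<Rightarrow> 'a set) \<Rightarrow> bool" where
  "proj_immersion_on V N \<phi> \<longleftrightarrow>
     (\<exists>F. smooth_on N F \<and>
        (\<forall>x\<in>N \<inter> V. F x \<noteq> 0 \<and> \<phi> x = span {F x} \<and>
           (\<forall>v\<in>V. frechet_derivative F (at x) v \<in> span {F x} \<longrightarrow> v = 0)))"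

text \<open>
  The set \<open>topspace T\<close> with its own topology \<open>T\<close> (in general finer than the subspace topology) is
  an immersed \<open>k\<close>-dimensional submanifold of the ambient manifold whose immersions are given by
  \<open>imm\<close>. The parametrizations are homeomorphisms onto \<open>T\<close>-open sets and immersions into the
  ambient manifold, so by the inverse function theorem all transition maps are smooth: the smooth
  structure is determined by \<open>T\<close> and need not be given separately.
\<close>

definition immersed_submanifold ::
  "('m::euclidean_space set \<Rightarrow> 'm set \<Rightarrow> ('m \<Rightarrow> 'x) \<Rightarrow> bool) \<Rightarrow> nat \<Rightarrow> 'x topology \<Rightarrow> bool" where
  "immersed_submanifold imm k T \<longleftrightarrow>
     Hausdorff_space T \<and>
     (\<exists>\<B>. countable \<B> \<and> (\<forall>B\<in>\<B>. openin T B) \<and>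
        (\<forall>U x. openin T U \<and> x \<in> U \<longrightarrow> (\<exists>B\<in>\<B>. x \<in> B \<and> B \<subseteq> U))) \<and>
     (\<forall>p\<in>topspace T. \<exists>V N \<phi>.
        subspace V \<and> dim V = k \<and> imm V N \<phi> \<and>
        p \<in> \<phi> ` (N \<inter> V) \<and> openin T (\<phi> ` (N \<inter> V)) \<and>
        homeomorphic_map (top_of_set (N \<inter> V)) (subtopology T (\<phi> ` (N \<inter> V))) \<phi>)"

section \<open>Lie subgroups of the general linear group\<close>

definition matrix_group :: "(real^'n^'n) set \<Rightarrow> bool" where
  "matrix_group G \<longleftrightarrow>
     mat 1 \<in> G \<and> (\<forall>A\<in>G. \<forall>B\<in>G. A ** B \<in> G) \<and> (\<forall>A\<in>G. invertible A \<and> matrix_inv A \<in> G)"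

text \<open>
  \<open>G\<close> with the topology \<open>T\<close> is a (not necessarily closed) Lie subgroup: an immersed submanifold
  that is a Lie group. A map into an immersed submanifold is smooth iff it is continuous for \<open>T\<close>
  and smooth into the ambient space; multiplication and inversion of matrices are smooth, so
  smoothness of the group operations of \<open>G\<close> amounts to their continuity for \<open>T\<close>.
\<close>

definition lie_subgroup :: "(real^'n^'n) set \<Rightarrow> (real^'n^'n) topology \<Rightarrow> bool" where
  "lie_subgroup G T \<longleftrightarrow>
     matrix_group G \<and> topspace T = G \<and> (\<exists>k. immersed_submanifold immersion_on k T) \<and>
     continuous_map (prod_topology T T) T (\<lambda>(A, B). A ** B) \<and>
     continuous_map T T matrix_inv"

section \<open>The Einstein universe and its de Sitter subgroup\<close>

definition signature_2_3 :: "(real^5 \<Rightarrow> real) \<Rightarrow> bool" where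
  "signature_2_3 q \<longleftrightarrow>
     (\<exists>f::real^5 \<Rightarrow> real^5. linear f \<and> bij f \<and>
        (\<forall>x. q x = - (f x $ 1)\<^sup>2 - (f x $ 2)\<^sup>2 + (f x $ 3)\<^sup>2 + (f x $ 4)\<^sup>2 + (f x $ 5)\<^sup>2))"

definition polar :: "(real^5 \<Rightarrow> real) \<Rightarrow> real^5 \<Rightarrow> real^5 \<Rightarrow> real" where
  "polar q x y = (q (x + y) - q x - q y) / 2"

definition orth :: "(real^5 \<Rightarrow> real) \<Rightarrow> (real^5) set \<Rightarrow> (real^5) set" where
  "orth q W = {x. \<forall>y\<in>W. polar q x y = 0}"

definition timelike_line :: "(real^5 \<Rightarrow> real) \<Rightarrow> (real^5) set \<Rightarrow> bool" where
  "timelike_line q L \<longleftrightarrow> subspace L \<and> dim L = 1 \<and> (\<forall>x\<in>L - {0}. q x < 0)"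

definition Ein :: "(real^5 \<Rightarrow> real) \<Rightarrow> (real^5) set set" where
  "Ein q = {span {v} | v. v \<noteq> 0 \<and> q v = 0}"

definition act :: "real^5^5 \<Rightarrow> (real^5) set \<Rightarrow> (real^5) set" where
  "act A W = (\<lambda>x. A *v x) ` W"

definition stab :: "(real^5^5) set \<Rightarrow> (real^5) set \<Rightarrow> (real^5^5) set" where
  "stab G W = {A \<in> G. act A W = W}"

definition orbit :: "(real^5^5) set \<Rightarrow> (real^5) set \<Rightarrow> (real^5) set set" where
  "orbit G p = (\<lambda>A. act A p) ` G"

definition SO0_2_3 :: "(real^5 \<Rightarrow> real) \<Rightarrow> (real^5^5) set" where
  "SO0_2_3 q = connected_component_set {A. \<forall>x. q (A *v x) = q x} (mat 1)"

text \<open>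
  The group \<open>Iso\<^sub>0(dS) = SO\<^sub>0(1,3)\<close>: it acts trivially on the timelike line \<open>L\<close>, and de Sitter space
  is the open subset of \<open>Ein q\<close> consisting of the null lines that are not contained in
  \<open>orth q L\<close>, on which it acts as the identity component of the isometry group.
\<close>

definition Iso0_dS :: "(real^5 \<Rightarrow> real) \<Rightarrow> (real^5) set \<Rightarrow> (real^5^5) set" where
  "Iso0_dS q L = connected_component_set (stab (SO0_2_3 q) L) (mat 1)"

text \<open>The maximal compact subgroup \<open>SO(3)\<close> attached to a timelike line \<open>M \<subseteq> orth q L\<close>.\<close>

definition SO_3 :: "(real^5 \<Rightarrow> real) \<Rightarrow> (real^5) set \<Rightarrow> (real^5) set \<Rightarrow> (real^5^5) set" where
  "SO_3 q L M = stab (Iso0_dS q L) M"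

text \<open>
  \<open>Ein q\<close> is 3-dimensional and embedded in projective space, so an orbit has codimension one if it
  is an immersed surface. The dimension does not depend on the choice of \<open>T\<close>: since immersed
  submanifolds are second countable here, it is the Hausdorff dimension of the orbit.
\<close>

definition cohomogeneity_one :: "(real^5 \<Rightarrow> real) \<Rightarrow> (real^5^5) set \<Rightarrow> bool" where
  "cohomogeneity_one q G \<longleftrightarrow>
     (\<exists>p\<in>Ein q. \<exists>T. topspace T = orbit G p \<and> immersed_submanifold proj_immersion_on 2 T)"

end

theory Submission
  imports Defs
begin

text \<open>
  In coordinates in which \<open>L\<close> is spanned by the first basis vector \<open>e1\<close> and \<open>M\<close> by the second one
  \<open>e2\<close>, the group \<open>Iso\<^sub>0(dS)\<close> becomes the identity component \<open>lorentz\<close> of the group of isometries that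
  fix \<open>e1\<close>. The theorem rests on the classification of its connected Lie subgroups \<open>G\<close>: either \<open>G\<close> is
  everything, or it stabilizes a null line of \<open>\<real>\<^sup>1\<^sup>,\<^sup>3 = e1\<^sup>\<bottom>\<close>, or it fixes a nonzero vector \<open>w\<close> of
  \<open>\<real>\<^sup>1\<^sup>,\<^sup>3\<close> (\<open>lie_pair_trichotomy\<close>). A fixed \<open>w\<close> that is spacelike again gives a fixed point of the
  Einstein universe, because a multiple of \<open>w\<close> can be added to the fixed timelike vector \<open>e1\<close> to
  produce a null vector. If \<open>w\<close> is timelike, then after moving it to \<open>e2\<close> the group lies in
  \<open>SO(3)\<close>; its Lie algebra is a subalgebra of \<open>\<real>\<^sup>3\<close> with the cross product, hence either all of \<open>\<real>\<^sup>3\<close>,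
  and then \<open>G = SO(3)\<close>, or contained in a line, which is then a spacelike line fixed by \<open>G\<close>
  (\<open>e2_stabilizer\<close>).

  The classification uses \<open>so(1,3) = \<complex>\<^sup>3\<close>, the bracket being the cross product. Elements of \<open>lorentz\<close>
  act on \<open>\<complex>\<^sup>3\<close> by \<open>\<complex>\<close>-linear maps that preserve the cross product and the complex dot product
  (\<open>cdot_rho\<close>, \<open>rho_complex_linear\<close>). Let \<open>p\<close> be the Lie algebra of \<open>G\<close>, a real subspace of \<open>\<complex>\<^sup>3\<close>
  that is invariant under \<open>G\<close>. If \<open>p = \<complex>\<^sup>3\<close>, then \<open>G\<close> is open in \<open>lorentz\<close>. If \<open>p \<inter> \<i>p\<close> is nonzero but
  not everything, it or its orthogonal complement is an invariant complex line
  (\<open>stable_complex_line\<close>), and an invariant complex line singles out an eigenvector of an element of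
  \<open>so(1,3)\<close> that spans an invariant null line (\<open>stable_complex_line_imp_null\<close>); the same argument applies to
  \<open>dim p = 1\<close>, and \<open>G\<close> is trivial if \<open>p = 0\<close>. In the remaining case \<open>p\<close> is a totally real subalgebra of dimension at least two. The
  double cross product identity forces the dot product to be real on it (\<open>real_form_generators\<close>),
  and two-forms on \<open>\<real>\<^sup>1\<^sup>,\<^sup>3\<close> with real dot products are decomposable with vanishing wedge product, so that \<open>p\<close>
  annihilates a common vector \<open>w\<close> (\<open>common_kernel\<close>).

  The Lie theory is condensed in the predicate \<open>lie_pair G g\<close>. Its proof from an immersion
  (\<open>lie_subgroup_imp_lie_pair\<close>) has two ingredients: a curve in \<open>G\<close> that is continuous for the topology of \<open>G\<close>
  has its velocity in the tangent space \<open>g\<close>, and the map \<open>A \<mapsto> A - A\<^sup>-\<^sup>1\<close>, which is injective near the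
  identity, together with invariance of domain shows that \<open>G\<close> is open in any group \<open>H\<close> that this map
  sends to \<open>g\<close>.
\<close>

section \<open>Matrices near the identity\<close>

lemma bounded_bilinear_matrix_mult:
  "bounded_bilinear ((**) :: real^'m^'n \<Rightarrow> real^'p^'m \<Rightarrow> real^'p^'n)"
proof -
  have "bilinear ((**) :: real^'m^'n \<Rightarrow> real^'p^'m \<Rightarrow> real^'p^'n)"
    unfolding bilinear_def linear_iff
    by (auto simp: matrix_matrix_mult_def vec_eq_iff sum.distrib sum_distrib_left algebra_simps)
  then show ?thesis by (simp add: bilinear_conv_bounded_bilinear)
qed

lemmas matrix_diff_mult = bounded_bilinear.diff_left [OF bounded_bilinear_matrix_mult]
lemmas matrix_mult_diff = bounded_bilinear.diff_right [OF bounded_bilinear_matrix_mult]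
lemmas continuous_on_matrix_mult = bounded_bilinear.continuous_on [OF bounded_bilinear_matrix_mult]
lemmas has_vector_derivative_matrix_mult =
  bounded_bilinear.has_vector_derivative [OF bounded_bilinear_matrix_mult]
lemmas bounded_linear_matrix_mult_left = bounded_bilinear.bounded_linear_left [OF bounded_bilinear_matrix_mult]
lemmas bounded_linear_matrix_mult_right = bounded_bilinear.bounded_linear_right [OF bounded_bilinear_matrix_mult]

lemma bounded_bilinear_matrix_vector_mult:
  "bounded_bilinear ((*v) :: real^'m^'n \<Rightarrow> real^'m \<Rightarrow> real^'n)"
proof -
  have "bilinear ((*v) :: real^'m^'n \<Rightarrow> real^'m \<Rightarrow> real^'n)"
    unfolding bilinear_def linear_iff
    by (auto simp: matrix_vector_right_distrib matrix_vector_mult_add_rdistrib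
        matrix_vector_mult_scaleR scaleR_matrix_vector_assoc)
  then show ?thesis by (simp add: bilinear_conv_bounded_bilinear)
qed

lemma difference_quotient_tendsto:
  assumes "(\<gamma> has_vector_derivative X) (at (0::real))"
  shows "((\<lambda>t. (1 / t) *\<^sub>R (\<gamma> t - \<gamma> 0)) \<longlongrightarrow> X) (at 0)"
proof -
  have "((\<lambda>h. norm (\<gamma> h - \<gamma> 0 - h *\<^sub>R X) / norm h) \<longlongrightarrow> 0) (at 0)"
    using assms by (simp add: has_vector_derivative_def has_derivative_at)
  moreover have "norm (\<gamma> h - \<gamma> 0 - h *\<^sub>R X) / norm h = norm ((1 / h) *\<^sub>R (\<gamma> h - \<gamma> 0) - X)" if "h \<noteq> 0" for h
  proof -
    have "(1 / h) *\<^sub>R (\<gamma> h - \<gamma> 0) - X = (1 / h) *\<^sub>R (\<gamma> h - \<gamma> 0 - h *\<^sub>R X)"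
      using that by (simp add: algebra_simps)
    then show ?thesis by (simp add: divide_inverse_commute)
  qed
  then have "\<forall>\<^sub>F h in at 0. norm (\<gamma> h - \<gamma> 0 - h *\<^sub>R X) / norm h = norm ((1 / h) *\<^sub>R (\<gamma> h - \<gamma> 0) - X)"
    by (simp add: eventually_at_filter)
  ultimately have "((\<lambda>h. norm ((1 / h) *\<^sub>R (\<gamma> h - \<gamma> 0) - X)) \<longlongrightarrow> 0) (at 0)"
    by (rule Lim_transform_eventually)
  then show ?thesis by (simp add: tendsto_norm_zero_iff flip: LIM_zero_iff [of _ X])
qed

lemma velocity_in_subspace:
  fixes h :: "real \<Rightarrow> 'a::euclidean_space"
  assumes "subspace p" "h 0 \<in> p" "\<forall>\<^sub>F t in at 0. h t \<in> p" "(h has_vector_derivative d) (at 0)"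
  shows "d \<in> p"
proof (rule Lim_in_closed_set [OF closed_subspace [OF assms(1)] _ _ difference_quotient_tendsto [OF assms(4)]])
  show "\<forall>\<^sub>F t in at 0. (1 / t) *\<^sub>R (h t - h 0) \<in> p"
    using assms(3) by eventually_elim (use assms in \<open>auto intro!: subspace_scale subspace_diff\<close>)
qed simp

lemma matrix_inv_both:
  assumes "invertible (A::real^'n^'n)"
  shows "A ** matrix_inv A = mat 1" "matrix_inv A ** A = mat 1"
proof -
  have "A ** matrix_inv A = mat 1 \<and> matrix_inv A ** A = mat 1"
    unfolding matrix_inv_def using assms unfolding invertible_def by (rule someI_ex)
  then show "A ** matrix_inv A = mat 1" "matrix_inv A ** A = mat 1" by auto
qed

lemma matrix_inv_eqI:
  assumes "(A::real^'n^'n) ** B = mat 1"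
  shows "matrix_inv A = B" "invertible A"
proof -
  have BA: "B ** A = mat 1" using assms matrix_left_right_inverse by blast
  then show inv: "invertible A" using assms by (auto simp: invertible_def)
  show "matrix_inv A = B"
    by (metis BA inv matrix_inv_both(1) matrix_mul_assoc matrix_mul_lid matrix_mul_rid)
qed

lemma matrix_group_simps:
  assumes "matrix_group G"
  shows "mat 1 \<in> G" and "A \<in> G \<Longrightarrow> B \<in> G \<Longrightarrow> A ** B \<in> G" and "A \<in> G \<Longrightarrow> matrix_inv A \<in> G"
    and "A \<in> G \<Longrightarrow> A ** matrix_inv A = mat 1" and "A \<in> G \<Longrightarrow> matrix_inv A ** A = mat 1"
  using assms matrix_inv_both unfolding matrix_group_def by blast+

text \<open>
  With \<open>D = A - B\<close> the hypothesis reads \<open>D = A\<^sup>-\<^sup>1 - B\<^sup>-\<^sup>1\<close>, hence \<open>A D B = - D\<close>, whereas \<open>A D B\<close> is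
  close to \<open>D\<close> when \<open>A\<close> and \<open>B\<close> are close to the identity.
\<close>

lemma minus_inverse_locally_injective:
  obtains \<epsilon> where "\<epsilon> > 0"
    and "\<And>A B :: real^'n^'n. norm (A - mat 1) < \<epsilon> \<Longrightarrow> norm (B - mat 1) < \<epsilon> \<Longrightarrow>
           invertible A \<Longrightarrow> invertible B \<Longrightarrow> A - matrix_inv A = B - matrix_inv B \<Longrightarrow> A = B"
proof -
  obtain K where K: "K > 0"
    "\<And>(X::real^'n^'n) (Y::real^'n^'n). norm (X ** Y) \<le> norm X * norm Y * K"
    using bounded_bilinear.pos_bounded [OF bounded_bilinear_matrix_mult] by metis
  define c where "c = norm (mat 1 :: real^'n^'n) + 1"
  have c: "c \<ge> 1" by (simp add: c_def)
  define \<epsilon> where "\<epsilon> = min 1 (1 / (2 * K * K * c + 2 * K))"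
  have pos: "2 * K * K * c + 2 * K > 0" using K c by (intro add_pos_pos) auto
  have \<epsilon>: "\<epsilon> > 0" using pos by (simp add: \<epsilon>_def)
  moreover have "A = B"
    if A: "norm (A - mat 1) < \<epsilon>" and B: "norm (B - mat 1) < \<epsilon>"
      and iA: "invertible A" and iB: "invertible B"
      and eq: "A - matrix_inv A = B - matrix_inv B" for A B :: "real^'n^'n"
  proof -
    define D where "D = A - B"
    have "D = matrix_inv A - matrix_inv B" using eq by (simp add: D_def algebra_simps)
    then have "A ** D ** B = (A ** matrix_inv A) ** B - A ** (matrix_inv B ** B)"
      by (simp add: matrix_mult_diff matrix_diff_mult matrix_mul_assoc)
    also have "\<dots> = - D" using iA iB by (simp add: matrix_inv_both D_def)
    finally have ADB: "A ** D ** B = - D" .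
    have "2 *\<^sub>R D = - ((A - mat 1) ** D ** B) - D ** (B - mat 1)"
      using ADB by (simp add: matrix_mult_diff matrix_diff_mult scaleR_2)
    then have "norm (2 *\<^sub>R D) \<le> norm ((A - mat 1) ** D ** B) + norm (D ** (B - mat 1))"
      by (metis norm_minus_cancel norm_triangle_ineq4)
    also have "norm ((A - mat 1) ** D ** B) \<le> norm ((A - mat 1) ** D) * norm B * K" by (rule K(2))
    also have "\<dots> \<le> (norm (A - mat 1) * norm D * K) * norm B * K"
      by (intro mult_right_mono K(2)) (use K in auto)
    also have "\<dots> \<le> (\<epsilon> * norm D * K) * c * K"
    proof -
      have "norm B \<le> norm (mat 1 :: real^'n^'n) + norm (B - mat 1)"
        by (metis add.commute diff_add_cancel norm_triangle_ineq)
      then have "norm B \<le> c" using B by (simp add: c_def \<epsilon>_def)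
      then show ?thesis using A K c \<epsilon> by (intro mult_right_mono mult_mono) auto
    qed
    also have "norm (D ** (B - mat 1)) \<le> norm D * norm (B - mat 1) * K" by (rule K(2))
    also have "\<dots> \<le> norm D * \<epsilon> * K" using B K by (intro mult_right_mono mult_left_mono) auto
    finally have "2 * norm D \<le> norm D * (\<epsilon> * (K * K * c + K))" by (simp add: algebra_simps)
    also have "\<dots> \<le> norm D * (1/2)"
    proof (rule mult_left_mono)
      have "\<epsilon> * (K * K * c + K) \<le> 1 / (2 * K * K * c + 2 * K) * (K * K * c + K)"
        using pos by (intro mult_right_mono) (auto simp: \<epsilon>_def)
      also have "\<dots> = 1/2" using pos by (simp add: field_simps)
      finally show "\<epsilon> * (K * K * c + K) \<le> 1/2" .
    qed auto
    finally have "norm D = 0" using norm_ge_zero [of D] by linarith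
    then show "A = B" by (simp add: D_def)
  qed
  ultimately show thesis using that by blast
qed

text \<open>
  From \<open>A\<^sup>-\<^sup>1 - 1 = - A\<^sup>-\<^sup>1 (A - 1)\<close> one first bounds the norm of the inverse and then its distance from the identity.
\<close>

lemma matrix_inv_close_to_one:
  assumes "\<epsilon> > 0"
  obtains \<delta> where "\<delta> > 0" and "\<And>A :: real^'n^'n. invertible A \<Longrightarrow> norm (A - mat 1) < \<delta> \<Longrightarrow>
    norm (A - matrix_inv A) < \<epsilon>"
proof -
  obtain K where K: "K > 0"
    "\<And>(X::real^'n^'n) (Y::real^'n^'n). norm (X ** Y) \<le> norm X * norm Y * K"
    using bounded_bilinear.pos_bounded [OF bounded_bilinear_matrix_mult] by metis
  define c where "c = norm (mat 1 :: real^'n^'n)"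
  have c: "c \<ge> 0" by (simp add: c_def)
  define \<delta> where "\<delta> = min (1 / (2 * K)) (\<epsilon> / (2 * (1 + 2 * c * K)))"
  have p: "1 + 2 * c * K > 0" using K c by (intro add_pos_nonneg) auto
  have "\<delta> > 0" using K p assms by (simp add: \<delta>_def)
  moreover have "norm (A - matrix_inv A) < \<epsilon>"
    if iA: "invertible A" and A: "norm (A - mat 1) < \<delta>" for A :: "real^'n^'n"
  proof -
    let ?I = "matrix_inv A"
    have eq: "?I - mat 1 = - (?I ** (A - mat 1))"
      using iA by (simp add: matrix_mult_diff matrix_inv_both)
    have le: "norm (?I - mat 1) \<le> norm ?I * norm (A - mat 1) * K"
      unfolding eq norm_minus_cancel by (rule K(2))
    also have "\<dots> \<le> norm ?I * (1 / (2 * K)) * K"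
      using A K by (intro mult_right_mono mult_left_mono) (auto simp: \<delta>_def)
    also have "\<dots> = norm ?I / 2" using K by simp
    finally have "norm ?I \<le> c + norm ?I / 2"
      using norm_triangle_ineq [of "?I - mat 1" "mat 1"] by (simp add: c_def)
    then have "norm ?I \<le> 2 * c" by simp
    then have "norm (?I - mat 1) \<le> 2 * c * norm (A - mat 1) * K"
      using le K by (smt (verit) mult_right_mono norm_ge_zero)
    moreover have "norm (A - ?I) \<le> norm (A - mat 1) + norm (?I - mat 1)"
      by (metis diff_diff_eq2 diff_add_cancel norm_triangle_ineq4 add_diff_cancel_right add.commute)
    ultimately have "norm (A - ?I) \<le> (1 + 2 * c * K) * norm (A - mat 1)" by (simp add: algebra_simps)
    also have "\<dots> \<le> (1 + 2 * c * K) * (\<epsilon> / (2 * (1 + 2 * c * K)))"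
      using A p by (intro mult_left_mono) (auto simp: \<delta>_def)
    also have "\<dots> = \<epsilon> / 2" using p by (simp add: field_simps)
    finally show ?thesis using assms by simp
  qed
  ultimately show thesis using that by blast
qed

section \<open>The Lie algebra of an immersed subgroup\<close>

text \<open>
  The interplay between a group and its Lie algebra \<open>g\<close>, in a form that is invariant under conjugation
  and mentions neither charts nor the exponential map. The last clause replaces the comparison of
  dimensions: for a group \<open>H\<close> of isometries, \<open>A - A\<^sup>-\<^sup>1\<close> is skew for every \<open>A \<in> H\<close>, so the hypothesis on \<open>H\<close>
  says that \<open>g\<close> contains the whole Lie algebra of \<open>H\<close>.
\<close>

definition lie_pair :: "(real^'n^'n) set \<Rightarrow> (real^'n^'n) set \<Rightarrow> bool" where
  "lie_pair G g \<longleftrightarrow> matrix_group G \<and> connected G \<and> subspace g \<and>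
     (\<forall>A\<in>G. \<forall>X\<in>g. A ** X ** matrix_inv A \<in> g) \<and>
     (\<forall>X\<in>g. \<exists>\<gamma>. \<gamma> 0 = mat 1 \<and> (\<forall>\<^sub>F t in at 0. \<gamma> t \<in> G) \<and> (\<gamma> has_vector_derivative X) (at (0::real))) \<and>
     (\<forall>w. (\<forall>X\<in>g. X *v w = 0) \<longrightarrow> (\<forall>A\<in>G. A *v w = w)) \<and>
     (\<forall>H. matrix_group H \<and> G \<subseteq> H \<and> (\<forall>A\<in>H. A - matrix_inv A \<in> g) \<longrightarrow>
        connected_component_set H (mat 1) \<subseteq> G)"

text \<open>
  Locally the identity map is a continuous chart composed with the inverse of a homeomorphism.
\<close>

lemma immersed_submanifold_finer:
  fixes T :: "'m::euclidean_space topology"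
  assumes "immersed_submanifold immersion_on k T"
  shows "continuous_map T euclidean (\<lambda>x. x)"
proof -
  have "openin T {x \<in> topspace T. x \<in> O'}" if "open O'" for O'
  proof (subst openin_subopen, intro ballI)
    fix p assume p: "p \<in> {x \<in> topspace T. x \<in> O'}"
    then have "p \<in> topspace T" by blast
    from bspec [OF conjunct2 [OF conjunct2 [OF assms [unfolded immersed_submanifold_def]]] this]
    obtain V N \<phi> where \<phi>: "immersion_on V N \<phi>" "p \<in> \<phi> ` (N \<inter> V)" "openin T (\<phi> ` (N \<inter> V))"
      "homeomorphic_map (top_of_set (N \<inter> V)) (subtopology T (\<phi> ` (N \<inter> V))) \<phi>"
      by (elim exE conjE)
    have "Ck_on 0 N \<phi>" using \<phi>(1) unfolding immersion_on_def smooth_on_def by blast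
    then have "continuous_on (N \<inter> V) \<phi>" by (auto intro: continuous_on_subset)
    then have "openin (top_of_set (N \<inter> V)) (N \<inter> V \<inter> \<phi> -` O')"
      using that by (simp add: continuous_openin_preimage_gen)
    then have "openin (subtopology T (\<phi> ` (N \<inter> V))) (\<phi> ` (N \<inter> V \<inter> \<phi> -` O'))"
      using \<phi>(4) homeomorphic_imp_open_map open_map_def by blast
    then have "openin T (\<phi> ` (N \<inter> V \<inter> \<phi> -` O'))"
      using \<phi>(3) openin_trans_full by blast
    moreover have "\<phi> ` (N \<inter> V \<inter> \<phi> -` O') \<subseteq> {x \<in> topspace T. x \<in> O'}"
      using openin_subset [OF \<phi>(3)] by auto
    moreover have "p \<in> \<phi> ` (N \<inter> V \<inter> \<phi> -` O')" using \<phi>(2) p by auto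
    ultimately show "\<exists>S. openin T S \<and> p \<in> S \<and> S \<subseteq> {x \<in> topspace T. x \<in> O'}" by blast
  qed
  then show ?thesis by (simp add: continuous_map_def)
qed

text \<open>
  A connected Lie subgroup with a parametrization \<open>\<phi>\<close> of a neighbourhood of the identity. Translations
  carry this chart to every other point, so that a single chart describes the whole group.
\<close>

locale lie_chart =
  fixes G V N :: "(real^'n^'n) set" and T :: "(real^'n^'n) topology" and \<phi> :: "real^'n^'n \<Rightarrow> real^'n^'n"
    and x0 :: "real^'n^'n"
  assumes group: "matrix_group G" and topspace: "topspace T = G" and connected: "connected_space T"
    and finer: "continuous_map T euclidean (\<lambda>x. x)"
    and mult: "continuous_map (prod_topology T T) T (\<lambda>(A, B). A ** B)"
    and inv: "continuous_map T T matrix_inv"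
    and V: "subspace V" and N: "open N" and diff: "\<phi> differentiable_on N"
    and imm: "\<And>v. v \<in> V \<Longrightarrow> frechet_derivative \<phi> (at x0) v = 0 \<Longrightarrow> v = 0"
    and x0: "x0 \<in> N \<inter> V" "\<phi> x0 = mat 1"
    and open_chart: "openin T (\<phi> ` (N \<inter> V))"
    and homeo: "homeomorphic_map (top_of_set (N \<inter> V)) (subtopology T (\<phi> ` (N \<inter> V))) \<phi>"
begin

lemmas group_simps = matrix_group_simps [OF group]

abbreviation "D \<equiv> frechet_derivative \<phi> (at x0)"

definition tangent where "tangent = D ` V"

lemma has_derivative_chart: "x \<in> N \<Longrightarrow> (\<phi> has_derivative frechet_derivative \<phi> (at x)) (at x)"
  using diff N by (simp add: differentiable_on_eq_differentiable_at frechet_derivative_works)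

lemma linear_D: "linear D"
  using has_derivative_chart x0(1) has_derivative_linear by blast

lemma subspace_tangent: "subspace tangent"
  unfolding tangent_def using linear_D V by (rule linear_subspace_image)

lemma dim_tangent: "dim tangent = dim V"
proof -
  have "inj_on D V"
    using linear_inj_on_iff_eq_0 [OF linear_D V] imm by blast
  then show ?thesis unfolding tangent_def
    using linear_D V by (intro dim_image_eq) (simp_all add: span_eq_iff [THEN iffD2])
qed

lemma chart_continuous: "continuous_map (top_of_set (N \<inter> V)) T \<phi>"
  using homeo homeomorphic_imp_continuous_map continuous_map_into_fulltopology by blast

lemma left_mult: "A \<in> G \<Longrightarrow> continuous_map T T (\<lambda>B. A ** B)"
proof -
  assume "A \<in> G"
  then have "continuous_map T (prod_topology T T) (\<lambda>B. (A, B))"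
    by (simp add: continuous_map_pairedI topspace)
  from continuous_map_compose [OF this mult] show ?thesis by (simp add: o_def)
qed

lemma right_mult: "A \<in> G \<Longrightarrow> continuous_map T T (\<lambda>B. B ** A)"
proof -
  assume "A \<in> G"
  then have "continuous_map T (prod_topology T T) (\<lambda>B. (B, A))"
    by (simp add: continuous_map_pairedI topspace)
  from continuous_map_compose [OF this mult] show ?thesis by (simp add: o_def)
qed

text \<open>
  Near \<open>0\<close> the curve is \<open>\<phi> \<circ> c\<close> with \<open>c\<close> merely continuous. Since the derivative \<open>D\<close> of \<open>\<phi>\<close> is bounded below on
  \<open>V\<close>, differentiability of \<open>\<phi> \<circ> c\<close> at \<open>0\<close> forces \<open>c t - x0 = O(t)\<close>, so the difference quotients of the
  curve are approximated by elements of \<open>D ` V\<close>, and this subspace is closed.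
\<close>

lemma velocity_in_tangent:
  assumes S: "open S" "0 \<in> S" and \<gamma>: "continuous_map (top_of_set S) T \<gamma>" "\<gamma> 0 = mat 1"
    and der: "(\<gamma> has_vector_derivative X) (at (0::real))"
  shows "X \<in> tangent"
proof -
  obtain \<psi> where \<psi>: "homeomorphic_maps (top_of_set (N \<inter> V)) (subtopology T (\<phi> ` (N \<inter> V))) \<phi> \<psi>"
    using homeo homeomorphic_map_maps by blast
  define c where "c = \<psi> \<circ> \<gamma>"
  define S' where "S' = {t \<in> S. \<gamma> t \<in> \<phi> ` (N \<inter> V)}"
  have "openin (top_of_set S) S'"
    using openin_continuous_map_preimage [OF \<gamma>(1) open_chart] by (simp add: S'_def)
  then have openS': "open S'" using S(1) by (simp add: openin_open_eq)
  have 0: "0 \<in> S'" using S(2) x0 \<gamma>(2) by (auto simp: S'_def image_iff intro!: bexI [of _ x0])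
  have "continuous_map (top_of_set S') (subtopology T (\<phi> ` (N \<inter> V))) \<gamma>"
    by (rule continuous_map_into_subtopology)
      (use \<gamma>(1) in \<open>auto simp: S'_def intro: continuous_map_from_subtopology_mono\<close>)
  then have "continuous_map (top_of_set S') (top_of_set (N \<inter> V)) c"
    unfolding c_def using \<psi> continuous_map_compose homeomorphic_maps_def by blast
  then have cont_c: "continuous_on S' c" and c_in: "\<And>t. t \<in> S' \<Longrightarrow> c t \<in> N \<inter> V"
    by (auto simp: continuous_map_in_subtopology image_subset_iff Pi_iff)
  have \<phi>c: "\<phi> (c t) = \<gamma> t" if "t \<in> S'" for t
  proof -
    have "\<gamma> t \<in> topspace (subtopology T (\<phi> ` (N \<inter> V)))"
      using that openin_subset [OF open_chart] by (auto simp: S'_def)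
    then show ?thesis using \<psi> by (auto simp: homeomorphic_maps_def c_def)
  qed
  have c0: "c 0 = x0" using \<psi> x0 \<gamma>(2) by (simp add: homeomorphic_maps_def c_def flip: x0(2))
  obtain m where m: "m > 0" "\<And>v. v \<in> V \<Longrightarrow> norm (D v) \<ge> m * norm v"
    using injective_imp_isometric [OF closed_subspace [OF V] V, of D] imm linear_D
    by (metis linear_conv_bounded_linear mult.commute)
  have c_lim: "(c \<longlongrightarrow> x0) (at 0)"
    using cont_c openS' 0 c0 by (metis continuous_on_eq_continuous_at isContD)
  have ev: "\<forall>\<^sub>F t in at 0. t \<in> S'"
    using openS' 0 by (simp add: eventually_at_topological) blast
  let ?y = "\<lambda>t. (1 / t) *\<^sub>R D (c t - x0)"
  have q: "((\<lambda>t. (1 / t) *\<^sub>R (\<gamma> t - mat 1)) \<longlongrightarrow> X) (at 0)"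
    using difference_quotient_tendsto [OF der] \<gamma>(2) by simp
  define M where "M = norm X + 1"
  have M: "M > 0" "\<forall>\<^sub>F t in at 0. norm ((1 / t) *\<^sub>R (\<gamma> t - mat 1)) \<le> M"
  proof -
    show "M > 0" by (simp add: M_def add_nonneg_pos)
    have "\<forall>\<^sub>F t in at 0. norm ((1 / t) *\<^sub>R (\<gamma> t - mat 1)) < M"
      using order_tendstoD(2) [OF tendsto_norm [OF q]] by (simp add: M_def)
    then show "\<forall>\<^sub>F t in at 0. norm ((1 / t) *\<^sub>R (\<gamma> t - mat 1)) \<le> M" by eventually_elim simp
  qed
  have "((\<lambda>t. (1 / t) *\<^sub>R (\<gamma> t - mat 1) - ?y t) \<longlongrightarrow> 0) (at 0)"
  proof (rule tendstoI)
    fix e :: real assume e: "e > 0"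
    \<comment> \<open>the first bound absorbs the error into the lower bound for \<open>D\<close>, the second one makes it small\<close>
    define \<epsilon> where "\<epsilon> = min (m/2) (e * m / (4 * M))"
    have \<epsilon>: "\<epsilon> > 0" using e m M by (simp add: \<epsilon>_def)
    have "\<forall>\<^sub>F x in nhds x0. norm (\<phi> x - \<phi> x0 - D (x - x0)) \<le> \<epsilon> * norm (x - x0)"
      using has_derivative_chart [of x0] x0 \<epsilon>
      unfolding has_derivative_at_alt eventually_nhds_metric dist_norm by blast
    then have "\<forall>\<^sub>F t in at 0. norm (\<phi> (c t) - \<phi> x0 - D (c t - x0)) \<le> \<epsilon> * norm (c t - x0)"
      using c_lim [unfolded filterlim_iff, rule_format] by blast
    moreover have "\<forall>\<^sub>F t in at (0::real). t \<noteq> 0" by (simp add: eventually_at_filter)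
    ultimately show "\<forall>\<^sub>F t in at 0. dist ((1 / t) *\<^sub>R (\<gamma> t - mat 1) - ?y t) 0 < e"
      using ev M(2)
    proof eventually_elim
      case (elim t)
      let ?d = "norm (c t - x0)"
      have 1: "norm (\<gamma> t - mat 1 - D (c t - x0)) \<le> \<epsilon> * ?d" using elim \<phi>c x0 by simp
      have "c t - x0 \<in> V" using c_in elim x0 V by (simp add: subspace_diff)
      then have "m * ?d \<le> norm (D (c t - x0))" using m by blast
      also have "\<dots> \<le> norm (\<gamma> t - mat 1) + norm (\<gamma> t - mat 1 - D (c t - x0))"
        by (metis norm_minus_commute norm_triangle_sub)
      also have "\<dots> \<le> norm (\<gamma> t - mat 1) + (m/2) * ?d"
        using 1 by (smt (verit) \<epsilon>_def min.cobounded1 mult_right_mono norm_ge_zero)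
      finally have "?d \<le> 2 / m * norm (\<gamma> t - mat 1)" using m by (simp add: field_simps)
      also have "\<dots> \<le> 2 / m * (M * \<bar>t\<bar>)"
      proof (rule mult_left_mono)
        have "norm (\<gamma> t - mat 1) = \<bar>t\<bar> * norm ((1 / t) *\<^sub>R (\<gamma> t - mat 1))"
          using elim by (simp del: scaleR_diff_right)
        also have "\<dots> \<le> \<bar>t\<bar> * M" using elim by (intro mult_left_mono) auto
        finally show "norm (\<gamma> t - mat 1) \<le> M * \<bar>t\<bar>" by (simp add: mult.commute)
      qed (use m in auto)
      finally have "\<epsilon> * ?d \<le> \<epsilon> * (2 / m * (M * \<bar>t\<bar>))" using \<epsilon> by (intro mult_left_mono) auto
      also have "\<dots> \<le> (e * m / (4 * M)) * (2 / m * (M * \<bar>t\<bar>))"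
        using m M by (intro mult_right_mono) (auto simp: \<epsilon>_def)
      also have "\<dots> = e / 2 * \<bar>t\<bar>" using m M by (simp add: field_simps)
      finally have "norm (\<gamma> t - mat 1 - D (c t - x0)) \<le> e / 2 * \<bar>t\<bar>" using 1 by simp
      then have "norm (\<gamma> t - mat 1 - D (c t - x0)) / \<bar>t\<bar> \<le> e / 2"
        using elim by (subst pos_divide_le_eq) auto
      then have "norm ((1 / t) *\<^sub>R (\<gamma> t - mat 1 - D (c t - x0))) \<le> e / 2"
        unfolding norm_scaleR by simp
      then show ?case using e by (simp add: scaleR_diff_right)
    qed
  qed
  from tendsto_diff [OF q this] have "(?y \<longlongrightarrow> X) (at 0)" by simp
  moreover have "\<forall>\<^sub>F t in at 0. ?y t \<in> tangent"
    using ev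
  proof eventually_elim
    case (elim t)
    then have "c t - x0 \<in> V" using c_in x0 V by (simp add: subspace_diff)
    then show ?case using subspace_tangent by (auto simp: tangent_def intro!: subspace_scale)
  qed
  ultimately show ?thesis
    by (intro Lim_in_closed_set [OF closed_subspace [OF subspace_tangent]]) auto
qed

lemma line_in_chart:
  assumes "x \<in> N \<inter> V" "v \<in> V"
  defines "S \<equiv> {t::real. x + t *\<^sub>R v \<in> N}"
  shows "open S" "0 \<in> S" "continuous_map (top_of_set S) T (\<lambda>t. \<phi> (x + t *\<^sub>R v))"
    "((\<lambda>t. \<phi> (x + t *\<^sub>R v)) has_vector_derivative frechet_derivative \<phi> (at x) v) (at 0)"
proof -
  have "S = (\<lambda>t. x + t *\<^sub>R v) -` N" by (auto simp: S_def)
  then show "open S" using N by (auto intro!: open_vimage continuous_intros)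
  show "0 \<in> S" using assms by (simp add: S_def)
  have "continuous_map (top_of_set S) (top_of_set (N \<inter> V)) (\<lambda>t. x + t *\<^sub>R v)"
    using assms V by (auto simp: continuous_map_in_subtopology S_def subspace_add subspace_scale
        intro!: continuous_intros)
  from continuous_map_compose [OF this chart_continuous]
  show "continuous_map (top_of_set S) T (\<lambda>t. \<phi> (x + t *\<^sub>R v))" by (simp add: o_def)
  have "((\<lambda>t. x + t *\<^sub>R v) has_vector_derivative v) (at 0)"
    by (auto intro!: derivative_eq_intros)
  moreover have "(\<phi> has_derivative frechet_derivative \<phi> (at x)) (at (x + 0 *\<^sub>R v))"
    using assms has_derivative_chart by simp
  ultimately show "((\<lambda>t. \<phi> (x + t *\<^sub>R v)) has_vector_derivative frechet_derivative \<phi> (at x) v) (at 0)"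
    using vector_derivative_diff_chain_within [of "\<lambda>t. x + t *\<^sub>R v" v 0 UNIV \<phi>]
    by (simp add: o_def has_derivative_at_withinI)
qed

lemma Ad_tangent:
  assumes A: "A \<in> G" and X: "X \<in> tangent"
  shows "A ** X ** matrix_inv A \<in> tangent"
proof -
  obtain v where v: "v \<in> V" "X = D v" using X by (auto simp: tangent_def)
  note line = line_in_chart [OF x0(1) v(1)]
  have "continuous_map (top_of_set {t. x0 + t *\<^sub>R v \<in> N}) T (\<lambda>t. A ** \<phi> (x0 + t *\<^sub>R v) ** matrix_inv A)"
    using continuous_map_compose [OF continuous_map_compose [OF line(3) left_mult [OF A]]
        right_mult [OF group_simps(3) [OF A]]] by (simp add: o_def)
  moreover have "((\<lambda>t. A ** \<phi> (x0 + t *\<^sub>R v) ** matrix_inv A) has_vector_derivative A ** X ** matrix_inv A) (at 0)"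
    unfolding v(2)
    by (intro bounded_linear.has_vector_derivative [OF bounded_linear_matrix_mult_left]
        bounded_linear.has_vector_derivative [OF bounded_linear_matrix_mult_right] line(4))
  ultimately show ?thesis
    using velocity_in_tangent [OF line(1,2)] A x0 by (simp add: group_simps)
qed

text \<open>
  Left translation by the inverse of \<open>\<phi> x\<close> moves a line in the chart to a curve through the identity.
\<close>

lemma chart_derivative:
  assumes x: "x \<in> N \<inter> V" and v: "v \<in> V"
  obtains Y where "Y \<in> tangent" "frechet_derivative \<phi> (at x) v = \<phi> x ** Y"
proof
  note line = line_in_chart [OF x v]
  let ?I = "matrix_inv (\<phi> x)"
  have A: "\<phi> x \<in> G" using x openin_subset [OF open_chart] topspace by auto
  have "continuous_map (top_of_set {t. x + t *\<^sub>R v \<in> N}) T (\<lambda>t. ?I ** \<phi> (x + t *\<^sub>R v))"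
    using continuous_map_compose [OF line(3) left_mult [OF group_simps(3) [OF A]]]
    by (simp add: o_def)
  moreover have "((\<lambda>t. ?I ** \<phi> (x + t *\<^sub>R v)) has_vector_derivative ?I ** frechet_derivative \<phi> (at x) v) (at 0)"
    by (intro bounded_linear.has_vector_derivative [OF bounded_linear_matrix_mult_right] line(4))
  ultimately show "?I ** frechet_derivative \<phi> (at x) v \<in> tangent"
    using velocity_in_tangent [OF line(1,2)] A by (simp add: group_simps)
  show "frechet_derivative \<phi> (at x) v = \<phi> x ** (?I ** frechet_derivative \<phi> (at x) v)"
    using A by (simp add: matrix_mul_assoc group_simps)
qed

lemma chart_image_open:
  assumes "open B" shows "openin T (\<phi> ` (N \<inter> V \<inter> B))"
proof -
  have "openin (top_of_set (N \<inter> V)) (N \<inter> V \<inter> B)" using assms by blast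
  then have "openin (subtopology T (\<phi> ` (N \<inter> V))) (\<phi> ` (N \<inter> V \<inter> B))"
    using homeo homeomorphic_imp_open_map open_map_def by blast
  then show ?thesis using open_chart openin_trans_full by blast
qed

text \<open>
  Along a segment in the chart the vector \<open>\<phi> w\<close> has derivative \<open>\<phi> Y w = 0\<close> with \<open>Y \<in> tangent\<close>. Hence
  \<open>A \<mapsto> A w\<close> is constant near the identity, and by translation it is locally constant on the
  connected group.
\<close>

lemma killed_imp_fixed:
  assumes w: "\<And>X. X \<in> tangent \<Longrightarrow> X *v w = 0" and A: "A \<in> G"
  shows "A *v w = w"
proof -
  obtain r where r: "r > 0" "ball x0 r \<subseteq> N" using N x0 open_contains_ball by blast
  define U where "U = \<phi> ` (N \<inter> V \<inter> ball x0 r)"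
  have openU: "openin T U" unfolding U_def by (rule chart_image_open) simp
  have oneU: "mat 1 \<in> U" using x0 r by (auto simp: U_def image_iff intro!: bexI [of _ x0])
  have U: "B *v w = w" if B: "B \<in> U" for B
  proof -
    obtain x where x: "x \<in> V" "x \<in> ball x0 r" "B = \<phi> x" using B unfolding U_def by blast
    let ?v = "x - x0"
    let ?x = "\<lambda>t. x0 + t *\<^sub>R ?v"
    have v: "?v \<in> V" using x x0 V by (simp add: subspace_diff)
    have x_in: "?x t \<in> N \<inter> V" if "t \<in> {0..1}" for t
    proof -
      have "\<bar>t\<bar> * norm ?v \<le> norm ?v" using that by (intro mult_left_le_one_le) auto
      also have "\<dots> < r" using x(2) by (simp add: dist_norm norm_minus_commute)
      finally have "?x t \<in> ball x0 r" by (simp add: dist_norm)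
      then have "?x t \<in> N" using r by blast
      moreover have "?x t \<in> V" using v x0 V by (simp add: subspace_add subspace_scale)
      ultimately show ?thesis by blast
    qed
    have "((\<lambda>t. \<phi> (?x t) *v w) has_vector_derivative 0) (at t within {0..1})" if t: "t \<in> {0..1}" for t
    proof -
      obtain Y where Y: "Y \<in> tangent" "frechet_derivative \<phi> (at (?x t)) ?v = \<phi> (?x t) ** Y"
        using chart_derivative [OF x_in [OF t] v] by blast
      have "(?x has_vector_derivative ?v) (at t within {0..1})"
        by (auto intro!: derivative_eq_intros)
      moreover have "(\<phi> has_derivative frechet_derivative \<phi> (at (?x t))) (at (?x t) within ?x ` {0..1})"
        using x_in [OF t] has_derivative_chart by (simp add: has_derivative_at_withinI)
      ultimately have "(\<phi> \<circ> ?x has_vector_derivative frechet_derivative \<phi> (at (?x t)) ?v) (at t within {0..1})"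
        by (rule vector_derivative_diff_chain_within)
      then have "((\<lambda>t. \<phi> (?x t) *v w) has_vector_derivative frechet_derivative \<phi> (at (?x t)) ?v *v w) (at t within {0..1})"
        unfolding o_def by (rule bounded_linear.has_vector_derivative
            [OF bounded_bilinear.bounded_linear_left [OF bounded_bilinear_matrix_vector_mult]])
      moreover have "frechet_derivative \<phi> (at (?x t)) ?v *v w = 0"
        using Y w by (simp flip: matrix_vector_mul_assoc)
      ultimately show ?thesis by simp
    qed
    then obtain c where c: "\<And>t. t \<in> {0..1} \<Longrightarrow> \<phi> (?x t) *v w = c"
      using has_vector_derivative_zero_constant [of "{0..1}" "\<lambda>t. \<phi> (?x t) *v w"] by auto
    have "\<phi> (?x 1) *v w = \<phi> (?x 0) *v w" using c [of 0] c [of 1] by simp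
    then show ?thesis using x x0 by simp
  qed
  define F where "F = {A \<in> G. A *v w = w}"
  have pre: "openin T {B \<in> G. matrix_inv A ** B \<in> U}" if "A \<in> G" for A
    using openin_continuous_map_preimage [OF left_mult [OF group_simps(3)[OF that]] openU] topspace by simp
  have same: "B *v w = A *v w" if "A \<in> G" "B \<in> G" "matrix_inv A ** B \<in> U" for A B
  proof -
    have "B *v w = A *v ((matrix_inv A ** B) *v w)"
      using that by (simp add: matrix_vector_mul_assoc matrix_mul_assoc group_simps)
    then show ?thesis using U [OF that(3)] by simp
  qed
  have "openin T F"
  proof (subst openin_subopen, intro ballI)
    fix A assume "A \<in> F"
    then have A: "A \<in> G" by (simp add: F_def)
    have "{B \<in> G. matrix_inv A ** B \<in> U} \<subseteq> F"
      using same [OF A] \<open>A \<in> F\<close> unfolding F_def by auto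
    moreover have "A \<in> {B \<in> G. matrix_inv A ** B \<in> U}" using A oneU group_simps by simp
    ultimately show "\<exists>S. openin T S \<and> A \<in> S \<and> S \<subseteq> F" using pre [OF A] by blast
  qed
  moreover have "closedin T F"
  proof -
    have "openin T (G - F)"
    proof (subst openin_subopen, intro ballI)
      fix A assume "A \<in> G - F"
      then have A: "A \<in> G" by (simp add: F_def)
      have "{B \<in> G. matrix_inv A ** B \<in> U} \<subseteq> G - F"
        using same [OF A] \<open>A \<in> G - F\<close> unfolding F_def by auto
      moreover have "A \<in> {B \<in> G. matrix_inv A ** B \<in> U}" using A oneU group_simps by simp
      ultimately show "\<exists>S. openin T S \<and> A \<in> S \<and> S \<subseteq> G - F" using pre [OF A] by blast
    qed
    then show ?thesis by (auto simp: closedin_def topspace F_def)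
  qed
  ultimately have "F = {} \<or> F = G"
    using connected by (simp add: connected_space_clopen_in topspace)
  moreover have "mat 1 \<in> F" by (simp add: F_def group_simps)
  ultimately show ?thesis using A by (auto simp: F_def)
qed

text \<open>
  Composed with the chart, \<open>A \<mapsto> A - A\<^sup>-\<^sup>1\<close> is an injective continuous map between spaces of the same
  dimension, so by invariance of domain it is open. Every element of \<open>H\<close> near the identity therefore
  has the same image as some element of \<open>G\<close> near the identity, and equals it.
\<close>

lemma contains_component:
  assumes H: "matrix_group H" "G \<subseteq> H" "\<And>A. A \<in> H \<Longrightarrow> A - matrix_inv A \<in> tangent"
  shows "connected_component_set H (mat 1) \<subseteq> G"
proof -
  note H_simps = matrix_group_simps [OF H(1)]
  have invertibleH: "invertible A" if "A \<in> H" for A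
    using H(1) that by (auto simp: matrix_group_def)
  obtain \<epsilon> where \<epsilon>: "\<epsilon> > 0" and inj: "\<And>A B :: real^'n^'n. norm (A - mat 1) < \<epsilon> \<Longrightarrow> norm (B - mat 1) < \<epsilon> \<Longrightarrow>
           invertible A \<Longrightarrow> invertible B \<Longrightarrow> A - matrix_inv A = B - matrix_inv B \<Longrightarrow> A = B"
    using minus_inverse_locally_injective by blast
  have cont\<phi>: "continuous_on (N \<inter> V) \<phi>"
    using continuous_map_compose [OF chart_continuous finer] by (simp add: o_def)
  have contI: "continuous_on (N \<inter> V) (\<lambda>x. matrix_inv (\<phi> x))"
    using continuous_map_compose [OF chart_continuous continuous_map_compose [OF inv finer]]
    by (simp add: o_def)
  define W where "W = N \<inter> V \<inter> \<phi> -` ball (mat 1) \<epsilon>"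
  have W: "W \<subseteq> N \<inter> V" by (auto simp: W_def)
  have "openin (top_of_set (N \<inter> V)) W"
    unfolding W_def by (rule continuous_openin_preimage_gen [OF cont\<phi>]) simp
  moreover have "openin (top_of_set V) (N \<inter> V)" using N by (metis Int_commute openin_open_Int)
  ultimately have openW: "openin (top_of_set V) W" using openin_trans by blast
  have inG: "\<phi> x \<in> G" if "x \<in> W" for x
    using that openin_subset [OF open_chart] topspace by (auto simp: W_def)
  let ?f = "\<lambda>x. \<phi> x - matrix_inv (\<phi> x)"
  have near: "norm (\<phi> x - mat 1) < \<epsilon>" if "x \<in> W" for x
    using that by (simp add: W_def dist_norm norm_minus_commute)
  have "inj_on \<phi> (N \<inter> V)" using homeo homeomorphic_imp_injective_map by fastforce
  then have "inj_on ?f W"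
    unfolding inj_on_def using inj near inG W invertibleH H(2) by (metis (no_types, lifting) subset_iff)
  moreover have "continuous_on W ?f"
    using W by (auto intro!: continuous_intros intro: continuous_on_subset cont\<phi> contI)
  moreover have "?f \<in> W \<rightarrow> tangent" using inG H by auto
  ultimately have "openin (top_of_set tangent) (?f ` W)"
    using openW V subspace_tangent dim_tangent by (intro invariance_of_domain_subspaces [of V]) auto
  moreover have "0 \<in> ?f ` W"
    using x0 \<epsilon> matrix_inv_eqI(1) [of "mat 1 :: real^'n^'n" "mat 1"]
    by (auto simp: W_def image_iff intro!: bexI [of _ x0])
  ultimately obtain e where e: "e > 0" "ball 0 e \<inter> tangent \<subseteq> ?f ` W"
    unfolding openin_contains_ball by blast
  obtain d where d: "d > 0" "\<And>A :: real^'n^'n. invertible A \<Longrightarrow> norm (A - mat 1) < d \<Longrightarrow>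
    norm (A - matrix_inv A) < e"
    using matrix_inv_close_to_one [OF e(1)] by blast
  have near_one: "A \<in> G" if A: "A \<in> H" "norm (A - mat 1) < min d \<epsilon>" for A
  proof -
    have "A - matrix_inv A \<in> ?f ` W" using e d A H(3) invertibleH by (auto simp: subset_iff)
    then obtain x where "x \<in> W" "A - matrix_inv A = ?f x" by blast
    moreover have "\<phi> x \<in> H" using inG H(2) \<open>x \<in> W\<close> by blast
    ultimately have "A = \<phi> x" using inj [of A "\<phi> x"] A near invertibleH by auto
    then show ?thesis using inG \<open>x \<in> W\<close> by simp
  qed
  \<comment> \<open>membership in \<open>G\<close> is locally constant on \<open>H\<close>, as \<open>G\<close> contains a neighbourhood of the identity in \<open>H\<close>\<close>
  have loc: "\<exists>U. openin (top_of_set S) U \<and> A \<in> U \<and> (\<forall>B\<in>U. B \<in> G \<longleftrightarrow> A \<in> G)"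
    if "S \<subseteq> H" "A \<in> S" for S A
  proof -
    let ?U = "S \<inter> (\<lambda>B. matrix_inv A ** B) -` ball (mat 1) (min d \<epsilon>)"
    have A: "A \<in> H" using that by blast
    have "openin (top_of_set S) ?U"
      by (rule continuous_openin_preimage_gen)
        (auto intro!: linear_continuous_on bounded_linear_matrix_mult_right)
    moreover have "A \<in> ?U" using that A d \<epsilon> by (simp add: H_simps)
    moreover have "B \<in> G \<longleftrightarrow> A \<in> G" if B: "B \<in> ?U" for B
    proof -
      have "matrix_inv A ** B \<in> H" using A B \<open>S \<subseteq> H\<close> by (auto simp: H_simps)
      then have C: "matrix_inv A ** B \<in> G"
        using B by (intro near_one) (auto simp: dist_norm norm_minus_commute)
      have "B = A ** (matrix_inv A ** B)" using A by (simp add: matrix_mul_assoc H_simps)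
      moreover have "A = B ** matrix_inv (matrix_inv A ** B)"
        using C \<open>B = _\<close> by (metis group_simps(4) matrix_mul_assoc matrix_mul_rid)
      ultimately show ?thesis using C by (metis group_simps(2,3))
    qed
    ultimately show ?thesis by blast
  qed
  show ?thesis
  proof
    fix A assume "A \<in> connected_component_set H (mat 1)"
    then obtain S where S: "connected S" "S \<subseteq> H" "mat 1 \<in> S" "A \<in> S"
      by (auto simp: connected_component_def)
    show "A \<in> G"
    proof (rule connected_induction_simple [of S "mat 1" A "\<lambda>B. B \<in> G", OF S(1,3,4)])
      show "mat 1 \<in> G" by (rule group_simps)
      fix B assume "B \<in> S"
      from loc [OF S(2) this] obtain U where "openin (top_of_set S) U" "B \<in> U" "\<forall>C\<in>U. C \<in> G \<longleftrightarrow> B \<in> G"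
        by (elim exE conjE)
      then show "\<exists>U. openin (top_of_set S) U \<and> B \<in> U \<and> (\<forall>x\<in>U. \<forall>y\<in>U. x \<in> G \<longrightarrow> y \<in> G)"
        by metis
    qed
  qed
qed

end

lemma lie_subgroup_imp_lie_pair:
  assumes "lie_subgroup G T" "connected_space T"
  obtains g where "lie_pair G g"
proof -
  from assms(1) obtain k where G: "matrix_group G" "topspace T = G" "immersed_submanifold immersion_on k T"
    "continuous_map (prod_topology T T) T (\<lambda>(A, B). A ** B)" "continuous_map T T matrix_inv"
    unfolding lie_subgroup_def by blast
  have "mat 1 \<in> topspace T" using G by (simp add: matrix_group_def)
  from bspec [OF conjunct2 [OF conjunct2 [OF G(3) [unfolded immersed_submanifold_def]]] this]
  obtain V N \<phi> where ch: "subspace V" "immersion_on V N \<phi>" "mat 1 \<in> \<phi> ` (N \<inter> V)"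
    "openin T (\<phi> ` (N \<inter> V))"
    "homeomorphic_map (top_of_set (N \<inter> V)) (subtopology T (\<phi> ` (N \<inter> V))) \<phi>"
    by (elim exE conjE)
  then obtain x0 where x0: "x0 \<in> N \<inter> V" "\<phi> x0 = mat 1" by force
  have N: "open N" and "Ck_on (Suc 0) N \<phi>" and imm: "\<And>v. v \<in> V \<Longrightarrow> frechet_derivative \<phi> (at x0) v = 0 \<Longrightarrow> v = 0"
    using ch(2) x0 unfolding immersion_on_def smooth_on_def by blast+
  then interpret lie_chart G V N T \<phi> x0
    using G ch x0 assms(2) immersed_submanifold_finer [OF G(3)] by unfold_locales auto
  have "connectedin T (topspace T)" using connected by (simp add: connectedin_topspace)
  from connectedin_continuous_map_image [OF finer this]
  have "connected G" by (simp add: topspace)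
  moreover have "\<exists>\<gamma>. \<gamma> 0 = mat 1 \<and> (\<forall>\<^sub>F t in at 0. \<gamma> t \<in> G) \<and> (\<gamma> has_vector_derivative X) (at (0::real))"
    if X: "X \<in> tangent" for X
  proof -
    obtain v where v: "v \<in> V" "X = D v" using X by (auto simp: tangent_def)
    note line = line_in_chart [OF x0(1) v(1)]
    let ?S = "{t. x0 + t *\<^sub>R v \<in> N}"
    have "\<forall>\<^sub>F t in at 0. t \<in> ?S"
      using eventually_nhds_in_open [OF line(1,2)] by (rule filter_leD [OF at_within_le_nhds])
    moreover have "\<phi> (x0 + t *\<^sub>R v) \<in> G" if "t \<in> ?S" for t
      using continuous_map_image_subset_topspace [OF line(3)] that
      unfolding topspace topspace_euclidean_subtopology by blast
    ultimately have "\<forall>\<^sub>F t in at 0. \<phi> (x0 + t *\<^sub>R v) \<in> G"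
      by (rule eventually_mono)
    moreover have "\<phi> (x0 + 0 *\<^sub>R v) = mat 1" using x0 by simp
    ultimately show ?thesis
      using line(4) unfolding v(2) by (intro exI [of _ "\<lambda>t. \<phi> (x0 + t *\<^sub>R v)"] conjI)
  qed
  ultimately have "lie_pair G tangent"
    unfolding lie_pair_def
    by (intro conjI ballI allI impI group subspace_tangent)
      (simp_all add: Ad_tangent killed_imp_fixed contains_component)
  then show thesis by (rule that)
qed

section \<open>Complex three-space with its cross product\<close>

lemma exhaust_5: fixes x :: 5 shows "x = 1 \<or> x = 2 \<or> x = 3 \<or> x = 4 \<or> x = 5"
proof (induct x)
  case (of_int z)
  then have "0 \<le> z" and "z < 5" by simp_all
  then have "z = 0 \<or> z = 1 \<or> z = 2 \<or> z = 3 \<or> z = 4" by arith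
  then show ?case by auto
qed

lemma forall_5: "(\<forall>i::5. P i) \<longleftrightarrow> P 1 \<and> P 2 \<and> P 3 \<and> P 4 \<and> P 5"
  by (metis exhaust_5)

lemma UNIV_5: "(UNIV::5 set) = {1, 2, 3, 4, 5}" using exhaust_5 by auto

lemma sum_5: "sum f (UNIV::5 set) = f 1 + f 2 + f 3 + f 4 + f 5"
  unfolding UNIV_5 by (simp add: add.assoc)

definition cdot :: "complex^3 \<Rightarrow> complex^3 \<Rightarrow> complex" where
  "cdot F Y = F$1 * Y$1 + F$2 * Y$2 + F$3 * Y$3"

definition ccross :: "complex^3 \<Rightarrow> complex^3 \<Rightarrow> complex^3" where
  "ccross F Y = vector [F$2 * Y$3 - F$3 * Y$2, F$3 * Y$1 - F$1 * Y$3, F$1 * Y$2 - F$2 * Y$1]"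

lemma ccross_nth [simp]:
  "ccross F Y $ 1 = F$2 * Y$3 - F$3 * Y$2" "ccross F Y $ 2 = F$3 * Y$1 - F$1 * Y$3"
  "ccross F Y $ 3 = F$1 * Y$2 - F$2 * Y$1"
  by (simp_all add: ccross_def)

lemmas complex3_simps = vec_eq_iff forall_3 cdot_def

lemma cdot_commute: "cdot F Y = cdot Y F"
  by (simp add: cdot_def)

lemma cdot_linear:
  "cdot (F + Y) Z = cdot F Z + cdot Y Z" "cdot Z (F + Y) = cdot Z F + cdot Z Y"
  "cdot (F - Y) Z = cdot F Z - cdot Y Z" "cdot Z (F - Y) = cdot Z F - cdot Z Y"
  "cdot (c *s F) Y = c * cdot F Y" "cdot F (c *s Y) = c * cdot F Y"
  "cdot (r *\<^sub>R F) Y = of_real r * cdot F Y" "cdot F (r *\<^sub>R Y) = of_real r * cdot F Y"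
  by (simp_all add: cdot_def scaleR_conv_of_real[where 'a=complex] algebra_simps)

lemma ccross_linear:
  "ccross (F + Y) Z = ccross F Z + ccross Y Z" "ccross Z (F + Y) = ccross Z F + ccross Z Y"
  "ccross (c *s F) Y = c *s ccross F Y" "ccross F (c *s Y) = c *s ccross F Y"
  "ccross F F = 0"
  by (simp_all add: complex3_simps algebra_simps)

lemma ccross_anticommute: "ccross F Y = - ccross Y F"
  by (simp add: complex3_simps)

lemma ccross_ccross: "ccross F (ccross F' Y) = cdot F Y *s F' - cdot F F' *s Y"
  by (simp add: complex3_simps algebra_simps)

lemma cdot_ccross_ccross:
  "cdot (ccross F Y) (ccross F Y) = cdot F F * cdot Y Y - cdot F Y * cdot F Y"
  by (simp add: complex3_simps algebra_simps)

lemma ccross_eq_0_imp_multiple: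
  assumes "W \<noteq> 0" "ccross W Y = 0"
  obtains \<mu> where "Y = \<mu> *s W"
proof -
  have e: "W$2 * Y$3 = W$3 * Y$2" "W$3 * Y$1 = W$1 * Y$3" "W$1 * Y$2 = W$2 * Y$1"
    using assms(2) by (simp_all add: complex3_simps)
  consider "W$1 \<noteq> 0" | "W$2 \<noteq> 0" | "W$3 \<noteq> 0" using assms(1) by (auto simp: complex3_simps)
  then have "\<exists>\<mu>. Y = \<mu> *s W"
  proof cases
    case 1 then show ?thesis using e by (intro exI [of _ "Y$1 / W$1"]) (simp add: complex3_simps field_simps)
  next
    case 2 then show ?thesis using e by (intro exI [of _ "Y$2 / W$2"]) (simp add: complex3_simps field_simps)
  next
    case 3 then show ?thesis using e by (intro exI [of _ "Y$3 / W$3"]) (simp add: complex3_simps field_simps)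
  qed
  then show thesis using that by blast
qed

text \<open>
  A totally isotropic subspace of \<open>\<complex>\<^sup>3\<close> has dimension at most one: by the double cross product
  identity both vectors are parallel to their cross product.
\<close>

lemma isotropic_imp_ccross_0:
  assumes "cdot Y Y = 0" "cdot Z Z = 0" "cdot Y Z = 0"
  shows "ccross Y Z = 0"
proof (rule ccontr)
  let ?W = "ccross Y Z"
  assume W: "?W \<noteq> 0"
  have "ccross ?W Y = 0" "ccross ?W Z = 0"
    unfolding ccross_anticommute [of ?W] ccross_ccross using assms by (simp_all add: cdot_commute)
  then obtain \<mu> \<nu> where "Y = \<mu> *s ?W" "Z = \<nu> *s ?W"
    using ccross_eq_0_imp_multiple [OF W] by metis
  then have "?W = (\<mu> * \<nu>) *s ccross ?W ?W" by (metis ccross_linear(3,4) vector_smult_assoc)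
  then show False using W by (simp add: ccross_linear)
qed

text \<open>
  If two elements of the proper complex subspace \<open>c\<close> have a nonzero cross product \<open>n\<close>, then \<open>c\<close> is the
  plane orthogonal to \<open>n\<close>, and the line of \<open>n\<close> is stable because it contains all cross products of
  elements of \<open>c\<close>. Otherwise \<open>c\<close> itself is a line.
\<close>

lemma stable_complex_line:
  assumes c: "\<And>F Y. F \<in> c \<Longrightarrow> Y \<in> c \<Longrightarrow> F + Y \<in> c" "\<And>a F. F \<in> c \<Longrightarrow> a *s F \<in> c"
    and proper: "c \<noteq> UNIV" "F0 \<in> c" "F0 \<noteq> 0"
    and stable: "\<And>\<rho> F. \<rho> \<in> R \<Longrightarrow> F \<in> c \<Longrightarrow> \<rho> F \<in> c"
    and cross: "\<And>\<rho> F Y. \<rho> \<in> R \<Longrightarrow> \<rho> (ccross F Y) = ccross (\<rho> F) (\<rho> Y)"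
  obtains Z where "Z \<noteq> 0" "\<And>\<rho>. \<rho> \<in> R \<Longrightarrow> \<exists>\<mu>. \<rho> Z = \<mu> *s Z"
proof (cases "\<forall>F\<in>c. \<forall>Y\<in>c. ccross F Y = 0")
  case True
  have "\<exists>\<mu>. \<rho> F0 = \<mu> *s F0" if "\<rho> \<in> R" for \<rho>
    using ccross_eq_0_imp_multiple [OF proper(3), of "\<rho> F0"] True stable that proper(2) by metis
  then show ?thesis using that proper(3) by blast
next
  case False
  then obtain F Y where FY: "F \<in> c" "Y \<in> c" "ccross F Y \<noteq> 0" by blast
  define n where "n = ccross F Y"
  have orth: "cdot U n = 0" if U: "U \<in> c" for U
  proof (rule ccontr)
    assume d: "cdot U n \<noteq> 0"
    \<comment> \<open>Cramer's rule: \<open>U, F, Y\<close> would be a basis\<close>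
    have "V \<in> c" for V
    proof -
      define W where "W = cdot V n *s U + (cdot V (ccross Y U) *s F + cdot V (ccross U F) *s Y)"
      have "W = cdot U n *s V" unfolding W_def n_def by (simp add: complex3_simps algebra_simps)
      moreover have "W \<in> c" unfolding W_def by (intro c U FY)
      ultimately have "(1 / cdot U n) *s (cdot U n *s V) \<in> c" by (metis c(2))
      then show "V \<in> c" using d by (simp add: vector_smult_assoc)
    qed
    then show False using proper(1) by blast
  qed
  have "\<exists>\<mu>. \<rho> n = \<mu> *s n" if "\<rho> \<in> R" for \<rho>
  proof -
    have "ccross n (\<rho> n) = 0"
      unfolding n_def cross [OF that] unfolding ccross_ccross
      using orth stable [OF that] FY by (simp add: n_def cdot_commute)
    then show ?thesis using ccross_eq_0_imp_multiple FY(3) unfolding n_def by metis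
  qed
  then show ?thesis using that FY(3) n_def by blast
qed

lemma complex_smult_split: "c *s F = Re c *\<^sub>R F + Im c *\<^sub>R (\<i> *s F)" for F :: "complex^3"
  by (simp add: complex3_simps complex_eq_iff)

text \<open>
  If \<open>F\<close> and \<open>Y\<close> lie in a totally real subalgebra, so does \<open>F \<times> (F \<times> Y) = (F \<cdot> Y) F - (F \<cdot> F) Y\<close>. Its
  imaginary part \<open>Im (F \<cdot> Y) F - Im (F \<cdot> F) Y\<close> must vanish, and therefore the dot product is real on \<open>p\<close>. To
  generate \<open>p\<close> by two elements and their cross product, start from a non-isotropic \<open>F\<close>. If its
  orthogonal complement in \<open>p\<close> has a non-isotropic element \<open>Y\<close>, then \<open>F, Y, F \<times> Y\<close> is an orthogonal
  basis of \<open>\<complex>\<^sup>3\<close> with real dot products; if the complement is totally isotropic, it is a line.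
\<close>

lemma real_form_generators:
  assumes p: "subspace p" and cross: "\<And>F Y. F \<in> p \<Longrightarrow> Y \<in> p \<Longrightarrow> ccross F Y \<in> p"
    and tot: "\<And>F. F \<in> p \<Longrightarrow> \<i> *s F \<in> p \<Longrightarrow> F = 0"
    and F0: "F0 \<in> p" "F0 \<noteq> 0" and Y0: "Y0 \<in> p" "\<And>r. Y0 \<noteq> r *\<^sub>R F0"
  obtains F Y where "cdot F F \<in> \<real>" "cdot Y Y \<in> \<real>" "cdot F Y \<in> \<real>"
    "\<And>U. U \<in> p \<Longrightarrow> \<exists>a b c. U = a *\<^sub>R F + b *\<^sub>R Y + c *\<^sub>R ccross F Y"
proof -
  have indep_real: "cdot F F \<in> \<real> \<and> cdot F Y \<in> \<real>"
    if F: "F \<in> p" "F \<noteq> 0" and Y: "Y \<in> p" "\<And>r. Y \<noteq> r *\<^sub>R F" for F Y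
  proof -
    \<comment> \<open>the imaginary part of the double cross product; both \<open>E\<close> and \<open>\<i> E\<close> lie in \<open>p\<close>\<close>
    define E where "E = Im (cdot F Y) *\<^sub>R F - Im (cdot F F) *\<^sub>R Y"
    have E: "E \<in> p" unfolding E_def using p F Y by (simp add: subspace_diff subspace_scale)
    have "ccross F (ccross F Y) \<in> p" using cross F Y by blast
    moreover have "ccross F (ccross F Y) = (Re (cdot F Y) *\<^sub>R F - Re (cdot F F) *\<^sub>R Y) + \<i> *s E"
      unfolding ccross_ccross E_def by (subst (1 2) complex_smult_split) (simp add: complex3_simps algebra_simps)
    moreover have "Re (cdot F Y) *\<^sub>R F - Re (cdot F F) *\<^sub>R Y \<in> p"
      using p F Y by (simp add: subspace_diff subspace_scale)
    ultimately have "\<i> *s E \<in> p" using p by (metis add_diff_cancel_left' subspace_diff)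
    then have "E = 0" using E tot by blast
    then have eq: "Im (cdot F F) *\<^sub>R Y = Im (cdot F Y) *\<^sub>R F" by (simp add: E_def)
    have 1: "Im (cdot F F) = 0"
    proof (rule ccontr)
      assume "Im (cdot F F) \<noteq> 0"
      then have "Y = (Im (cdot F Y) / Im (cdot F F)) *\<^sub>R F"
        using eq by (metis divideR_right divide_inverse_commute scaleR_scaleR)
      then show False using Y(2) by blast
    qed
    with eq F(2) have "Im (cdot F Y) = 0" by simp
    with 1 show ?thesis by (simp add: complex_is_Real_iff)
  qed
  have real_dot: "cdot F Y \<in> \<real>" if "F \<in> p" "Y \<in> p" for F Y
  proof (cases "F = 0")
    case True then show ?thesis by (simp add: cdot_def)
  next
    case False
    show ?thesis
    proof (cases "\<exists>r. Y = r *\<^sub>R F")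
      case True
      then obtain r where r: "Y = r *\<^sub>R F" by blast
      have "\<exists>Y'\<in>p. \<forall>s. Y' \<noteq> s *\<^sub>R F"
      proof (rule ccontr)
        assume "\<not> ?thesis"
        then obtain a b where "F0 = a *\<^sub>R F" "Y0 = b *\<^sub>R F" using F0 Y0 by metis
        moreover from this have "a \<noteq> 0" using F0 by auto
        ultimately have "Y0 = (b / a) *\<^sub>R F0" by simp
        then show False using Y0 by blast
      qed
      then have "cdot F F \<in> \<real>" using indep_real False that by blast
      then show ?thesis by (simp add: r cdot_linear)
    next
      case False
      then show ?thesis using indep_real [of F Y] that \<open>F \<noteq> 0\<close> by blast
    qed
  qed
  have parallel_dependent: "\<exists>r. Z = r *\<^sub>R Y"
    if YZ: "Y \<in> p" "Z \<in> p" "Y \<noteq> 0" "ccross Y Z = 0" for Y Z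
  proof -
    obtain \<mu> where \<mu>: "Z = \<mu> *s Y" using ccross_eq_0_imp_multiple [OF YZ(3,4)] .
    then have Z: "Z = Re \<mu> *\<^sub>R Y + \<i> *s (Im \<mu> *\<^sub>R Y)"
      using complex_smult_split [of \<mu> Y] by (simp add: complex3_simps)
    then have "\<i> *s (Im \<mu> *\<^sub>R Y) \<in> p"
      using p that by (metis add_diff_cancel_left' subspace_diff subspace_scale)
    then have "Im \<mu> *\<^sub>R Y = 0" using tot [OF subspace_scale [OF p YZ(1)]] by blast
    then show ?thesis using Z by (metis add.right_neutral vector_smult_rzero)
  qed
  obtain F where F: "F \<in> p" "cdot F F \<noteq> 0"
  proof -
    have False if null: "\<And>F. F \<in> p \<Longrightarrow> cdot F F = 0"
    proof -
      have "cdot (F0 + Y0) (F0 + Y0) = 0" using null p F0 Y0 by (simp add: subspace_add)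
      then have "cdot F0 Y0 = 0"
        using null F0 Y0 by (simp add: cdot_linear cdot_commute [of Y0 F0])
      then have "ccross F0 Y0 = 0" using isotropic_imp_ccross_0 null F0 Y0 by blast
      then show False using parallel_dependent F0 Y0 by blast
    qed
    then show thesis using that by blast
  qed
  \<comment> \<open>the orthogonal projection to the complement of \<open>F\<close>\<close>
  define \<pi> where "\<pi> U = U - Re (cdot U F / cdot F F) *\<^sub>R F" for U
  have re: "of_real (Re (cdot U F / cdot F F)) = cdot U F / cdot F F" if "U \<in> p" for U
    using real_dot F that by (intro of_real_Re Reals_divide) auto
  have \<pi>: "\<pi> U \<in> p" "cdot F (\<pi> U) = 0" if "U \<in> p" for U
    using p F that re [OF that]
    by (simp_all add: \<pi>_def subspace_diff subspace_scale cdot_linear cdot_commute [of F U])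
  show thesis
  proof (cases "\<exists>Y\<in>p. cdot F Y = 0 \<and> cdot Y Y \<noteq> 0")
    case True
    then obtain Y where Y: "Y \<in> p" "cdot F Y = 0" "cdot Y Y \<noteq> 0" by blast
    let ?n = "ccross F Y"
    have n: "?n \<in> p" "cdot ?n ?n = cdot F F * cdot Y Y"
      using cross F Y by (simp_all add: cdot_ccross_ccross)
    have "\<exists>a b c. U = a *\<^sub>R F + b *\<^sub>R Y + c *\<^sub>R ?n" if U: "U \<in> p" for U
    proof -
      have "(cdot F F * cdot Y Y) *s U
          = (cdot U F * cdot Y Y) *s F + (cdot U Y * cdot F F) *s Y + cdot U ?n *s ?n"
      proof -
        have "(cdot F F * cdot Y Y - cdot F Y * cdot F Y) *s U
          = (cdot U F * cdot Y Y - cdot U Y * cdot F Y) *s F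
            + (cdot U Y * cdot F F - cdot U F * cdot F Y) *s Y + cdot U ?n *s ?n"
          by (simp add: complex3_simps algebra_simps)
        then show ?thesis using Y by simp
      qed
      then have "(1 / (cdot F F * cdot Y Y)) *s ((cdot F F * cdot Y Y) *s U)
        = (1 / (cdot F F * cdot Y Y)) *s ((cdot U F * cdot Y Y) *s F + (cdot U Y * cdot F F) *s Y + cdot U ?n *s ?n)"
        by simp
      then have "U = (cdot U F / cdot F F) *s F + (cdot U Y / cdot Y Y) *s Y
          + (cdot U ?n / (cdot F F * cdot Y Y)) *s ?n"
        using F(2) Y(3) by (simp add: vector_smult_assoc vector_add_ldistrib field_simps)
      moreover have "cdot U F / cdot F F \<in> \<real>" "cdot U Y / cdot Y Y \<in> \<real>"
        "cdot U ?n / (cdot F F * cdot Y Y) \<in> \<real>"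
        using real_dot U F Y n by (auto intro!: Reals_divide Reals_mult)
      moreover have "c *s W = Re c *\<^sub>R W" if "c \<in> \<real>" for c and W :: "complex^3"
        using that by (subst complex_smult_split) (simp add: complex_is_Real_iff)
      ultimately show ?thesis by metis
    qed
    then show thesis using that [of F Y] real_dot F Y by blast
  next
    case False
    then have null: "cdot Y Y = 0" if "Y \<in> p" "cdot F Y = 0" for Y using that by blast
    obtain Y1 where Y1: "Y1 \<in> p" "\<And>r. Y1 \<noteq> r *\<^sub>R F"
    proof (cases "\<exists>r. Y0 = r *\<^sub>R F")
      case True
      have "F0 \<noteq> s *\<^sub>R F" for s
      proof
        assume s: "F0 = s *\<^sub>R F"
        then have "s \<noteq> 0" using F0 by auto
        moreover obtain r where "Y0 = r *\<^sub>R F" using True by blast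
        ultimately have "Y0 = (r / s) *\<^sub>R F0" using s by simp
        then show False using Y0 by blast
      qed
      then show ?thesis using that F0 by blast
    qed (use that Y0 in blast)
    define Y where "Y = \<pi> Y1"
    have Y: "Y \<in> p" "cdot F Y = 0" "Y \<noteq> 0"
      using \<pi> [OF Y1(1)] Y1(2) by (auto simp: Y_def \<pi>_def)
    have "\<exists>a b c. U = a *\<^sub>R F + b *\<^sub>R Y + c *\<^sub>R ccross F Y" if U: "U \<in> p" for U
    proof -
      have "cdot (Y + \<pi> U) (Y + \<pi> U) = 0"
        using Y \<pi> [OF U] p by (intro null) (auto simp: subspace_add cdot_linear)
      then have "cdot Y (\<pi> U) = 0"
        using null Y \<pi> [OF U] by (simp add: cdot_linear cdot_commute [of "\<pi> U" Y])
      then have "ccross Y (\<pi> U) = 0"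
        using isotropic_imp_ccross_0 null Y \<pi> [OF U] by blast
      then obtain r where "\<pi> U = r *\<^sub>R Y" using parallel_dependent Y \<pi> [OF U] by blast
      then have "U = Re (cdot U F / cdot F F) *\<^sub>R F + r *\<^sub>R Y + 0 *\<^sub>R ccross F Y"
        by (simp add: \<pi>_def algebra_simps)
      then show ?thesis by blast
    qed
    then show thesis using that [of F Y] real_dot F Y by blast
  qed
qed

section \<open>The Lorentz group and its Lie algebra\<close>

text \<open>
  The element of the Lie algebra of the isometries fixing the first basis vector whose rotation
  part is \<open>Re F\<close> and whose boost part is \<open>Im F\<close>: on \<open>(t, r) \<in> \<real> \<times> \<real>\<^sup>3\<close> it acts by
  \<open>(t, r) \<mapsto> (Im F \<cdot> r, t Im F + Re F \<times> r)\<close> (see \<open>gen_emb\<close>). With this choice the bracket is the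
  cross product.
\<close>

definition gen :: "complex^3 \<Rightarrow> real^5^5" where
  "gen F = (\<chi> i j.
     if i = 2 \<and> j = 3 \<or> i = 3 \<and> j = 2 then Im (F$1)
     else if i = 2 \<and> j = 4 \<or> i = 4 \<and> j = 2 then Im (F$2)
     else if i = 2 \<and> j = 5 \<or> i = 5 \<and> j = 2 then Im (F$3)
     else if i = 5 \<and> j = 4 then Re (F$1) else if i = 4 \<and> j = 5 then - Re (F$1)
     else if i = 3 \<and> j = 5 then Re (F$2) else if i = 5 \<and> j = 3 then - Re (F$2)
     else if i = 4 \<and> j = 3 then Re (F$3) else if i = 3 \<and> j = 4 then - Re (F$3)
     else 0)"

definition gen_inv :: "real^5^5 \<Rightarrow> complex^3" where
  "gen_inv M = vector [Complex (M$5$4) (M$3$2), Complex (M$3$5) (M$4$2), Complex (M$4$3) (M$5$2)]"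

lemma gen_nth [simp]:
  "gen F $ 1 $ j = 0" "gen F $ i $ 1 = 0"
  "gen F $ 2 $ 2 = 0" "gen F $ 2 $ 3 = Im (F$1)" "gen F $ 2 $ 4 = Im (F$2)" "gen F $ 2 $ 5 = Im (F$3)"
  "gen F $ 3 $ 2 = Im (F$1)" "gen F $ 3 $ 3 = 0" "gen F $ 3 $ 4 = - Re (F$3)" "gen F $ 3 $ 5 = Re (F$2)"
  "gen F $ 4 $ 2 = Im (F$2)" "gen F $ 4 $ 3 = Re (F$3)" "gen F $ 4 $ 4 = 0" "gen F $ 4 $ 5 = - Re (F$1)"
  "gen F $ 5 $ 2 = Im (F$3)" "gen F $ 5 $ 3 = - Re (F$2)" "gen F $ 5 $ 4 = Re (F$1)" "gen F $ 5 $ 5 = 0"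
  by (simp_all add: gen_def)

lemma gen_inv_nth [simp]:
  "gen_inv M $ 1 = Complex (M$5$4) (M$3$2)" "gen_inv M $ 2 = Complex (M$3$5) (M$4$2)"
  "gen_inv M $ 3 = Complex (M$4$3) (M$5$2)"
  by (simp_all add: gen_inv_def)

lemma gen_inv_gen [simp]: "gen_inv (gen F) = F"
  by (simp add: vec_eq_iff forall_3)

lemma linear_gen_inv: "linear gen_inv"
  by (simp add: linear_iff vec_eq_iff forall_3 complex_eq_iff)

lemma gen_inject [simp]: "gen F = gen Y \<longleftrightarrow> F = Y"
  by (metis gen_inv_gen)

lemma gen_linear: "gen (F + Y) = gen F + gen Y" "gen (F - Y) = gen F - gen Y" "gen (r *\<^sub>R F) = r *\<^sub>R gen F" "gen 0 = 0"
  by (simp_all add: vec_eq_iff forall_5)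

lemma gen_ccross: "gen F ** gen Y - gen Y ** gen F = gen (ccross F Y)"
  by (simp add: vec_eq_iff forall_5 matrix_matrix_mult_def sum_5 algebra_simps)

text \<open>
  The two trace identities express the real part and, up to sign, the imaginary part of \<open>F \<cdot> F\<close> by
  quantities that are invariant under conjugation.
\<close>

lemma trace_gen_2: "trace (gen F ** gen F) = - 2 * Re (cdot F F)"
  by (simp add: trace_def matrix_matrix_mult_def sum_5 cdot_def algebra_simps)

lemma trace_gen_4:
  "trace ((gen F ** gen F) ** (gen F ** gen F)) = 2 * (Re (cdot F F))\<^sup>2 + (Im (cdot F F))\<^sup>2"
  by (simp add: trace_def matrix_matrix_mult_def sum_5 cdot_def power2_eq_square) algebra

definition msign :: "5 \<Rightarrow> real" where "msign i = (if i = 1 \<or> i = 2 then -1 else 1)"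

lemma msign_simps [simp]: "msign 1 = -1" "msign 2 = -1" "msign 3 = 1" "msign 4 = 1" "msign 5 = 1" "msign i * msign i = 1"
  "msign i * (msign i * x) = x"
  by (simp_all add: msign_def)

definition form :: "real^5 \<Rightarrow> real^5 \<Rightarrow> real" where
  "form x y = (\<Sum>k\<in>UNIV. msign k * x$k * y$k)"

abbreviation quad :: "real^5 \<Rightarrow> real" where "quad x \<equiv> form x x"

lemma form_expand: "form x y = - x$1 * y$1 - x$2 * y$2 + x$3 * y$3 + x$4 * y$4 + x$5 * y$5"
  by (simp add: form_def sum_5)

lemma form_axis: "form (axis i 1) y = msign i * y$i" "form y (axis i 1) = msign i * y$i"
  using exhaust_5 [of i] by (auto simp: form_expand axis_def)

lemma form_commute: "form x y = form y x"
  by (simp add: form_def mult.commute mult.left_commute)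

lemma bounded_bilinear_form: "bounded_bilinear form"
proof -
  have "bilinear form"
    unfolding bilinear_def linear_iff by (simp add: form_expand algebra_simps)
  then show ?thesis by (simp add: bilinear_conv_bounded_bilinear)
qed

lemmas form_linear = bounded_bilinear.add_left [OF bounded_bilinear_form] bounded_bilinear.add_right [OF bounded_bilinear_form]
  bounded_bilinear.diff_left [OF bounded_bilinear_form] bounded_bilinear.diff_right [OF bounded_bilinear_form]
  bounded_bilinear.scaleR_left [OF bounded_bilinear_form] bounded_bilinear.scaleR_right [OF bounded_bilinear_form]
  bounded_bilinear.minus_left [OF bounded_bilinear_form] bounded_bilinear.minus_right [OF bounded_bilinear_form]
  bounded_bilinear.zero_left [OF bounded_bilinear_form] bounded_bilinear.zero_right [OF bounded_bilinear_form]

text \<open>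
  Isometries that fix every vector of \<open>S\<close>. The set \<open>S\<close> is \<open>{e1}\<close> for the Lorentz group and grows when
  rotations are decomposed into reflections.
\<close>

definition isom_fix :: "(real^5) set \<Rightarrow> (real^5^5) set" where
  "isom_fix S = {A. (\<forall>x. quad (A *v x) = quad x) \<and> (\<forall>s\<in>S. A *v s = s)}"

text \<open>
  The adjoint with respect to \<open>form\<close>. It is linear, hence continuous and differentiable everywhere, and
  coincides with the inverse on isometries.
\<close>

definition form_adj :: "real^5^5 \<Rightarrow> real^5^5" where
  "form_adj A = (\<chi> i j. msign i * msign j * A$j$i)"

lemma form_polar: "form x y = (quad (x + y) - quad x - quad y) / 2"
  by (simp add: form_linear form_commute [of y x])

lemma isom_fix_form: "A \<in> isom_fix S \<Longrightarrow> form (A *v x) (A *v y) = form x y"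
  using form_polar [of "A *v x" "A *v y"] form_polar [of x y]
  by (simp add: isom_fix_def flip: matrix_vector_right_distrib)

lemma isom_fix_inv:
  assumes "A \<in> isom_fix S" shows "matrix_inv A = form_adj A" "invertible A" "A ** matrix_inv A = mat 1" "matrix_inv A ** A = mat 1"
proof -
  have "(form_adj A ** A) $ i $ j = (mat 1 :: real^5^5) $ i $ j" for i j
  proof -
    have "(form_adj A ** A) $ i $ j = msign i * form (A *v axis i 1) (A *v axis j 1)"
      by (simp add: form_adj_def matrix_matrix_mult_def matrix_vector_mult_basis column_def form_def
          sum_distrib_left mult_ac)
    also have "\<dots> = mat 1 $ i $ j"
      unfolding isom_fix_form [OF assms] form_axis by (simp add: mat_def axis_def)
    finally show ?thesis .
  qed
  then have "form_adj A ** A = mat 1" by (simp add: vec_eq_iff)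
  then have *: "A ** form_adj A = mat 1" using matrix_left_right_inverse by blast
  show inv: "matrix_inv A = form_adj A" "invertible A" using matrix_inv_eqI [OF *] by auto
  show "A ** matrix_inv A = mat 1" "matrix_inv A ** A = mat 1" using inv matrix_inv_both by blast+
qed

lemma isom_fix_adjoint: "A \<in> isom_fix S \<Longrightarrow> form (A *v x) y = form x (matrix_inv A *v y)"
  using isom_fix_form [of A S x "matrix_inv A *v y"] by (simp add: matrix_vector_mul_assoc isom_fix_inv(3))

lemma matrix_group_isom_fix: "matrix_group (isom_fix S)"
  unfolding matrix_group_def
proof (intro conjI ballI)
  show "mat 1 \<in> isom_fix S" by (simp add: isom_fix_def)
  show "A ** B \<in> isom_fix S" if "A \<in> isom_fix S" "B \<in> isom_fix S" for A B
    using that by (simp add: isom_fix_def flip: matrix_vector_mul_assoc)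
  fix A assume A: "A \<in> isom_fix S"
  show "invertible A" by (rule isom_fix_inv [OF A])
  have "quad (matrix_inv A *v x) = quad x" for x
    using isom_fix_form [OF A, of "matrix_inv A *v x" "matrix_inv A *v x"] isom_fix_inv(3) [OF A]
    by (simp add: matrix_vector_mul_assoc)
  moreover have "matrix_inv A *v s = s" if "s \<in> S" for s
  proof -
    have "matrix_inv A *v (A *v s) = s" by (simp add: matrix_vector_mul_assoc isom_fix_inv(4) [OF A])
    then show ?thesis using A that by (simp add: isom_fix_def)
  qed
  ultimately show "matrix_inv A \<in> isom_fix S" by (simp add: isom_fix_def)
qed

lemma linear_form_adj: "linear form_adj"
  by (simp add: linear_iff form_adj_def vec_eq_iff algebra_simps)

lemma continuous_form_adj: "continuous_on S form_adj"
  using linear_form_adj by (simp add: linear_conv_bounded_linear linear_continuous_on)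

lemma skew_imp_gen:
  assumes "\<And>x y. form (M *v x) y = - form x (M *v y)" "M *v axis 1 1 = 0"
  shows "M = gen (gen_inv M)"
proof -
  have "msign i * M$i$j = - (msign j * M$j$i)" for i j
    using assms(1) [of "axis j 1" "axis i 1"]
    by (simp add: form_axis matrix_vector_mult_basis column_def)
  note e = this
  have c: "M$i$1 = 0" for i using assms(2) by (simp add: matrix_vector_mult_basis column_def vec_eq_iff)
  have d: "M$i$i = 0" for i using e [of i i] by (auto simp: msign_def split: if_splits)
  have r: "M$1$j = 0" for j using e [of 1 j] c [of j] by simp
  show ?thesis
    unfolding vec_eq_iff forall_5
    using c r d e [of 2 3] e [of 2 4] e [of 2 5] e [of 3 4] e [of 3 5] e [of 4 5]
    by simp
qed

lemma gen_skew: "form (gen F *v x) y = - form x (gen F *v y)"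
  by (simp add: form_expand matrix_vector_mult_def sum_5 algebra_simps)

abbreviation e1 :: "real^5" where "e1 \<equiv> axis 1 1"
abbreviation e2 :: "real^5" where "e2 \<equiv> axis 2 1"

lemma gen_e1: "gen F *v e1 = 0"
  by (simp add: matrix_vector_mult_basis column_def vec_eq_iff)

text \<open>
  The adjoint action on \<open>\<complex>\<^sup>3\<close>, with \<open>form_adj A\<close> in place of the inverse so that it is visibly smooth in \<open>A\<close>.
\<close>

definition rho :: "real^5^5 \<Rightarrow> complex^3 \<Rightarrow> complex^3" where
  "rho A F = gen_inv (A ** gen F ** form_adj A)"

lemma gen_rho:
  assumes A: "A \<in> isom_fix S" "e1 \<in> S"
  shows "gen (rho A F) = A ** gen F ** matrix_inv A"
proof -
  let ?M = "A ** gen F ** matrix_inv A"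
  have Ai: "matrix_inv A \<in> isom_fix S" using A matrix_group_simps [OF matrix_group_isom_fix] by blast
  have ii: "matrix_inv (matrix_inv A) = A" using isom_fix_inv(4) [OF A(1)] matrix_inv_eqI by blast
  have "form (?M *v x) y = - form x (?M *v y)" for x y
    by (simp add: isom_fix_adjoint [OF A(1)] gen_skew isom_fix_adjoint [OF Ai] ii flip: matrix_vector_mul_assoc)
  moreover have "?M *v e1 = 0"
    using Ai A(2) by (simp add: isom_fix_def gen_e1 flip: matrix_vector_mul_assoc)
  ultimately have "?M = gen (gen_inv ?M)" by (rule skew_imp_gen)
  then show ?thesis by (simp add: rho_def isom_fix_inv [OF A(1)])
qed

lemma conj_mult:
  assumes "A \<in> isom_fix S"
  shows "(A ** X ** matrix_inv A) ** (A ** Y ** matrix_inv A) = A ** (X ** Y) ** matrix_inv A"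
proof -
  have "(A ** X ** matrix_inv A) ** (A ** Y ** matrix_inv A)
      = A ** X ** (matrix_inv A ** A) ** Y ** matrix_inv A"
    by (simp add: matrix_mul_assoc)
  then show ?thesis by (simp add: isom_fix_inv(4) [OF assms] matrix_mul_assoc)
qed

lemma rho_linear: "rho A (F + Y) = rho A F + rho A Y" "rho A (F - Y) = rho A F - rho A Y"
  "rho A (r *\<^sub>R F) = r *\<^sub>R rho A F"
proof -
  note d = linear_add [OF linear_gen_inv] linear_diff [OF linear_gen_inv] linear_scale [OF linear_gen_inv]
  note l = bounded_bilinear.add_left [OF bounded_bilinear_matrix_mult] bounded_bilinear.add_right [OF bounded_bilinear_matrix_mult]
    bounded_bilinear.scaleR_left [OF bounded_bilinear_matrix_mult] bounded_bilinear.scaleR_right [OF bounded_bilinear_matrix_mult]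
    matrix_diff_mult matrix_mult_diff
  show "rho A (F + Y) = rho A F + rho A Y" "rho A (F - Y) = rho A F - rho A Y"
    "rho A (r *\<^sub>R F) = r *\<^sub>R rho A F"
    by (simp_all add: rho_def gen_linear l d)
qed

lemma rho_ccross:
  assumes A: "A \<in> isom_fix S" "e1 \<in> S"
  shows "rho A (ccross F Y) = ccross (rho A F) (rho A Y)"
proof -
  have "gen (ccross (rho A F) (rho A Y)) = A ** (gen F ** gen Y - gen Y ** gen F) ** matrix_inv A"
    by (simp add: gen_rho [OF A] conj_mult [OF A(1)] matrix_mult_diff matrix_diff_mult flip: gen_ccross)
  also have "\<dots> = gen (rho A (ccross F Y))" by (simp add: gen_ccross gen_rho [OF A])
  finally show ?thesis by simp
qed

lemma rho_mult:
  assumes A: "A \<in> isom_fix S" "e1 \<in> S" and B: "B \<in> isom_fix S"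
  shows "rho (A ** B) F = rho A (rho B F)"
proof -
  note grp = matrix_group_simps [OF matrix_group_isom_fix [of S]]
  have i: "matrix_inv (A ** B) = matrix_inv B ** matrix_inv A"
  proof (rule matrix_inv_eqI)
    have "A ** B ** (matrix_inv B ** matrix_inv A) = A ** (B ** matrix_inv B) ** matrix_inv A"
      by (simp add: matrix_mul_assoc)
    then show "A ** B ** (matrix_inv B ** matrix_inv A) = mat 1"
      by (simp add: isom_fix_inv(3) [OF A(1)] isom_fix_inv(3) [OF B])
  qed
  have "gen (rho (A ** B) F) = gen (rho A (rho B F))"
    by (simp add: gen_rho [OF grp(2) [OF A(1) B] A(2)] gen_rho [OF A] gen_rho [OF B A(2)] i matrix_mul_assoc)
  then show ?thesis by simp
qed

lemma rho_one: "rho (mat 1) F = F"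
  using gen_rho [of "mat 1" UNIV F] matrix_inv_eqI(1) [of "mat 1 :: real^5^5" "mat 1"]
  by (simp add: isom_fix_def)

lemma trace_conj: "A \<in> isom_fix S \<Longrightarrow> trace (A ** X ** matrix_inv A) = trace X"
  by (metis isom_fix_inv(4) matrix_mul_assoc matrix_mul_lid trace_mul_sym)

abbreviation lorentz :: "(real^5^5) set" where
  "lorentz \<equiv> connected_component_set (isom_fix {e1}) (mat 1)"

lemma lorentz_isom_fix: "lorentz \<subseteq> isom_fix {e1}" by (rule connected_component_subset)

lemma one_in_lorentz: "mat 1 \<in> lorentz"
  using matrix_group_simps [OF matrix_group_isom_fix] by (simp add: connected_component_refl)

lemma continuous_rho: "continuous_on S (\<lambda>A. rho A F)"
  unfolding rho_def
  by (intro bounded_linear.continuous_on [OF linear_gen_inv [unfolded linear_conv_bounded_linear]]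
      continuous_on_matrix_mult continuous_intros continuous_form_adj)

lemma connected_square_constant:
  fixes f :: "'a::topological_space \<Rightarrow> real"
  assumes "connected S" "continuous_on S f" "\<And>x. x \<in> S \<Longrightarrow> (f x)\<^sup>2 = c" "a \<in> S" "x \<in> S"
  shows "f x = f a"
proof -
  have "connected (f ` S)" using assms by (intro connected_continuous_image)
  moreover have "f ` S \<subseteq> {sqrt c, - sqrt c}"
  proof
    fix y assume "y \<in> f ` S"
    then obtain x where "x \<in> S" "y = f x" by blast
    then have "sqrt c = \<bar>y\<bar>" using assms(3) real_sqrt_abs by metis
    then show "y \<in> {sqrt c, - sqrt c}" by (auto simp: abs_if split: if_splits)
  qed
  then have "finite (f ` S)" using finite_subset by blast
  ultimately show ?thesis using assms(4,5) by (metis connected_finite_iff_sing empty_iff imageI singletonD)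
qed

text \<open>
  The traces of the second and fourth power of \<open>gen F\<close> give \<open>Re (F \<cdot> F)\<close> and \<open>(Im (F \<cdot> F))\<^sup>2\<close>. The sign of
  \<open>Im (F \<cdot> F)\<close>, which orientation-reversing isometries do flip, is constant on the connected group.
\<close>

lemma cdot_rho:
  assumes A: "A \<in> lorentz"
  shows "cdot (rho A F) (rho A Y) = cdot F Y"
proof -
  have sq: "cdot (rho A F) (rho A F) = cdot F F" for F
  proof -
    have re: "Re (cdot (rho A F) (rho A F)) = Re (cdot F F)" if "A \<in> isom_fix {e1}" for A
      using trace_gen_2 [of "rho A F"] trace_gen_2 [of F] that
      by (simp add: gen_rho conj_mult trace_conj)
    have im: "(Im (cdot (rho A F) (rho A F)))\<^sup>2 = (Im (cdot F F))\<^sup>2" if "A \<in> isom_fix {e1}" for A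
      using trace_gen_4 [of "rho A F"] trace_gen_4 [of F] that re [OF that]
      by (simp add: gen_rho conj_mult trace_conj)
    have "Im (cdot (rho A F) (rho A F)) = Im (cdot (rho (mat 1) F) (rho (mat 1) F))"
    proof (rule connected_square_constant [where S = lorentz and f = "\<lambda>A. Im (cdot (rho A F) (rho A F))"])
      show "connected lorentz" by simp
      show "continuous_on lorentz (\<lambda>A. Im (cdot (rho A F) (rho A F)))"
        unfolding cdot_def by (intro continuous_intros continuous_rho)
      show "A \<in> lorentz" by fact
    qed (use im lorentz_isom_fix one_in_lorentz in auto)
    then show ?thesis using re A lorentz_isom_fix by (auto simp: complex_eq_iff rho_one)
  qed
  have "cdot (rho A (F + Y)) (rho A (F + Y)) = cdot (F + Y) (F + Y)" by (rule sq)
  then show ?thesis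
    using sq [of F] sq [of Y]
    by (simp add: rho_linear cdot_linear cdot_commute [of Y F] cdot_commute [of "rho A Y" "rho A F"])
qed

text \<open>
  The complex dot product is nondegenerate and complex bilinear, and it is preserved by a surjective map.
\<close>

lemma rho_complex_linear:
  assumes A: "A \<in> lorentz"
  shows "rho A (c *s F) = c *s rho A F"
proof -
  have iso: "A \<in> isom_fix {e1}" "matrix_inv A \<in> isom_fix {e1}"
    using A lorentz_isom_fix matrix_group_simps [OF matrix_group_isom_fix] by blast+
  have surj: "rho A (rho (matrix_inv A) Y) = Y" for Y
    using rho_mult [OF iso(1) _ iso(2), of Y] isom_fix_inv(3) [OF iso(1)] by (simp add: rho_one)
  have eq: "cdot (rho A (c *s F) - c *s rho A F) Y = 0" for Y
    using cdot_rho [OF A, of "c *s F" "rho (matrix_inv A) Y"] cdot_rho [OF A, of F "rho (matrix_inv A) Y"]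
    by (simp add: surj cdot_linear)
  have "rho A (c *s F) - c *s rho A F = 0"
    using eq [of "axis 1 1"] eq [of "axis 2 1"] eq [of "axis 3 1"]
    by (simp add: cdot_def axis_def vec_eq_iff forall_3)
  then show ?thesis by simp
qed

section \<open>Eigenvectors and kernels of Lorentz generators\<close>

text \<open>
  The inclusion of \<open>\<real>\<^sup>1\<^sup>,\<^sup>3 = \<real> \<times> \<real>\<^sup>3\<close> as the orthogonal complement of the first basis vector.
\<close>

definition emb :: "real \<Rightarrow> real^3 \<Rightarrow> real^5" where
  "emb t r = (\<chi> i. if i = 2 then t else if i = 3 then r$1 else if i = 4 then r$2 else if i = 5 then r$3 else 0)"

lemma emb_nth [simp]: "emb t r $ 1 = 0" "emb t r $ 2 = t" "emb t r $ 3 = r$1" "emb t r $ 4 = r$2" "emb t r $ 5 = r$3"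
  by (simp_all add: emb_def)

lemma emb_exhaust: assumes "w $ 1 = 0" obtains t r where "w = emb t r"
proof
  show "w = emb (w$2) (vector [w$3, w$4, w$5])"
    using assms by (simp add: vec_eq_iff forall_5)
qed

lemma emb_inject [simp]: "emb t r = emb t' r' \<longleftrightarrow> t = t' \<and> r = r'"
  by (auto simp: vec_eq_iff forall_5 forall_3)

lemma emb_eq_0: "emb t r = 0 \<longleftrightarrow> t = 0 \<and> r = 0"
  by (auto simp: vec_eq_iff forall_5 forall_3)

lemma emb_linear: "emb t r + emb t' r' = emb (t + t') (r + r')" "emb t r - emb t' r' = emb (t - t') (r - r')"
  "c *\<^sub>R emb t r = emb (c * t) (c *\<^sub>R r)"
  by (simp_all add: vec_eq_iff forall_5)

lemma form_emb: "form (emb t r) (emb t' r') = - t * t' + r \<bullet> r'"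
  by (simp add: form_expand inner_vec_def sum_3)

definition rpart :: "complex^3 \<Rightarrow> real^3" where "rpart F = (\<chi> i. Re (F$i))"
definition ipart :: "complex^3 \<Rightarrow> real^3" where "ipart F = (\<chi> i. Im (F$i))"

lemma parts_simps [simp]: "rpart F $ i = Re (F$i)" "ipart F $ i = Im (F$i)"
  by (simp_all add: rpart_def ipart_def)

lemma parts_i: "rpart (\<i> *s F) = - ipart F" "ipart (\<i> *s F) = rpart F"
  by (simp_all add: vec_eq_iff)

lemma parts_eq_0: "F = 0 \<longleftrightarrow> rpart F = 0 \<and> ipart F = 0"
  by (auto simp: vec_eq_iff complex_eq_iff)

lemma cdot_parts: "Re (cdot F Y) = rpart F \<bullet> rpart Y - ipart F \<bullet> ipart Y"
  "Im (cdot F Y) = rpart F \<bullet> ipart Y + ipart F \<bullet> rpart Y"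
  by (simp_all add: cdot_def inner_vec_def sum_3)

lemma gen_emb: "gen F *v emb t r = emb (ipart F \<bullet> r) (t *\<^sub>R ipart F + cross3 (rpart F) r)"
  by (simp add: vec_eq_iff forall_5 matrix_vector_mult_def sum_5 inner_vec_def sum_3 cross3_def algebra_simps)

lemma cross_both_orthogonal:
  fixes b r e :: "real^3"
  assumes "e \<bullet> b = 0" "e \<bullet> r = 0" "e \<noteq> 0"
  shows "cross3 b r = ((cross3 b r \<bullet> e) / (e \<bullet> e)) *\<^sub>R e"
proof -
  have "cross3 e (cross3 b r) = 0" using assms by (simp add: Lagrange)
  then have "cross3 e (cross3 e (cross3 b r)) = 0" by simp
  then have "(e \<bullet> e) *\<^sub>R cross3 b r = (cross3 b r \<bullet> e) *\<^sub>R e"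
    unfolding Lagrange [of e e "cross3 b r"] by (simp add: inner_commute)
  then have "(1 / (e \<bullet> e)) *\<^sub>R ((e \<bullet> e) *\<^sub>R cross3 b r) = (1 / (e \<bullet> e)) *\<^sub>R ((cross3 b r \<bullet> e) *\<^sub>R e)" by simp
  then show ?thesis using assms(3) by simp
qed

lemma exists_orthogonal_pair:
  fixes e b :: "real^3"
  assumes "e \<bullet> b = 0"
  obtains r where "r \<noteq> 0" "e \<bullet> r = 0" "cross3 b r = 0"
proof (cases "b = 0")
  case False then show ?thesis using that [of b] assms by simp
next
  case True
  show ?thesis
  proof (cases "e$1 = 0 \<and> e$2 = 0")
    case True
    then show ?thesis using that [of "axis 1 1"] \<open>b = 0\<close> by (simp add: inner_axis)
  next
    case False
    then show ?thesis using that [of "vector [e$2, - e$1, 0]"] \<open>b = 0\<close>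
      by (auto simp: inner_vec_def sum_3 vec_eq_iff forall_3)
  qed
qed

text \<open>
  Subtracting a multiple of \<open>F\<close> from \<open>Y\<close> leaves a pure rotation whose axis is orthogonal to the boost
  direction \<open>e\<close> of \<open>F\<close>. A vector \<open>r\<close> on this axis is moved by \<open>F\<close> in the direction of \<open>e\<close> only, which a suitable
  time component compensates.
\<close>

lemma common_kernel_parallel:
  assumes e: "ipart F \<noteq> 0" "ipart Y = l *\<^sub>R ipart F"
    and dots: "cdot F F \<in> \<real>" "cdot F Y \<in> \<real>"
  obtains w where "w \<noteq> 0" "w $ 1 = 0" "gen F *v w = 0" "gen Y *v w = 0"
proof -
  let ?e = "ipart F" let ?b = "rpart F" let ?c = "rpart Y - l *\<^sub>R rpart F"
  have 1: "?e \<bullet> ?b = 0"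
    using dots(1) cdot_parts(2) [of F F] by (simp add: complex_is_Real_iff inner_commute)
  have 2: "?e \<bullet> ?c = 0"
    using dots(2) cdot_parts(2) [of F Y] e 1
    by (simp add: complex_is_Real_iff inner_commute inner_diff_right)
  obtain r where r: "r \<noteq> 0" "?e \<bullet> r = 0" "cross3 ?c r = 0" using exists_orthogonal_pair [OF 2] .
  define t where "t = - ((cross3 ?b r \<bullet> ?e) / (?e \<bullet> ?e))"
  have br: "cross3 ?b r = (- t) *\<^sub>R ?e" unfolding t_def using cross_both_orthogonal [OF 1 r(2) e(1)] by simp
  have "cross3 (rpart Y) r = cross3 ?c r + l *\<^sub>R cross3 ?b r"
    by (simp add: Cross3.left_diff_distrib cross_mult_left)
  then have "cross3 (rpart Y) r = (- t) *\<^sub>R ipart Y" using r(3) br e(2) by simp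
  then show thesis using that [of "emb t r"] r br e(2) by (simp add: gen_emb emb_eq_0)
qed

text \<open>
  As two-forms, \<open>F\<close> and \<open>Y\<close> are decomposable by the first two hypotheses, and their wedge product
  vanishes by the third one, so the kernels, which are planes, meet. If the boost parts \<open>e\<close> and \<open>e'\<close> are
  not parallel, the intersection is spanned by an explicit vector with spatial part \<open>e \<times> e'\<close>.
\<close>

lemma common_kernel:
  assumes dots: "cdot F F \<in> \<real>" "cdot Y Y \<in> \<real>" "cdot F Y \<in> \<real>"
  obtains w where "w \<noteq> 0" "w $ 1 = 0" "gen F *v w = 0" "gen Y *v w = 0"
proof -
  let ?e = "ipart F" let ?b = "rpart F" let ?e' = "ipart Y" let ?b' = "rpart Y"
  have 1: "?b \<bullet> ?e = 0" "?b' \<bullet> ?e' = 0" "?b \<bullet> ?e' + ?b' \<bullet> ?e = 0"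
    using dots cdot_parts(2) [of F F] cdot_parts(2) [of Y Y] cdot_parts(2) [of F Y]
    by (simp_all add: complex_is_Real_iff inner_commute)
  show thesis
  proof (cases "cross3 ?e ?e' = 0")
    case False
    have "gen F *v emb (- (?b \<bullet> ?e')) (cross3 ?e ?e') = 0"
      using 1 by (simp add: gen_emb emb_eq_0 Lagrange dot_cross_self)
    moreover have "?b' \<bullet> ?e = - (?b \<bullet> ?e')" using 1(3) by simp
    then have "gen Y *v emb (- (?b \<bullet> ?e')) (cross3 ?e ?e') = 0"
      using 1(2) by (simp add: gen_emb emb_eq_0 Lagrange dot_cross_self)
    ultimately show thesis using that [of "emb (- (?b \<bullet> ?e')) (cross3 ?e ?e')"] False
      by (simp add: emb_eq_0)
  next
    case par: True
    show thesis
    proof (cases "?e = 0")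
      case e: True
      show thesis
      proof (cases "?e' = 0")
        case True
        then show thesis using e that [of "emb 1 0"] by (simp add: gen_emb emb_eq_0)
      next
        case False
        moreover have "ipart F = 0 *\<^sub>R ipart Y" using e by simp
        ultimately show thesis
          using common_kernel_parallel [of Y F 0] dots that by (metis cdot_commute)
      qed
    next
      case False
      have "cross3 ?e (cross3 ?e ?e') = 0" using par by simp
      then have "(?e \<bullet> ?e) *\<^sub>R ?e' = (?e \<bullet> ?e') *\<^sub>R ?e" by (simp add: Lagrange)
      then have "(1 / (?e \<bullet> ?e)) *\<^sub>R ((?e \<bullet> ?e) *\<^sub>R ?e') = (1 / (?e \<bullet> ?e)) *\<^sub>R ((?e \<bullet> ?e') *\<^sub>R ?e)" by simp
      then have "?e' = ((?e \<bullet> ?e') / (?e \<bullet> ?e)) *\<^sub>R ?e" using False by simp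
      then show thesis using common_kernel_parallel [OF False _ dots(1,3)] that by blast
    qed
  qed
qed

text \<open>
  After scaling, a complex line is spanned by some \<open>Z\<close> with \<open>Z \<cdot> Z = 0\<close> or \<open>Z \<cdot> Z = -1\<close>. In the first case
  \<open>gen Z\<close> is nilpotent and the common kernel of \<open>Z\<close> and \<open>\<i> Z\<close> is a null line. In the second case \<open>gen Z\<close>
  is a pure boost in suitable coordinates, and its eigenspace for the eigenvalue \<open>1\<close> is a null line.
  With \<open>b = Re Z\<close> and \<open>e = Im Z\<close>, the vector with time component \<open>e \<cdot> e\<close> and spatial part \<open>l e + b \<times> e\<close>
  serves both cases.
\<close>

lemma null_eigenvector:
  assumes Z: "Z \<noteq> 0" "cdot Z Z = - of_real (l\<^sup>2)" "l = 0 \<or> l = 1"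
  obtains n where "n \<noteq> 0" "n $ 1 = 0" "quad n = 0" "gen Z *v n = l *\<^sub>R n" "l = 0 \<Longrightarrow> gen (\<i> *s Z) *v n = 0"
    "\<And>w. w $ 1 = 0 \<Longrightarrow> gen Z *v w = l *\<^sub>R w \<Longrightarrow> (l = 0 \<Longrightarrow> gen (\<i> *s Z) *v w = 0) \<Longrightarrow> w \<in> span {n}"
proof -
  let ?e = "ipart Z" let ?b = "rpart Z"
  have 1: "?b \<bullet> ?e = 0" "?b \<bullet> ?b - ?e \<bullet> ?e = - l\<^sup>2"
    using Z(2) cdot_parts [of Z Z] by (simp_all add: complex_eq_iff inner_commute)
  have e: "?e \<noteq> 0"
  proof
    assume "?e = 0"
    then have "?b \<bullet> ?b \<le> 0" using 1(2) by simp
    then have "?b = 0" by (metis inner_eq_zero_iff inner_ge_zero order_antisym)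
    then show False using Z(1) \<open>?e = 0\<close> parts_eq_0 by blast
  qed
  define n where "n = emb (?e \<bullet> ?e) (l *\<^sub>R ?e + cross3 ?b ?e)"
  have bb: "?b \<bullet> ?b = ?e \<bullet> ?e - l\<^sup>2" using 1 by simp
  have ll: "l * l = l\<^sup>2" by (simp add: power2_eq_square)
  show thesis
  proof
    show "n \<noteq> 0" "n $ 1 = 0" using e by (simp_all add: n_def emb_eq_0)
    have "cross3 ?b ?e \<bullet> cross3 ?b ?e = (?b \<bullet> ?b) * (?e \<bullet> ?e)"
      using norm_cross_dot [of ?b ?e] 1 by (simp add: power2_norm_eq_inner power_mult_distrib)
    then have "quad n = - (?e \<bullet> ?e) * (?e \<bullet> ?e) + (l * l * (?e \<bullet> ?e) + (?b \<bullet> ?b) * (?e \<bullet> ?e))"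
      by (simp add: n_def form_emb inner_add_left inner_add_right dot_cross_self inner_commute)
    then show "quad n = 0" by (simp add: bb ll algebra_simps)
    have "cross3 ?b (l *\<^sub>R ?e + cross3 ?b ?e) = l *\<^sub>R cross3 ?b ?e - (?b \<bullet> ?b) *\<^sub>R ?e"
      using 1 by (simp add: cross_add_right cross_mult_right Lagrange)
    then show "gen Z *v n = l *\<^sub>R n"
      by (simp add: n_def gen_emb emb_linear inner_add_right dot_cross_self bb ll [symmetric] algebra_simps)
    show "gen (\<i> *s Z) *v n = 0" if "l = 0"
      using 1 that by (simp add: n_def gen_emb parts_i emb_eq_0 Lagrange dot_cross_self inner_commute)
    fix w assume w: "w $ 1 = 0" "gen Z *v w = l *\<^sub>R w" "l = 0 \<Longrightarrow> gen (\<i> *s Z) *v w = 0"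
    obtain t r where tr: "w = emb t r" using emb_exhaust [OF w(1)] .
    \<comment> \<open>subtracting a multiple of \<open>n\<close> removes the time component of \<open>w\<close>\<close>
    define r' where "r' = (?e \<bullet> ?e) *\<^sub>R r - t *\<^sub>R (l *\<^sub>R ?e + cross3 ?b ?e)"
    have w': "(?e \<bullet> ?e) *\<^sub>R w - t *\<^sub>R n = emb 0 r'"
      by (simp add: tr n_def emb_linear r'_def)
    have k: "gen Z *v emb 0 r' = l *\<^sub>R emb 0 r'"
      unfolding w' [symmetric] using w(2) \<open>gen Z *v n = l *\<^sub>R n\<close>
      by (simp add: matrix_vector_mult_diff_distrib matrix_vector_mult_scaleR scaleR_diff_right mult.commute)
    then have br: "cross3 ?b r' = l *\<^sub>R r'" by (simp add: gen_emb emb_linear)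
    have "r' = 0"
    proof (cases "l = 0")
      case True
      have "gen (\<i> *s Z) *v emb 0 r' = 0"
        unfolding w' [symmetric] using w(3) \<open>l = 0 \<Longrightarrow> gen (\<i> *s Z) *v n = 0\<close> True
        by (simp add: matrix_vector_mult_diff_distrib matrix_vector_mult_scaleR)
      then have "?b \<bullet> r' = 0" by (simp add: gen_emb parts_i emb_eq_0)
      moreover have "cross3 ?b r' = 0" using br True by simp
      moreover have "?b \<noteq> 0" using bb e True by auto
      ultimately show ?thesis using norm_and_cross_eq_0 by blast
    next
      case False
      then have "r' \<bullet> r' = r' \<bullet> cross3 ?b r'" using br Z(3) by simp
      then show ?thesis by (simp add: dot_cross_self)
    qed
    then have "(?e \<bullet> ?e) *\<^sub>R w = t *\<^sub>R n" using w' by (simp add: emb_eq_0 [of 0 0, simplified])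
    then have "(1 / (?e \<bullet> ?e)) *\<^sub>R ((?e \<bullet> ?e) *\<^sub>R w) = (1 / (?e \<bullet> ?e)) *\<^sub>R (t *\<^sub>R n)" by simp
    then have "w = (t / (?e \<bullet> ?e)) *\<^sub>R n" using e by simp
    then show "w \<in> span {n}" by (metis span_base span_scale singletonI)
  qed
qed

lemma isom_fix_preserves_hyperplane: "A \<in> isom_fix {e1} \<Longrightarrow> w $ 1 = 0 \<Longrightarrow> (A *v w) $ 1 = 0"
proof -
  assume A: "A \<in> isom_fix {e1}" and w: "w $ 1 = 0"
  have "form (A *v e1) (A *v w) = form e1 w" by (rule isom_fix_form [OF A])
  then show ?thesis using A w by (simp add: isom_fix_def form_axis)
qed

text \<open>
  If \<open>Z \<cdot> Z = 0\<close>, an element of \<open>G\<close> may rescale \<open>Z\<close>, but it preserves the common kernel of the complex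
  line. Otherwise normalize \<open>Z \<cdot> Z = -1\<close>; an element of \<open>G\<close> sends \<open>Z\<close> to \<open>Z\<close> or \<open>- Z\<close> because it preserves the
  dot product, and by connectedness to \<open>Z\<close>, so that it commutes with \<open>gen Z\<close> and preserves its eigenspaces.
\<close>

lemma stable_complex_line_imp_null:
  assumes G: "matrix_group G" "connected G" "G \<subseteq> lorentz"
    and Z: "Z \<noteq> 0" "\<And>A. A \<in> G \<Longrightarrow> \<exists>\<mu>. rho A Z = \<mu> *s Z"
  obtains n where "n \<noteq> 0" "quad n = 0" "\<And>A. A \<in> G \<Longrightarrow> A *v n \<in> span {n}"
proof -
  note grp = matrix_group_simps [OF G(1)]
  have iso: "A \<in> isom_fix {e1}" if "A \<in> G" for A using that G(3) lorentz_isom_fix by blast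
  have inter: "gen F *v (A *v w) = A *v (gen (rho (matrix_inv A) F) *v w)" if "A \<in> G" for A F w
  proof -
    have "A ** gen (rho (matrix_inv A) F) = gen F ** A"
    proof -
      have i: "matrix_inv (matrix_inv A) = A" using isom_fix_inv(4) [OF iso [OF that]] matrix_inv_eqI by blast
      have "A ** gen (rho (matrix_inv A) F) = (A ** matrix_inv A) ** gen F ** A"
        using gen_rho [OF iso [OF grp(3) [OF that]], of F] i by (simp add: matrix_mul_assoc)
      then show ?thesis using isom_fix_inv(3) [OF iso [OF that]] by simp
    qed
    then show ?thesis by (simp add: matrix_vector_mul_assoc)
  qed
  show thesis
  proof (cases "cdot Z Z = 0")
    case True
    then have "cdot Z Z = - of_real (0\<^sup>2)" by simp
    then obtain n where n: "n \<noteq> 0" "n $ 1 = 0" "quad n = 0" "gen Z *v n = 0" "gen (\<i> *s Z) *v n = 0"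
      and uniq: "\<And>w. w $ 1 = 0 \<Longrightarrow> gen Z *v w = 0 \<Longrightarrow> gen (\<i> *s Z) *v w = 0 \<Longrightarrow> w \<in> span {n}"
      using null_eigenvector [OF Z(1), of 0] by auto
    have kill: "gen (c *s Z) *v n = 0" for c
      by (subst complex_smult_split)
        (simp add: gen_linear n matrix_vector_mult_add_rdistrib flip: scaleR_matrix_vector_assoc)
    have "A *v n \<in> span {n}" if A: "A \<in> G" for A
    proof (rule uniq)
      show "(A *v n) $ 1 = 0" using isom_fix_preserves_hyperplane iso A n by blast
      obtain \<mu> where \<mu>: "rho (matrix_inv A) Z = \<mu> *s Z" using Z(2) grp(3) A by blast
      have "matrix_inv A \<in> lorentz" using grp(3) A G(3) by blast
      from rho_complex_linear [OF this, of \<i> Z]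
      have "rho (matrix_inv A) (\<i> *s Z) = (\<i> * \<mu>) *s Z" by (simp add: \<mu> vector_smult_assoc)
      then show "gen Z *v (A *v n) = 0" "gen (\<i> *s Z) *v (A *v n) = 0"
        using inter [OF A] \<mu> kill by simp_all
    qed
    then show thesis using that n by blast
  next
    case False
    define c where "c = csqrt (- 1 / cdot Z Z)"
    define Z' where "Z' = c *s Z"
    have "c\<^sup>2 = - 1 / cdot Z Z" by (simp add: c_def)
    moreover have "cdot Z' Z' = c\<^sup>2 * cdot Z Z" by (simp add: Z'_def cdot_linear power2_eq_square)
    ultimately have ZZ: "cdot Z' Z' = - 1" using False by simp
    then have Z'0: "Z' \<noteq> 0" by (auto simp: cdot_def)
    have stable: "rho A Z' = Z' \<or> rho A Z' = - Z'" if A: "A \<in> G" for A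
    proof -
      obtain \<mu> where \<mu>: "rho A Z = \<mu> *s Z" using Z(2) A by blast
      have AL: "A \<in> lorentz" using A G by blast
      have \<mu>': "rho A Z' = \<mu> *s Z'"
        unfolding Z'_def rho_complex_linear [OF AL] \<mu> by (simp add: vector_smult_assoc mult.commute)
      have "\<mu>\<^sup>2 = 1" using cdot_rho [OF AL, of Z' Z'] ZZ by (simp add: \<mu>' cdot_linear power2_eq_square)
      then have "\<mu> = 1 \<or> \<mu> = -1" by (simp add: power2_eq_1_iff)
      then show ?thesis using \<mu>' by auto
    qed
    have fixed: "rho A Z' = Z'" if "A \<in> G" for A
    proof -
      let ?f = "\<lambda>A. Re (cdot (rho A Z') Z')"
      have minus: "cdot (- Z') Z' = - cdot Z' Z'" by (simp add: cdot_def)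
      have "?f A = ?f (mat 1)"
      proof (rule connected_square_constant [where S = G and f = ?f and c = 1])
        show "continuous_on G ?f"
          unfolding cdot_def by (intro continuous_intros continuous_rho)
        show "(?f A)\<^sup>2 = 1" if "A \<in> G" for A
          using stable [OF that] ZZ minus by auto
      qed (use G grp that in auto)
      then have "?f A = - 1" by (simp add: rho_one ZZ)
      then show ?thesis using stable [OF that] ZZ minus by auto
    qed
    have "cdot Z' Z' = - of_real (1\<^sup>2)" using ZZ by simp
    then obtain n where n: "n \<noteq> 0" "n $ 1 = 0" "quad n = 0" "gen Z' *v n = n"
      and uniq: "\<And>w. w $ 1 = 0 \<Longrightarrow> gen Z' *v w = w \<Longrightarrow> w \<in> span {n}"
      using null_eigenvector [OF Z'0, of 1] by auto
    have "A *v n \<in> span {n}" if A: "A \<in> G" for A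
    proof (rule uniq)
      show "(A *v n) $ 1 = 0" using isom_fix_preserves_hyperplane iso A n by blast
      show "gen Z' *v (A *v n) = A *v n" using inter [OF A] fixed grp(3) A n by simp
    qed
    then show thesis using that n by blast
  qed
qed

section \<open>Conjugation\<close>

definition conj_by :: "real^'n^'n \<Rightarrow> real^'n^'n \<Rightarrow> real^'n^'n" where
  "conj_by P A = P ** A ** matrix_inv P"

lemma conj_by_mult:
  assumes "invertible P" shows "conj_by P A ** conj_by P B = conj_by P (A ** B)"
proof -
  have "conj_by P A ** conj_by P B = P ** A ** (matrix_inv P ** P) ** B ** matrix_inv P"
    by (simp add: conj_by_def matrix_mul_assoc)
  then show ?thesis by (simp add: matrix_inv_both [OF assms] conj_by_def matrix_mul_assoc)
qed

lemma conj_by_one: "invertible P \<Longrightarrow> conj_by P (mat 1) = mat 1"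
  by (simp add: conj_by_def matrix_inv_both)

lemma conj_by_matrix_inv:
  assumes "invertible P" "invertible A"
  shows "matrix_inv (conj_by P A) = conj_by P (matrix_inv A)" "invertible (conj_by P A)"
proof -
  have "conj_by P A ** conj_by P (matrix_inv A) = mat 1"
    by (simp add: conj_by_mult [OF assms(1)] matrix_inv_both [OF assms(2)] conj_by_one [OF assms(1)])
  from matrix_inv_eqI [OF this]
  show "matrix_inv (conj_by P A) = conj_by P (matrix_inv A)" "invertible (conj_by P A)" .
qed

lemma linear_conj_by: "linear (conj_by P)"
  unfolding conj_by_def
  by (intro linear_compose [of "\<lambda>A. P ** A" "\<lambda>A. A ** matrix_inv P", unfolded o_def] bounded_linear.linear
      bounded_linear_matrix_mult_left bounded_linear_matrix_mult_right)

lemma matrix_inv_matrix_inv: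
  assumes "invertible (P :: real^'n^'n)" shows "matrix_inv (matrix_inv P) = P" "invertible (matrix_inv P)"
  using matrix_inv_eqI [OF matrix_inv_both(2) [OF assms]] by auto

lemma conj_by_cancel:
  assumes "invertible P"
  shows "conj_by P (conj_by (matrix_inv P) A) = A" "conj_by (matrix_inv P) (conj_by P A) = A"
proof -
  have "conj_by P (conj_by (matrix_inv P) A) = (P ** matrix_inv P) ** A ** (P ** matrix_inv P)"
    by (simp add: conj_by_def matrix_inv_matrix_inv [OF assms] matrix_mul_assoc)
  then show "conj_by P (conj_by (matrix_inv P) A) = A" by (simp add: matrix_inv_both [OF assms])
  have "conj_by (matrix_inv P) (conj_by P A) = (matrix_inv P ** P) ** A ** (matrix_inv P ** P)"
    by (simp add: conj_by_def matrix_inv_matrix_inv [OF assms] matrix_mul_assoc)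
  then show "conj_by (matrix_inv P) (conj_by P A) = A" by (simp add: matrix_inv_both [OF assms])
qed

lemma matrix_group_conj_by:
  assumes G: "matrix_group G" and P: "invertible P"
  shows "matrix_group (conj_by P ` G)"
  unfolding matrix_group_def
proof (intro conjI ballI)
  note grp = matrix_group_simps [OF G]
  show "mat 1 \<in> conj_by P ` G" using grp(1) conj_by_one [OF P] by (metis image_eqI)
  fix A assume "A \<in> conj_by P ` G"
  then obtain A' where A: "A' \<in> G" "A = conj_by P A'" by blast
  then have iA: "invertible A'" using G by (simp add: matrix_group_def)
  show "invertible A" using conj_by_matrix_inv [OF P iA] A by simp
  show "matrix_inv A \<in> conj_by P ` G" using conj_by_matrix_inv(1) [OF P iA] A grp(3) by simp
  fix B assume "B \<in> conj_by P ` G"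
  then obtain B' where "B' \<in> G" "B = conj_by P B'" by blast
  then show "A ** B \<in> conj_by P ` G" using conj_by_mult [OF P] A grp(2) by simp
qed

lemma connected_conj_by: "connected S \<Longrightarrow> connected (conj_by P ` S)"
  using linear_conj_by by (intro connected_continuous_image linear_continuous_on) (simp add: linear_conv_bounded_linear)

lemma conj_by_component:
  assumes P: "invertible P" and A: "A \<in> connected_component_set H (mat 1)"
  shows "conj_by P A \<in> connected_component_set (conj_by P ` H) (mat 1)"
proof -
  obtain S where S: "connected S" "S \<subseteq> H" "mat 1 \<in> S" "A \<in> S"
    using A by (auto simp: connected_component_def)
  have "connected (conj_by P ` S)" by (rule connected_conj_by [OF S(1)])
  moreover have "mat 1 \<in> conj_by P ` S" using S(3) conj_by_one [OF P] by (metis image_eqI)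
  ultimately show ?thesis
    using S unfolding mem_Collect_eq connected_component_def by (intro exI [of _ "conj_by P ` S"]) auto
qed

lemma lie_pair_conj_by:
  fixes P :: "real^'n^'n"
  assumes "lie_pair G g" and P: "invertible P"
  shows "lie_pair (conj_by P ` G) (conj_by P ` g)"
proof -
  let ?c = "conj_by P" and ?d = "conj_by (matrix_inv P)"
  note Q = matrix_inv_matrix_inv [OF P]
  have G: "matrix_group G" "connected G" "subspace g"
    and Ad: "\<And>A X. A \<in> G \<Longrightarrow> X \<in> g \<Longrightarrow> A ** X ** matrix_inv A \<in> g"
    and curve: "\<And>X. X \<in> g \<Longrightarrow> \<exists>\<gamma>. \<gamma> 0 = mat 1 \<and> (\<forall>\<^sub>F t in at 0. \<gamma> t \<in> G) \<and> (\<gamma> has_vector_derivative X) (at (0::real))"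
    and kill: "\<And>w A. \<forall>X\<in>g. X *v w = 0 \<Longrightarrow> A \<in> G \<Longrightarrow> A *v w = w"
    and comp: "\<And>H. matrix_group H \<Longrightarrow> G \<subseteq> H \<Longrightarrow> \<forall>A\<in>H. A - matrix_inv A \<in> g \<Longrightarrow>
        connected_component_set H (mat 1) \<subseteq> G"
    using assms(1) unfolding lie_pair_def by blast+
  have invG: "invertible A" if "A \<in> G" for A using G(1) that by (simp add: matrix_group_def)
  have "?c A ** ?c X ** matrix_inv (?c A) \<in> ?c ` g" if "A \<in> G" "X \<in> g" for A X
    using Ad [OF that] invG [OF that(1)] by (simp add: conj_by_matrix_inv [OF P] conj_by_mult [OF P])
  moreover have "\<exists>\<gamma>. \<gamma> 0 = mat 1 \<and> (\<forall>\<^sub>F t in at 0. \<gamma> t \<in> ?c ` G) \<and> (\<gamma> has_vector_derivative ?c X) (at (0::real))"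
    if X: "X \<in> g" for X
  proof -
    obtain \<gamma> where \<gamma>: "\<gamma> 0 = mat 1" "\<forall>\<^sub>F t in at 0. \<gamma> t \<in> G" "(\<gamma> has_vector_derivative X) (at (0::real))"
      using curve [OF X] by (elim exE conjE)
    have "((\<lambda>t. ?c (\<gamma> t)) has_vector_derivative ?c X) (at 0)"
      by (rule bounded_linear.has_vector_derivative [OF linear_conj_by [unfolded linear_conv_bounded_linear] \<gamma>(3)])
    moreover have "\<forall>\<^sub>F t in at 0. ?c (\<gamma> t) \<in> ?c ` G" using \<gamma>(2) by eventually_elim simp
    moreover have "?c (\<gamma> 0) = mat 1" using \<gamma>(1) conj_by_one [OF P] by simp
    ultimately show ?thesis by (intro exI [of _ "\<lambda>t. ?c (\<gamma> t)"] conjI)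
  qed
  moreover have "?c A *v w = w" if w: "\<forall>X\<in>?c ` g. X *v w = 0" and A: "A \<in> G" for w A
  proof -
    have "X *v (matrix_inv P *v w) = 0" if "X \<in> g" for X
    proof -
      have "matrix_inv P *v (?c X *v w) = (matrix_inv P ** P) *v (X *v (matrix_inv P *v w))"
        by (simp add: conj_by_def matrix_vector_mul_assoc matrix_mul_assoc)
      then show ?thesis using w that by (simp add: matrix_inv_both [OF P])
    qed
    then have "A *v (matrix_inv P *v w) = matrix_inv P *v w" using kill A by blast
    then have "P *v (A *v (matrix_inv P *v w)) = w" by (simp add: matrix_vector_mul_assoc matrix_inv_both [OF P])
    then show ?thesis by (simp add: conj_by_def matrix_vector_mul_assoc matrix_mul_assoc)
  qed
  moreover have "connected_component_set H (mat 1) \<subseteq> ?c ` G"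
    if H: "matrix_group H" "?c ` G \<subseteq> H" "\<forall>A\<in>H. A - matrix_inv A \<in> ?c ` g" for H
  proof -
    have "?d (?c A) \<in> ?d ` H" if "A \<in> G" for A using H(2) that by blast
    then have "G \<subseteq> ?d ` H" by (auto simp: conj_by_cancel [OF P])
    moreover have "A - matrix_inv A \<in> g" if A: "A \<in> ?d ` H" for A
    proof -
      obtain B where B: "B \<in> H" "A = ?d B" using A by blast
      then have "invertible B" using H(1) by (simp add: matrix_group_def)
      obtain X where X: "X \<in> g" "B - matrix_inv B = ?c X" using H(3) B by blast
      have "A - matrix_inv A = ?d (B - matrix_inv B)"
        using B(2) conj_by_matrix_inv(1) [OF Q(2) \<open>invertible B\<close>] by (simp add: linear_diff [OF linear_conj_by])
      then show ?thesis using X by (simp add: conj_by_cancel [OF P])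
    qed
    ultimately have le: "connected_component_set (?d ` H) (mat 1) \<subseteq> G"
      using comp [OF matrix_group_conj_by [OF H(1) Q(2)]] by blast
    show ?thesis
    proof
      fix A assume "A \<in> connected_component_set H (mat 1)"
      from conj_by_component [OF Q(2) this] have "?d A \<in> G" using le by blast
      then have "?c (?d A) \<in> ?c ` G" by blast
      then show "A \<in> ?c ` G" by (simp add: conj_by_cancel [OF P])
    qed
  qed
  moreover have "subspace (?c ` g)" using linear_conj_by G(3) by (rule linear_subspace_image)
  ultimately show ?thesis
    unfolding lie_pair_def using matrix_group_conj_by [OF G(1) P] connected_conj_by [OF G(2)]
    by (intro conjI ballI allI impI) auto
qed

section \<open>Connected Lie subgroups of the Lorentz group\<close>

lemma eventually_constant_derivative_0:
  assumes "(h has_vector_derivative d) (at (0::real))" "\<forall>\<^sub>F t in at 0. h t = h 0"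
  shows "d = 0"
proof -
  have "((\<lambda>t. h 0) has_vector_derivative d) (at 0)"
    using assms by (simp add: has_vector_derivative_def has_derivative_transform_eventually)
  then show ?thesis using vector_derivative_unique_at has_vector_derivative_const by blast
qed

text \<open>
  Differentiate the constant function \<open>t \<mapsto> form (\<gamma> t x) (\<gamma> t y)\<close> along a curve \<open>\<gamma>\<close> in \<open>G\<close>.
\<close>

lemma lie_pair_skew:
  assumes "lie_pair G g" "G \<subseteq> isom_fix S" "X \<in> g"
  shows "form (X *v x) y = - form x (X *v y)"
proof -
  obtain \<gamma> where \<gamma>: "\<gamma> 0 = mat 1" "\<forall>\<^sub>F t in at 0. \<gamma> t \<in> G" "(\<gamma> has_vector_derivative X) (at (0::real))"
    using assms(1,3) unfolding lie_pair_def by blast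
  have d: "((\<lambda>t. \<gamma> t *v x) has_vector_derivative X *v x) (at 0)" for x
    by (rule bounded_linear.has_vector_derivative [OF bounded_bilinear.bounded_linear_left
          [OF bounded_bilinear_matrix_vector_mult] \<gamma>(3)])
  have "form (\<gamma> 0 *v x) (X *v y) + form (X *v x) (\<gamma> 0 *v y) = 0"
  proof (rule eventually_constant_derivative_0)
    show "((\<lambda>t. form (\<gamma> t *v x) (\<gamma> t *v y)) has_vector_derivative
        form (\<gamma> 0 *v x) (X *v y) + form (X *v x) (\<gamma> 0 *v y)) (at 0)"
      by (rule bounded_bilinear.has_vector_derivative [OF bounded_bilinear_form d d])
    show "\<forall>\<^sub>F t in at 0. form (\<gamma> t *v x) (\<gamma> t *v y) = form (\<gamma> 0 *v x) (\<gamma> 0 *v y)"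
      using \<gamma>(2) by eventually_elim (use assms(2) isom_fix_form \<gamma>(1) in auto)
  qed
  then show ?thesis by (simp add: \<gamma>(1))
qed

lemma lie_pair_kills_fixed:
  assumes "lie_pair G g" "\<And>A. A \<in> G \<Longrightarrow> A *v w = w" "X \<in> g"
  shows "X *v w = 0"
proof -
  obtain \<gamma> where \<gamma>: "\<gamma> 0 = mat 1" "\<forall>\<^sub>F t in at 0. \<gamma> t \<in> G" "(\<gamma> has_vector_derivative X) (at (0::real))"
    using assms(1,3) unfolding lie_pair_def by blast
  show ?thesis
  proof (rule eventually_constant_derivative_0)
    show "((\<lambda>t. \<gamma> t *v w) has_vector_derivative X *v w) (at 0)"
      by (rule bounded_linear.has_vector_derivative [OF bounded_bilinear.bounded_linear_left
          [OF bounded_bilinear_matrix_vector_mult] \<gamma>(3)])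
    show "\<forall>\<^sub>F t in at 0. \<gamma> t *v w = \<gamma> 0 *v w"
      using \<gamma>(2) by eventually_elim (use assms(2) \<gamma>(1) in auto)
  qed
qed

lemma isom_fix_minus_inverse:
  assumes "A \<in> isom_fix S" "e1 \<in> S"
  shows "A - matrix_inv A = gen (gen_inv (A - matrix_inv A))"
proof (rule skew_imp_gen)
  have Ai: "matrix_inv A \<in> isom_fix S" using assms matrix_group_simps [OF matrix_group_isom_fix] by blast
  have ii: "matrix_inv (matrix_inv A) = A" using isom_fix_inv(4) [OF assms(1)] matrix_inv_eqI by blast
  show "form ((A - matrix_inv A) *v x) y = - form x ((A - matrix_inv A) *v y)" for x y
    by (simp add: matrix_vector_mult_diff_rdistrib form_linear isom_fix_adjoint [OF assms(1)] isom_fix_adjoint [OF Ai] ii)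
  show "(A - matrix_inv A) *v e1 = 0"
    using assms Ai by (simp add: matrix_vector_mult_diff_rdistrib isom_fix_def)
qed

lemma lie_pair_gen:
  assumes G: "lie_pair G g" "G \<subseteq> lorentz" and X: "X \<in> g"
  shows "X = gen (gen_inv X)"
proof (rule skew_imp_gen)
  have iso: "G \<subseteq> isom_fix {e1}" using G(2) lorentz_isom_fix by blast
  show "form (X *v x) y = - form x (X *v y)" for x y by (rule lie_pair_skew [OF G(1) iso X])
  show "X *v e1 = 0"
    by (rule lie_pair_kills_fixed [OF G(1) _ X]) (use iso in \<open>auto simp: isom_fix_def\<close>)
qed

lemma lie_pair_rho:
  assumes G: "lie_pair G g" "G \<subseteq> lorentz" and "A \<in> G" "gen F \<in> g"
  shows "gen (rho A F) \<in> g"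
proof -
  have "A \<in> isom_fix {e1}" using assms lorentz_isom_fix by blast
  then have "gen (rho A F) = A ** gen F ** matrix_inv A" by (rule gen_rho) simp
  then show ?thesis using assms unfolding lie_pair_def by simp
qed

text \<open>
  Differentiate \<open>\<gamma> Y \<gamma>\<^sup>-\<^sup>1\<close>, which stays in the Lie algebra, along a curve \<open>\<gamma>\<close> in \<open>G\<close> with velocity \<open>F\<close>.
\<close>

lemma lie_pair_ccross:
  assumes G: "lie_pair G g" "G \<subseteq> lorentz" and F: "gen F \<in> g" and Y: "gen Y \<in> g"
  shows "gen (ccross F Y) \<in> g"
proof -
  define p where "p = {F. gen F \<in> g}"
  have p: "subspace p" using G(1) by (simp add: lie_pair_def p_def subspace_def gen_linear)
  obtain \<gamma> where \<gamma>: "\<gamma> 0 = mat 1" "\<forall>\<^sub>F t in at 0. \<gamma> t \<in> G" "(\<gamma> has_vector_derivative gen F) (at (0::real))"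
    using G(1) F unfolding lie_pair_def by blast
  let ?h = "\<lambda>t. rho (\<gamma> t) Y"
  have "(?h has_vector_derivative gen_inv (\<gamma> 0 ** gen Y ** form_adj (gen F) + gen F ** gen Y ** form_adj (\<gamma> 0))) (at 0)"
    unfolding rho_def
    by (intro bounded_linear.has_vector_derivative [OF linear_gen_inv [unfolded linear_conv_bounded_linear]]
        has_vector_derivative_matrix_mult bounded_linear.has_vector_derivative [OF bounded_linear_matrix_mult_left]
        bounded_linear.has_vector_derivative [OF linear_form_adj [unfolded linear_conv_bounded_linear]] \<gamma>(3))
  moreover have "form_adj (mat 1) = mat 1" "form_adj (gen F) = - gen F"
    by (simp_all add: form_adj_def vec_eq_iff forall_5 mat_def)
  ultimately have "(?h has_vector_derivative gen_inv (gen F ** gen Y - gen Y ** gen F)) (at 0)"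
    using bounded_bilinear.minus_right [OF bounded_bilinear_matrix_mult, of "gen Y" "gen F"]
    by (simp add: \<gamma>(1))
  then have "(?h has_vector_derivative ccross F Y) (at 0)" by (simp add: gen_ccross)
  moreover have "\<forall>\<^sub>F t in at 0. ?h t \<in> p"
    using \<gamma>(2) by eventually_elim (use lie_pair_rho [OF G] Y in \<open>auto simp: p_def\<close>)
  moreover have "?h 0 \<in> p" using Y by (simp add: p_def \<gamma>(1) rho_one)
  ultimately have "ccross F Y \<in> p" using velocity_in_subspace [OF p, of ?h] by blast
  then show ?thesis by (simp add: p_def)
qed

text \<open>
  The cases are distinguished by the position of the Lie algebra \<open>p\<close> relative to the complex structure of
  \<open>\<complex>\<^sup>3\<close>: all of \<open>\<complex>\<^sup>3\<close>; proper, with \<open>p \<inter> \<i>p \<noteq> 0\<close>; totally real of real dimension at least two; a real line; zero.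
\<close>

lemma lie_pair_trichotomy:
  assumes G: "lie_pair G g" "G \<subseteq> lorentz"
  shows "G = lorentz \<or> (\<exists>n. n \<noteq> 0 \<and> quad n = 0 \<and> (\<forall>A\<in>G. A *v n \<in> span {n})) \<or>
    (\<exists>w. w \<noteq> 0 \<and> w $ 1 = 0 \<and> (\<forall>A\<in>G. A *v w = w))"
proof -
  have grp: "matrix_group G" "connected G" and g: "subspace g"
    and kill: "\<And>w A. \<forall>X\<in>g. X *v w = 0 \<Longrightarrow> A \<in> G \<Longrightarrow> A *v w = w"
    and comp: "\<And>H. matrix_group H \<Longrightarrow> G \<subseteq> H \<Longrightarrow> \<forall>A\<in>H. A - matrix_inv A \<in> g \<Longrightarrow>
        connected_component_set H (mat 1) \<subseteq> G"
    using G(1) unfolding lie_pair_def by blast+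
  have iso: "G \<subseteq> isom_fix {e1}" using G(2) lorentz_isom_fix by blast
  define p where "p = {F. gen F \<in> g}"
  have g_gen: "\<exists>F\<in>p. X = gen F" if "X \<in> g" for X
    using lie_pair_gen [OF G that] that unfolding p_def by (metis mem_Collect_eq)
  have p: "subspace p"
    using g by (simp add: p_def subspace_def gen_linear)
  have rho_p: "rho A F \<in> p" if "A \<in> G" "F \<in> p" for A F
    using lie_pair_rho [OF G] that by (simp add: p_def)
  have cross: "ccross F Y \<in> p" if "F \<in> p" "Y \<in> p" for F Y
    using lie_pair_ccross [OF G] that by (simp add: p_def)
  have line: ?thesis if "Z \<noteq> 0" "\<And>A. A \<in> G \<Longrightarrow> \<exists>\<mu>. rho A Z = \<mu> *s Z" for Z
    using stable_complex_line_imp_null [OF grp G(2) that] by metis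
  have fixed: ?thesis if "w \<noteq> 0" "w $ 1 = 0" "\<And>F. F \<in> p \<Longrightarrow> gen F *v w = 0" for w
    using that kill g_gen by metis
  show ?thesis
  proof (cases "p = UNIV")
    case True
    have "lorentz \<subseteq> G"
    proof (rule comp [OF matrix_group_isom_fix iso], rule ballI)
      fix A assume "A \<in> isom_fix {e1}"
      then have "A - matrix_inv A = gen (gen_inv (A - matrix_inv A))" by (rule isom_fix_minus_inverse) simp
      moreover have "gen_inv (A - matrix_inv A) \<in> p" using True by blast
      ultimately show "A - matrix_inv A \<in> g" by (simp add: p_def)
    qed
    then show ?thesis using G(2) by blast
  next
    case proper: False
    show ?thesis
    proof (cases "\<exists>F\<in>p. \<i> *s F \<in> p \<and> F \<noteq> 0")
      case True
      then obtain F0 where F0: "F0 \<in> p" "\<i> *s F0 \<in> p" "F0 \<noteq> 0" by blast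
      define c where "c = {F \<in> p. \<i> *s F \<in> p}"
      obtain Z where Z: "Z \<noteq> 0" "\<And>\<rho>. \<rho> \<in> rho ` G \<Longrightarrow> \<exists>\<mu>. \<rho> Z = \<mu> *s Z"
      proof (rule stable_complex_line [of c F0 "rho ` G"])
        show "F + Y \<in> c" if "F \<in> c" "Y \<in> c" for F Y
          using that p by (simp add: c_def subspace_add vector_add_ldistrib)
        show "a *s F \<in> c" if "F \<in> c" for a F
        proof -
          \<comment> \<open>\<open>c = p \<inter> \<i>p\<close> is the largest complex subspace of \<open>p\<close>\<close>
          have "\<i> *s (a *s F) = Re a *\<^sub>R (\<i> *s F) - Im a *\<^sub>R F"
            by (simp add: vec_eq_iff complex_eq_iff)
          then show ?thesis
            using that p complex_smult_split [of a F] by (simp add: c_def subspace_add subspace_diff subspace_scale)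
        qed
        show "c \<noteq> UNIV" using proper by (auto simp: c_def)
        show "F0 \<in> c" "F0 \<noteq> 0" using F0 by (simp_all add: c_def)
        show "\<rho> F \<in> c" if "\<rho> \<in> rho ` G" "F \<in> c" for \<rho> F
          using that rho_p G(2) by (auto simp: c_def simp flip: rho_complex_linear)
        show "\<rho> (ccross F Y) = ccross (\<rho> F) (\<rho> Y)" if "\<rho> \<in> rho ` G" for \<rho> F Y
          using that iso rho_ccross by blast
      qed (rule that)
      then show ?thesis using line by blast
    next
      case tot: False
      show ?thesis
      proof (cases "\<exists>F\<in>p. F \<noteq> 0")
        case True
        then obtain F0 where F0: "F0 \<in> p" "F0 \<noteq> 0" by blast
        show ?thesis
        proof (cases "\<exists>Y\<in>p. \<forall>r. Y \<noteq> r *\<^sub>R F0")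
          case True
          then obtain Y0 where Y0: "Y0 \<in> p" "\<And>r. Y0 \<noteq> r *\<^sub>R F0" by blast
          obtain F Y where FY: "cdot F F \<in> \<real>" "cdot Y Y \<in> \<real>" "cdot F Y \<in> \<real>"
            and gens: "\<And>U. U \<in> p \<Longrightarrow> \<exists>a b c. U = a *\<^sub>R F + b *\<^sub>R Y + c *\<^sub>R ccross F Y"
            by (rule real_form_generators [OF p cross _ F0 Y0]) (use tot in auto)
          obtain w where w: "w \<noteq> 0" "w $ 1 = 0" "gen F *v w = 0" "gen Y *v w = 0"
            using common_kernel [OF FY] by blast
          have "gen (ccross F Y) *v w = 0"
            using w by (simp add: matrix_vector_mult_diff_rdistrib flip: gen_ccross matrix_vector_mul_assoc)
          then have "gen U *v w = 0" if "U \<in> p" for U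
            using gens [OF that] w
            by (auto simp: gen_linear matrix_vector_mult_add_rdistrib simp flip: scaleR_matrix_vector_assoc)
          then show ?thesis using fixed w by blast
        next
          case False
          have "\<exists>\<mu>. rho A F0 = \<mu> *s F0" if A: "A \<in> G" for A
          proof -
            obtain r where "rho A F0 = r *\<^sub>R F0" using False rho_p [OF A F0(1)] by blast
            then have "rho A F0 = of_real r *s F0" using complex_smult_split [of "of_real r" F0] by simp
            then show ?thesis by blast
          qed
          then show ?thesis using line F0 by blast
        qed
      next
        case False
        then have "gen F *v e2 = 0" if "F \<in> p" for F using that by (auto simp: gen_linear)
        then show ?thesis using fixed [of e2] by (auto simp: axis_def vec_eq_iff)
      qed
    qed
  qed
qed

section \<open>Rotations as products of reflections\<close>

definition reflection :: "real^5 \<Rightarrow> real^5^5" where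
  "reflection u = (\<chi> i j. (if i = j then 1 else 0) - 2 * msign j * u$j * u$i / quad u)"

lemma reflection_mult: "reflection u *v x = x - (2 * form u x / quad u) *\<^sub>R u"
proof -
  have "(reflection u *v x) $ i = (x - (2 * form u x / quad u) *\<^sub>R u) $ i" for i
  proof -
    have "(reflection u *v x) $ i = (\<Sum>j\<in>UNIV. (if i = j then x$j else 0) - (2 * u$i / quad u) * (msign j * u$j * x$j))"
      unfolding reflection_def matrix_vector_mult_def by (simp, intro sum.cong) (auto simp: algebra_simps)
    also have "\<dots> = x$i - (2 * u$i / quad u) * form u x"
      by (simp add: sum_subtractf form_def sum_distrib_left)
    finally show ?thesis by simp
  qed
  then show ?thesis by (simp add: vec_eq_iff)
qed

lemma reflection_isom_fix: "quad u \<noteq> 0 \<Longrightarrow> (\<And>s. s \<in> S \<Longrightarrow> form s u = 0) \<Longrightarrow> reflection u \<in> isom_fix S"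
  by (auto simp: isom_fix_def reflection_mult form_linear form_commute field_simps)

lemma reflection_square: "quad u \<noteq> 0 \<Longrightarrow> reflection u ** reflection u = mat 1"
proof -
  assume "quad u \<noteq> 0"
  then have "(reflection u ** reflection u) *v x = mat 1 *v x" for x
    by (simp add: reflection_mult form_linear flip: matrix_vector_mul_assoc)
  then show ?thesis using matrix_eq by blast
qed

lemma reflection_maps:
  assumes "quad u = quad v" "quad (u - v) \<noteq> 0" shows "reflection (u - v) *v u = v"
proof -
  have "quad (u - v) = 2 * form (u - v) u"
    using assms(1) by (simp add: form_linear form_commute [of v u])
  then have "2 * form (u - v) u / quad (u - v) = 1" using assms(2) by simp
  then show ?thesis by (simp add: reflection_mult)
qed

lemma rotation_maps:
  assumes "quad u = quad v" "quad u \<noteq> 0" "quad (u + v) \<noteq> 0"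
  shows "(reflection (u + v) ** reflection u) *v u = v"
proof -
  have "quad (u + v) = 2 * form (u + v) u"
    using assms(1) by (simp add: form_linear form_commute [of v u])
  then have "2 * form (u + v) u / quad (u + v) = 1" using assms(3) by simp
  then have "reflection (u + v) *v (- u) = v" by (simp add: reflection_mult form_linear(8))
  moreover have "reflection u *v u = - u" using assms(2) by (simp add: reflection_mult vec_eq_iff)
  ultimately show ?thesis by (simp flip: matrix_vector_mul_assoc)
qed

lemma continuous_reflection: "continuous_on {u. quad u \<noteq> 0} reflection"
  unfolding reflection_def
  by (intro continuous_on_vec_lambda continuous_intros bounded_bilinear.continuous_on [OF bounded_bilinear_form]) auto

text \<open>
  Deform \<open>u + v\<close> linearly to \<open>u\<close>; at the end the two reflections cancel.
\<close>

lemma rotation_in_component: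
  assumes "\<And>t. 0 \<le> t \<Longrightarrow> t \<le> 1 \<Longrightarrow> quad (u + t *\<^sub>R v) \<noteq> 0"
    and "\<And>s. s \<in> S \<Longrightarrow> form s u = 0" "\<And>s. s \<in> S \<Longrightarrow> form s v = 0"
  shows "reflection (u + v) ** reflection u \<in> connected_component_set (isom_fix S) (mat 1)"
proof -
  let ?\<gamma> = "\<lambda>t. reflection (u + t *\<^sub>R v) ** reflection u"
  have u: "quad u \<noteq> 0" using assms(1) [of 0] by simp
  have "continuous_on {0..1::real} ?\<gamma>"
    by (intro continuous_on_matrix_mult continuous_on_compose2 [OF continuous_reflection] continuous_intros)
      (use assms(1) in auto)
  then have "connected (?\<gamma> ` {0..1})" by (intro connected_continuous_image) auto
  moreover have "?\<gamma> ` {0..1} \<subseteq> isom_fix S"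
    using assms u matrix_group_simps(2) [OF matrix_group_isom_fix [of S]] reflection_isom_fix
    by (auto simp: form_linear)
  moreover have "mat 1 \<in> ?\<gamma> ` {0..1}"
    using reflection_square [OF u] by (intro image_eqI [of _ _ 0]) auto
  moreover have "reflection (u + v) ** reflection u \<in> ?\<gamma> ` {0..1}" by (intro image_eqI [of _ _ 1]) auto
  ultimately show ?thesis unfolding mem_Collect_eq connected_component_def by blast
qed

lemma form_axis_axis: "form (axis i 1) (axis j 1) = (if i = j then msign i else 0)"
  unfolding form_axis(1) by (simp add: axis_def)

lemma connected_nonzero_pos:
  fixes f :: "'a::topological_space \<Rightarrow> real"
  assumes "connected S" "continuous_on S f" "\<And>x. x \<in> S \<Longrightarrow> f x \<noteq> 0" "a \<in> S" "f a > 0" "x \<in> S"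
  shows "f x > 0"
proof (rule ccontr)
  assume "\<not> f x > 0"
  then have "f x \<le> 0" "0 \<le> f a" using assms(5) by auto
  moreover have "connected (f ` S)" using assms by (intro connected_continuous_image)
  ultimately have "0 \<in> f ` S" using assms(4,6) connectedD_interval [of "f ` S" "f x" "f a" 0] by blast
  then show False using assms(3) by force
qed

lemma det_lorentz: assumes "A \<in> lorentz" shows "det A > 0"
proof (rule connected_nonzero_pos [where S = lorentz and f = det and a = "mat 1"])
  show "continuous_on lorentz det" unfolding det_def by (intro continuous_intros)
  show "det B \<noteq> 0" if "B \<in> lorentz" for B
    using that lorentz_isom_fix isom_fix_inv(2) invertible_det_nz by blast
qed (use assms one_in_lorentz in auto)

text \<open>
  An isometry that fixes \<open>e1\<close> cannot move the timelike vector \<open>e2\<close> to a vector with time component \<open>0\<close>, so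
  the sign of this component is constant on the connected group.
\<close>

lemma lorentz_e2: assumes "A \<in> lorentz" shows "(A *v e2) $ 2 > 0"
proof (rule connected_nonzero_pos [where S = lorentz and f = "\<lambda>A. (A *v e2) $ 2" and a = "mat 1"])
  show "continuous_on lorentz (\<lambda>A. (A *v e2) $ 2)"
    by (intro continuous_intros bounded_linear.continuous_on [OF bounded_bilinear.bounded_linear_left
          [OF bounded_bilinear_matrix_vector_mult]])
  show "(B *v e2) $ 2 \<noteq> 0" if "B \<in> lorentz" for B
  proof
    assume 2: "(B *v e2) $ 2 = 0"
    have B: "B \<in> isom_fix {e1}" using that lorentz_isom_fix by blast
    have "(B *v e2) $ 1 = 0" using isom_fix_preserves_hyperplane [OF B, of e2] by (simp add: axis_def)
    then have "quad (B *v e2) \<ge> 0" using 2 by (simp add: form_expand)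
    then show False using isom_fix_form [OF B, of e2 e2] by (simp add: form_axis_axis)
  qed
qed (use assms one_in_lorentz in \<open>auto simp: axis_def\<close>)

lemma isom_fix_component_mono:
  "S' \<subseteq> S \<Longrightarrow> connected_component_set (isom_fix S) (mat 1) \<subseteq> connected_component_set (isom_fix S') (mat 1)"
  by (intro connected_component_mono) (auto simp: isom_fix_def)

lemma spacelike_definite:
  assumes "form e1 x = 0" "form e2 x = 0"
  shows "quad x \<ge> 0" "quad x = 0 \<Longrightarrow> x = 0"
proof -
  have x: "x$1 = 0" "x$2 = 0" using assms by (simp_all add: form_axis)
  then show "quad x \<ge> 0" by (simp add: form_expand)
  assume "quad x = 0"
  then have "(x$3)\<^sup>2 + (x$4)\<^sup>2 + (x$5)\<^sup>2 = 0" using x by (simp add: form_expand power2_eq_square)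
  then have "x$3 = 0 \<and> x$4 = 0 \<and> x$5 = 0"
    by (smt (verit) zero_le_power2 power2_eq_iff power_zero_numeral zero_eq_power2)
  then show "x = 0" using x by (simp add: vec_eq_iff forall_5)
qed

text \<open>
  The product of the reflections in \<open>u + v\<close> and \<open>u\<close> maps \<open>u\<close> to \<open>v\<close> unless \<open>v = - u\<close>. For antipodal vectors pass through
  the unit vector \<open>z\<close>.
\<close>

lemma spacelike_transitive:
  assumes S: "e1 \<in> S" "e2 \<in> S"
    and perp: "\<And>s. s \<in> S \<Longrightarrow> form s u = 0" "\<And>s. s \<in> S \<Longrightarrow> form s v = 0" "\<And>s. s \<in> S \<Longrightarrow> form s z = 0"
    and unit: "quad u = 1" "quad v = 1" "quad z = 1" and uz: "form u z = 0"
    and H: "matrix_group H" "connected_component_set (isom_fix S) (mat 1) \<subseteq> H"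
  obtains B where "B \<in> H" "B \<in> isom_fix S" "B *v u = v"
proof -
  have step: "\<exists>B. B \<in> H \<and> B \<in> isom_fix S \<and> B *v x = y"
    if x: "\<And>s. s \<in> S \<Longrightarrow> form s x = 0" "quad x = 1" and y: "\<And>s. s \<in> S \<Longrightarrow> form s y = 0" "quad y = 1"
      and xy: "x + y \<noteq> 0" for x y
  proof -
    have nz: "quad (x + t *\<^sub>R y) \<noteq> 0" if t: "0 \<le> t" "t \<le> 1" for t
    proof
      assume "quad (x + t *\<^sub>R y) = 0"
      then have "x + t *\<^sub>R y = 0" using spacelike_definite(2) x y S by (simp add: form_linear)
      then have eq: "x = (- t) *\<^sub>R y" by (simp add: add_eq_0_iff)
      then have "t * t = 1" using x(2) y(2) by (simp add: form_linear)
      then have "t = 1" using t by (metis abs_of_nonneg abs_square_eq_1 power2_eq_square)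
      then show False using eq xy by simp
    qed
    have "reflection (x + y) ** reflection x \<in> connected_component_set (isom_fix S) (mat 1)"
      using nz x y by (intro rotation_in_component)
    moreover have "(reflection (x + y) ** reflection x) *v x = y"
      using nz [of 1] x y by (intro rotation_maps) auto
    ultimately show ?thesis using H(2) connected_component_subset by blast
  qed
  show thesis
  proof (cases "u + v = 0")
    case False
    then show ?thesis using step [of u v] perp unit that by blast
  next
    case True
    have ne: "u + z \<noteq> 0" "z + v \<noteq> 0"
    proof -
      have v: "v = - u" using True by (simp add: add_eq_0_iff2 minus_unique)
      have "quad (u + z) = 2" "quad (z + v) = 2"
        using unit uz v by (simp_all add: form_linear form_commute [of z u])
      then show "u + z \<noteq> 0" "z + v \<noteq> 0" using form_linear(9) [of 0] by (metis zero_neq_numeral)+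
    qed
    obtain B B' where "B \<in> H" "B \<in> isom_fix S" "B *v u = z" "B' \<in> H" "B' \<in> isom_fix S" "B' *v z = v"
      using step [of u z] step [of z v] perp unit ne by metis
    then show ?thesis
      using that [of "B' ** B"] matrix_group_simps(2) [OF H(1)] matrix_group_simps(2) [OF matrix_group_isom_fix]
      by (simp flip: matrix_vector_mul_assoc)
  qed
qed

text \<open>
  Connectedness of \<open>SO(3)\<close> in disguise: products of pairs of reflections, which lie in the identity
  component, bring the images of the third and the fourth basis vector back to their places. What
  remains is the identity or a reflection, and the latter has negative determinant.
\<close>

lemma SO3_generated:
  assumes H: "matrix_group H" "connected_component_set (isom_fix {e1, e2}) (mat 1) \<subseteq> H" "H \<subseteq> lorentz"
    and A: "A \<in> lorentz" "A *v e2 = e2"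
  shows "A \<in> H"
proof -
  note grp = matrix_group_simps [OF H(1)]
  let ?e3 = "axis 3 1 :: real^5" and ?e4 = "axis 4 1 :: real^5" and ?e5 = "axis 5 1 :: real^5"
  have Ai: "A \<in> isom_fix {e1, e2}" using A lorentz_isom_fix by (auto simp: isom_fix_def)
  have HL: "H \<subseteq> isom_fix {e1}" using H(3) lorentz_isom_fix by blast
  note ax = form_axis_axis
  have perp: "form s (X *v y) = 0" if "X \<in> isom_fix S" "s \<in> S" "form s y = 0" for X S s y
  proof -
    have "form (X *v s) (X *v y) = form s y" using that isom_fix_form by blast
    then show ?thesis using that by (simp add: isom_fix_def)
  qed
  obtain B where B: "B \<in> H" "B \<in> isom_fix {e1, e2}" "B *v ?e3 = A *v ?e3"
  proof (rule spacelike_transitive [of "{e1, e2}" ?e3 "A *v ?e3" ?e4 H])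
    show "form s (A *v ?e3) = 0" if "s \<in> {e1, e2}" for s using perp [OF Ai that] that by (auto simp: ax)
  qed (use H isom_fix_form [OF Ai, of ?e3 ?e3] in \<open>auto simp: ax\<close>)
  define A1 where "A1 = matrix_inv B ** A"
  have A1: "A1 \<in> isom_fix {e1, e2, ?e3}"
  proof -
    have "A1 \<in> isom_fix {e1, e2}"
      unfolding A1_def using matrix_group_simps [OF matrix_group_isom_fix [of "{e1, e2}"]] B(2) Ai by blast
    moreover have "A1 *v ?e3 = matrix_inv B *v (B *v ?e3)"
      by (simp add: A1_def B(3) flip: matrix_vector_mul_assoc)
    then have "A1 *v ?e3 = ?e3" using isom_fix_inv(4) [OF B(2)] by (simp add: matrix_vector_mul_assoc)
    ultimately show ?thesis by (simp add: isom_fix_def)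
  qed
  have mono: "connected_component_set (isom_fix {e1, e2, ?e3}) (mat 1) \<subseteq> H"
    using isom_fix_component_mono [of "{e1, e2}" "{e1, e2, ?e3}"] H(2) by blast
  obtain C where C: "C \<in> H" "C \<in> isom_fix {e1, e2, ?e3}" "C *v ?e4 = A1 *v ?e4"
  proof (rule spacelike_transitive [of "{e1, e2, ?e3}" ?e4 "A1 *v ?e4" ?e5 H])
    show "form s (A1 *v ?e4) = 0" if "s \<in> {e1, e2, ?e3}" for s using perp [OF A1 that] that by (auto simp: ax)
  qed (use H(1) mono isom_fix_form [OF A1, of ?e4 ?e4] in \<open>auto simp: ax\<close>)
  define A2 where "A2 = matrix_inv C ** A1"
  have A2: "A2 \<in> isom_fix {e1, e2, ?e3, ?e4}"
  proof -
    have "A2 \<in> isom_fix {e1, e2, ?e3}"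
      unfolding A2_def using matrix_group_simps [OF matrix_group_isom_fix [of "{e1, e2, ?e3}"]] C(2) A1 by blast
    moreover have "A2 *v ?e4 = matrix_inv C *v (C *v ?e4)"
      by (simp add: A2_def C(3) flip: matrix_vector_mul_assoc)
    then have "A2 *v ?e4 = ?e4" using isom_fix_inv(4) [OF C(2)] by (simp add: matrix_vector_mul_assoc)
    ultimately show ?thesis by (simp add: isom_fix_def)
  qed
  have A_eq: "A = B ** (C ** A2)"
  proof -
    have "B ** (C ** A2) = (B ** (C ** matrix_inv C) ** matrix_inv B) ** A"
      by (simp add: A2_def A1_def matrix_mul_assoc)
    then show ?thesis by (simp add: isom_fix_inv(3) [OF B(2)] isom_fix_inv(3) [OF C(2)])
  qed
  have cols: "A2 *v e1 = e1" "A2 *v e2 = e2" "A2 *v ?e3 = ?e3" "A2 *v ?e4 = ?e4"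
    using A2 by (simp_all add: isom_fix_def)
  define a where "a = (A2 *v ?e5) $ 5"
  have comp: "(A2 *v ?e5) $ 1 = 0" "(A2 *v ?e5) $ 2 = 0" "(A2 *v ?e5) $ 3 = 0" "(A2 *v ?e5) $ 4 = 0"
    using perp [OF A2, of e1 ?e5] perp [OF A2, of e2 ?e5] perp [OF A2, of ?e3 ?e5] perp [OF A2, of ?e4 ?e5]
    by (simp_all add: ax form_axis(1) [of _ "A2 *v ?e5"])
  moreover have "quad (A2 *v ?e5) = 1" unfolding isom_fix_form [OF A2] ax by simp
  ultimately have "a\<^sup>2 = 1" by (simp add: form_expand a_def power2_eq_square)
  have entry: "A2 $ i $ j = (A2 *v axis j 1) $ i" for i j by (simp add: matrix_vector_mult_basis column_def)
  have A2_entries: "A2 $ i $ j = (if i = j then if i = 5 then a else 1 else 0)" for i j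
  proof -
    have "A2 $ i $ j = (axis j 1 :: real^5) $ i" if "j \<noteq> 5"
      using exhaust_5 [of j] that by (auto simp: entry cols)
    moreover have "A2 $ i $ 5 = (if i = 5 then a else 0)"
      using exhaust_5 [of i] comp by (auto simp: entry a_def)
    ultimately show ?thesis by (cases "j = 5") (auto simp: axis_def)
  qed
  have "det A2 = a"
  proof -
    have "det A2 = prod (\<lambda>i. A2$i$i) UNIV" by (rule det_diagonal) (simp add: A2_entries)
    also have "\<dots> = A2$1$1 * A2$2$2 * A2$3$3 * A2$4$4 * A2$5$5" unfolding UNIV_5 by (simp add: mult.assoc)
    also have "\<dots> = a" unfolding A2_entries by simp
    finally show ?thesis .
  qed
  moreover have "det A = det B * (det C * det A2)" by (simp add: A_eq det_mul)
  moreover have "det A > 0" "det B > 0" "det C > 0" using det_lorentz A(1) B(1) C(1) H(3) by blast+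
  ultimately have "a > 0" by (simp add: zero_less_mult_iff)
  then have "a = 1" using \<open>a\<^sup>2 = 1\<close> by (simp add: power2_eq_1_iff)
  then have "A2 = mat 1" by (simp add: vec_eq_iff A2_entries mat_def)
  then show ?thesis using A_eq B C grp(2) by simp
qed

section \<open>Stabilizers of timelike vectors\<close>

text \<open>
  Scaled to unit length, \<open>w\<close> compensates the timelike unit vector \<open>e1\<close>.
\<close>

lemma fixed_spacelike_imp_null:
  assumes "w $ 1 = 0" "quad w > 0" "G \<subseteq> isom_fix {e1}" "\<And>A. A \<in> G \<Longrightarrow> A *v w = w"
  obtains n where "n \<noteq> 0" "quad n = 0" "\<And>A. A \<in> G \<Longrightarrow> A *v n = n"
proof
  let ?n = "e1 + (1 / sqrt (quad w)) *\<^sub>R w"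
  have "?n $ 1 = 1" using assms(1) by simp
  then show "?n \<noteq> 0" by (metis zero_index zero_neq_one)
  have "form e1 w = 0" "form w e1 = 0" "quad e1 = -1" using assms(1) by (simp_all add: form_axis)
  then show "quad ?n = 0" using assms(2) by (simp add: form_linear)
  show "A *v ?n = ?n" if "A \<in> G" for A
    using assms(3,4) that by (auto simp: matrix_vector_right_distrib matrix_vector_mult_scaleR isom_fix_def)
qed

text \<open>
  The Lie algebra consists of rotations only. Two of them with nonzero cross product span, together with
  the cross product, all rotations, and \<open>G\<close> is the whole stabilizer. Otherwise all of them have a common axis,
  which \<open>G\<close> fixes pointwise.
\<close>

lemma e2_stabilizer:
  assumes G: "lie_pair G g" "G \<subseteq> lorentz" and e2: "\<And>A. A \<in> G \<Longrightarrow> A *v e2 = e2"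
  shows "G = {A \<in> lorentz. A *v e2 = e2} \<or> (\<exists>n. n \<noteq> 0 \<and> quad n = 0 \<and> (\<forall>A\<in>G. A *v n = n))"
proof -
  have grp: "matrix_group G" and g: "subspace g"
    and kill: "\<And>w A. \<forall>X\<in>g. X *v w = 0 \<Longrightarrow> A \<in> G \<Longrightarrow> A *v w = w"
    and comp: "\<And>H. matrix_group H \<Longrightarrow> G \<subseteq> H \<Longrightarrow> \<forall>A\<in>H. A - matrix_inv A \<in> g \<Longrightarrow>
        connected_component_set H (mat 1) \<subseteq> G"
    using G(1) unfolding lie_pair_def by blast+
  have iso: "G \<subseteq> isom_fix {e1}" using G(2) lorentz_isom_fix by blast
  have iso2: "G \<subseteq> isom_fix {e1, e2}" using iso e2 by (auto simp: isom_fix_def)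
  define p where "p = {F. gen F \<in> g}"
  have e2_emb: "e2 = emb 1 0" by (simp add: vec_eq_iff forall_5 axis_def)
  have g_gen: "\<exists>F\<in>p. X = gen F" if "X \<in> g" for X
    using lie_pair_gen [OF G that] that unfolding p_def by (metis mem_Collect_eq)
  have p: "subspace p" using g by (simp add: p_def subspace_def gen_linear)
  have real: "ipart F = 0" if "F \<in> p" for F
  proof -
    have "gen F *v e2 = 0" using lie_pair_kills_fixed [OF G(1) e2] that by (simp add: p_def)
    then show ?thesis by (simp add: e2_emb gen_emb emb_eq_0)
  qed
  have Im0: "Im (F $ i) = 0" if "ipart F = 0" for F i
    using that by (simp add: vec_eq_iff)
  show ?thesis
  proof (cases "\<exists>F\<in>p. \<exists>Y\<in>p. ccross F Y \<noteq> 0")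
    case True
    then obtain F Y where FY: "F \<in> p" "Y \<in> p" "ccross F Y \<noteq> 0" by blast
    define n where "n = ccross F Y"
    have n: "n \<in> p" using lie_pair_ccross [OF G FY(1,2) [unfolded p_def mem_Collect_eq]]
      by (simp add: p_def n_def)
    then have n_real: "ipart n = 0" by (rule real)
    have all: "V \<in> p" if V: "ipart V = 0" for V
    proof -
      have rdot: "cdot U W = of_real (Re (cdot U W))" if "ipart U = 0" "ipart W = 0" for U W
        using cdot_parts(2) [of U W] that by (simp add: complex_eq_iff)
      have cr: "ipart (ccross U W) = 0" if "ipart U = 0" "ipart W = 0" for U W
        using Im0 [OF that(1)] Im0 [OF that(2)] by (simp add: vec_eq_iff forall_3)
      have rs: "(of_real r :: complex) *s U = r *\<^sub>R U" for r and U :: "complex^3"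
        using complex_smult_split [of "of_real r" U] by simp
      have "cdot n n *s V = cdot V n *s n + cdot V (ccross Y n) *s F + cdot V (ccross n F) *s Y"
        unfolding n_def by (simp add: complex3_simps algebra_simps)
      then have eq: "Re (cdot n n) *\<^sub>R V
          = Re (cdot V n) *\<^sub>R n + Re (cdot V (ccross Y n)) *\<^sub>R F + Re (cdot V (ccross n F)) *\<^sub>R Y"
        unfolding rs [symmetric] rdot [OF n_real n_real, symmetric] rdot [OF V n_real, symmetric]
          rdot [OF V cr [OF real [OF FY(2)] n_real], symmetric] rdot [OF V cr [OF n_real real [OF FY(1)]], symmetric] .
      have "Re (cdot n n) = rpart n \<bullet> rpart n" using n_real by (simp add: cdot_parts)
      moreover have "rpart n \<noteq> 0" using FY(3) n_real parts_eq_0 n_def by blast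
      ultimately have "Re (cdot n n) \<noteq> 0" by simp
      moreover have "Re (cdot n n) *\<^sub>R V \<in> p"
        unfolding eq using p n FY by (intro subspace_add subspace_scale) auto
      from subspace_scale [OF p this]
      have "(1 / Re (cdot n n)) *\<^sub>R (Re (cdot n n) *\<^sub>R V) \<in> p" .
      ultimately show ?thesis by simp
    qed
    have "connected_component_set (isom_fix {e1, e2}) (mat 1) \<subseteq> G"
    proof (rule comp [OF matrix_group_isom_fix iso2], rule ballI)
      fix A assume A: "A \<in> isom_fix {e1, e2}"
      let ?F = "gen_inv (A - matrix_inv A)"
      have eq: "A - matrix_inv A = gen ?F" using A by (rule isom_fix_minus_inverse) simp
      have "matrix_inv A \<in> isom_fix {e1, e2}" using A matrix_group_simps(3) [OF matrix_group_isom_fix] by blast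
      then have "gen ?F *v e2 = 0"
        using A unfolding eq [symmetric] by (simp add: matrix_vector_mult_diff_rdistrib isom_fix_def)
      then have "ipart ?F = 0" by (simp add: e2_emb gen_emb emb_eq_0)
      then have "gen ?F \<in> g" using all by (simp add: p_def)
      then show "A - matrix_inv A \<in> g" by (subst eq)
    qed
    then have "{A \<in> lorentz. A *v e2 = e2} \<subseteq> G" using SO3_generated [OF grp _ G(2)] by blast
    then show ?thesis using G(2) e2 by blast
  next
    case False
    obtain r where r: "r \<noteq> 0" "\<And>F. F \<in> p \<Longrightarrow> gen F *v emb 0 r = 0"
    proof (cases "\<exists>F\<in>p. F \<noteq> 0")
      case True
      then obtain F where F: "F \<in> p" "F \<noteq> 0" by blast
      have "gen Y *v emb 0 (rpart F) = 0" if Y: "Y \<in> p" for Y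
      proof -
        have "ccross Y F = 0" using False F Y by blast
        then have "cross3 (rpart Y) (rpart F) = 0"
          using Im0 [OF real [OF Y]] Im0 [OF real [OF F(1)]]
          by (simp add: vec_eq_iff forall_3 cross3_def complex_eq_iff)
        then show ?thesis using real [OF Y] by (simp add: gen_emb emb_eq_0)
      qed
      moreover have "rpart F \<noteq> 0" using F real parts_eq_0 by blast
      ultimately show ?thesis using that by blast
    next
      case False
      then have "gen F *v emb 0 (axis 1 1) = 0" if "F \<in> p" for F using that by (auto simp: gen_linear)
      then show ?thesis using that [of "axis 1 1"] by simp
    qed
    have "A *v emb 0 r = emb 0 r" if "A \<in> G" for A using kill r g_gen that by metis
    moreover have "quad (emb 0 r) > 0" using r(1) by (simp add: form_emb)
    ultimately obtain n where "n \<noteq> 0" "quad n = 0" "\<And>A. A \<in> G \<Longrightarrow> A *v n = n"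
      using fixed_spacelike_imp_null [of "emb 0 r" G] iso by auto
    then show ?thesis by blast
  qed
qed

text \<open>
  A fixed timelike vector can be moved to \<open>e2\<close> by an element \<open>B\<close> of the identity component once its time
  component is positive, because then the whole segment from \<open>e2\<close> to \<open>e2 + v\<close> is timelike.
\<close>

lemma lie_pair_lorentz:
  assumes G: "lie_pair G g" "G \<subseteq> lorentz"
  shows "(\<exists>n. n \<noteq> 0 \<and> quad n = 0 \<and> (\<forall>A\<in>G. A *v n \<in> span {n})) \<or>
    (\<exists>B\<in>lorentz. G = conj_by B ` {A \<in> lorentz. A *v e2 = e2}) \<or> G = lorentz"
proof -
  have grp: "matrix_group G" "connected G" using G(1) unfolding lie_pair_def by blast+
  have iso: "G \<subseteq> isom_fix {e1}" using G(2) lorentz_isom_fix by blast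
  have fixed: ?thesis if w: "w \<noteq> 0" "w $ 1 = 0" "\<And>A. A \<in> G \<Longrightarrow> A *v w = w" for w
  proof -
    consider "quad w = 0" | "quad w > 0" | "quad w < 0" by linarith
    then show ?thesis
    proof cases
      case 1
      then show ?thesis using w span_base by (intro disjI1 exI [of _ w]) auto
    next
      case 2
      obtain n where n: "n \<noteq> 0" "quad n = 0" "\<And>A. A \<in> G \<Longrightarrow> A *v n = n"
        using fixed_spacelike_imp_null [OF w(2) 2 iso w(3)] by blast
      then show ?thesis using span_base by (intro disjI1 exI [of _ n]) auto
    next
      case 3
      have w2: "w $ 2 \<noteq> 0"
      proof
        assume "w $ 2 = 0"
        then have "quad w \<ge> 0" using w(2) by (simp add: form_expand)
        then show False using 3 by simp
      qed
      \<comment> \<open>the future-directed unit vector on the line of \<open>w\<close>\<close>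
      define v where "v = (sgn (w $ 2) / sqrt (- quad w)) *\<^sub>R w"
      have v1: "v $ 1 = 0" by (simp add: v_def w(2))
      have "v $ 2 = \<bar>w $ 2\<bar> / sqrt (- quad w)" by (simp add: v_def sgn_mult_abs abs_sgn mult.commute)
      then have v2: "v $ 2 > 0" using 3 w2 by simp
      have "quad v = (sgn (w $ 2))\<^sup>2 / (- quad w) * quad w"
        using 3 by (simp add: v_def form_linear power2_eq_square)
      then have qv: "quad v = -1" using 3 w2 by (simp add: sgn_if)
      have Av: "A *v v = v" if "A \<in> G" for A using w(3) [OF that] by (simp add: v_def matrix_vector_mult_scaleR)
      define B where "B = reflection (e2 + v) ** reflection e2"
      have path: "quad (e2 + t *\<^sub>R v) < 0" if "0 \<le> t" for t
      proof -
        have "quad (e2 + t *\<^sub>R v) = - 1 - 2 * (t * v$2) - t * t"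
          by (simp add: form_linear qv form_axis algebra_simps)
        moreover have "t * v$2 \<ge> 0" "t * t \<ge> 0" using that v2 by auto
        ultimately show ?thesis by linarith
      qed
      have BL: "B \<in> lorentz"
        unfolding B_def
        by (rule rotation_in_component) (use path v1 in \<open>auto simp: form_axis_axis form_axis(1) [of _ v] less_imp_neq\<close>)
      have Be2: "B *v e2 = v"
        unfolding B_def using path [of 1] qv by (intro rotation_maps) (auto simp: form_axis)
      have iB: "invertible B" using BL lorentz_isom_fix isom_fix_inv(2) by blast
      note iB' = matrix_inv_matrix_inv [OF iB]
      let ?G = "conj_by (matrix_inv B) ` G"
      have lp: "lie_pair ?G (conj_by (matrix_inv B) ` g)" by (rule lie_pair_conj_by [OF G(1) iB'(2)])
      have "?G \<subseteq> isom_fix {e1}"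
      proof -
        have "B \<in> isom_fix {e1}" using BL lorentz_isom_fix by blast
        then show ?thesis
          using iso matrix_group_simps [OF matrix_group_isom_fix [of "{e1}"]]
          by (auto simp: conj_by_def iB'(1))
      qed
      then have sub: "?G \<subseteq> lorentz"
        using lp by (intro connected_component_maximal) (auto simp: lie_pair_def matrix_group_def)
      have fix2: "A *v e2 = e2" if A: "A \<in> ?G" for A
      proof -
        obtain A' where A': "A' \<in> G" "A = conj_by (matrix_inv B) A'" using A by blast
        have "A *v e2 = matrix_inv B *v (A' *v (B *v e2))"
          by (simp add: A'(2) conj_by_def iB'(1) matrix_vector_mul_assoc matrix_mul_assoc)
        also have "\<dots> = matrix_inv B *v (B *v e2)" by (simp add: Be2 Av A'(1))
        also have "\<dots> = e2" by (simp add: matrix_vector_mul_assoc matrix_inv_both [OF iB])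
        finally show ?thesis .
      qed
      have cancel: "conj_by B ` ?G = G" by (simp add: image_image conj_by_cancel [OF iB])
      from e2_stabilizer [OF lp sub fix2] show ?thesis
      proof
        assume "?G = {A \<in> lorentz. A *v e2 = e2}"
        then have "G = conj_by B ` {A \<in> lorentz. A *v e2 = e2}" using cancel by simp
        then show ?thesis using BL by blast
      next
        assume "\<exists>n. n \<noteq> 0 \<and> quad n = 0 \<and> (\<forall>A\<in>?G. A *v n = n)"
        then obtain n where n: "n \<noteq> 0" "quad n = 0" "\<And>A. A \<in> ?G \<Longrightarrow> A *v n = n" by blast
        have "A *v (B *v n) \<in> span {B *v n}" if "A \<in> G" for A
        proof -
          have "B *v (conj_by (matrix_inv B) A *v n) = (B ** matrix_inv B) *v (A *v (B *v n))"
            by (simp add: conj_by_def iB'(1) matrix_vector_mul_assoc matrix_mul_assoc)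
          then have "A *v (B *v n) = B *v n" using n(3) that by (simp add: matrix_inv_both [OF iB])
          then show ?thesis by (simp add: span_base)
        qed
        moreover have "B *v n \<noteq> 0"
        proof
          assume "B *v n = 0"
          then have "matrix_inv B *v (B *v n) = 0" by simp
          then show False using n(1) by (simp add: matrix_vector_mul_assoc matrix_inv_both [OF iB])
        qed
        moreover have "quad (B *v n) = 0" using BL lorentz_isom_fix n(2) by (auto simp: isom_fix_def)
        ultimately show ?thesis by blast
      qed
    qed
  qed
  from lie_pair_trichotomy [OF G] show ?thesis using fixed by blast
qed

section \<open>Coordinates adapted to two timelike lines\<close>

lemma act_span: "act A (span {v}) = span {A *v v}"
  unfolding act_def using linear_span_image [OF matrix_vector_mul_linear, of A "{v}"] by simp

lemma span_scale_singleton: "c \<noteq> 0 \<Longrightarrow> span {c *\<^sub>R v} = span {v}"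
proof
  assume c: "c \<noteq> 0"
  show "span {c *\<^sub>R v} \<subseteq> span {v}" by (rule span_minimal) (auto simp: span_base span_scale)
  have "(1 / c) *\<^sub>R (c *\<^sub>R v) \<in> span {c *\<^sub>R v}" by (intro span_scale span_base) simp
  then show "span {v} \<subseteq> span {c *\<^sub>R v}" using c by (intro span_minimal) auto
qed

lemma timelike_line_span:
  assumes L: "timelike_line q L" and hom: "\<And>c x. q (c *\<^sub>R x) = c\<^sup>2 * q x"
  obtains l where "L = span {l}" "q l = -1"
proof -
  have s: "subspace L" "dim L = 1" "\<And>x. x \<in> L \<Longrightarrow> x \<noteq> 0 \<Longrightarrow> q x < 0"
    using L by (auto simp: timelike_line_def)
  obtain B where B: "B \<subseteq> L" "independent B" "L \<subseteq> span B" "card B = 1"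
    using basis_exists [of L] s(2) by metis
  obtain x where x: "B = {x}" using B(4) card_1_singletonE by blast
  have x0: "x \<noteq> 0" using B(2) x dependent_zero by auto
  have "span {x} \<subseteq> L" using B(1) x s(1) by (intro span_minimal) auto
  then have Lx: "L = span {x}" using B(3) x by blast
  have neg: "q x < 0" using s(3) B(1) x x0 by blast
  let ?l = "(1 / sqrt (- q x)) *\<^sub>R x"
  have "L = span {?l}" using Lx span_scale_singleton [of "1 / sqrt (- q x)" x] neg by simp
  moreover have "q ?l = -1" unfolding hom using neg by (simp add: power_divide)
  ultimately show thesis using that by blast
qed

text \<open>
  Since \<open>quad (u - v) + quad (u + v) = 4 quad v\<close> is nonzero, one of \<open>u - v\<close>, \<open>u + v\<close> defines a reflection,
  which maps \<open>u\<close> to \<open>v\<close> or \<open>- v\<close>.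
\<close>

lemma isometry_to_axis:
  assumes "quad u = quad v" "quad v \<noteq> 0" "\<And>s. s \<in> S \<Longrightarrow> form s u = 0 \<and> form s v = 0"
  obtains A c where "A \<in> isom_fix S" "c = 1 \<or> c = -1" "A *v u = c *\<^sub>R v"
proof -
  have "quad (u - v) + quad (u - (- v)) = 4 * quad v"
    using assms(1) by (simp add: form_linear form_commute [of v u])
  then consider "quad (u - v) \<noteq> 0" | "quad (u - (- v)) \<noteq> 0" using assms(2) by fastforce
  then show thesis
  proof cases
    case 1
    then show thesis
      using that [of "reflection (u - v)" 1] reflection_maps [OF assms(1) 1] reflection_isom_fix [OF 1, of S] assms(3)
      by (simp add: form_linear)
  next
    case 2
    have "quad u = quad (- v)" using assms(1) by (simp add: form_linear)
    then show thesis
      using that [of "reflection (u - (- v))" "-1"] reflection_maps [OF _ 2] reflection_isom_fix [OF 2, of S] assms(3)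
      by (simp add: form_linear)
  qed
qed

lemma exist_adapted_coordinates:
  assumes q: "signature_2_3 q" and L: "timelike_line q L" and M: "timelike_line q M" "M \<subseteq> orth q L"
  obtains P l m where "invertible P" "\<And>x. q x = quad (P *v x)" "L = span {l}" "M = span {m}"
    "P *v l = e1" "P *v m = e2"
proof -
  obtain f :: "real^5 \<Rightarrow> real^5" where f: "linear f" "bij f"
    "\<And>x. q x = - (f x $ 1)\<^sup>2 - (f x $ 2)\<^sup>2 + (f x $ 3)\<^sup>2 + (f x $ 4)\<^sup>2 + (f x $ 5)\<^sup>2"
    using q unfolding signature_2_3_def by blast
  define F where "F = matrix f"
  have F: "F *v x = f x" for x unfolding F_def using f(1) by (simp add: matrix_works)
  have invF: "invertible F"
    unfolding invertible_eq_bij using f(2) F by (simp add: bij_def inj_def surj_def)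
  have qF: "q x = quad (F *v x)" for x by (simp add: F f(3) form_expand power2_eq_square)
  have hom: "q (c *\<^sub>R x) = c\<^sup>2 * q x" for c x
    by (simp add: qF matrix_vector_mult_scaleR form_linear power2_eq_square)
  obtain l where l: "L = span {l}" "q l = -1" using timelike_line_span [OF L hom] .
  obtain m where m: "M = span {m}" "q m = -1" using timelike_line_span [OF M(1) hom] .
  have "m \<in> orth q L" "l \<in> L" using M(2) m(1) l(1) span_base by blast+
  then have "polar q m l = 0" by (auto simp: orth_def)
  then have orth: "form (F *v m) (F *v l) = 0"
    using form_polar [of "F *v m" "F *v l"] by (simp add: polar_def qF matrix_vector_right_distrib)
  have qe: "quad e1 = -1" "quad e2 = -1" "form e1 e2 = 0" by (simp_all add: form_axis_axis)
  obtain A c where A: "A \<in> isom_fix {}" "c = 1 \<or> c = -1" "A *v (F *v l) = c *\<^sub>R e1"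
    using isometry_to_axis [of "F *v l" e1 "{}"] l(2) qe qF by auto
  have "form (A *v (F *v m)) (A *v (F *v l)) = 0" using isom_fix_form [OF A(1)] orth by simp
  then have orth': "form e1 (A *v (F *v m)) = 0" using A(2,3) form_commute by (auto simp: form_linear)
  have qm: "quad (A *v (F *v m)) = -1" using isom_fix_form [OF A(1)] m(2) qF by simp
  obtain B d where B: "B \<in> isom_fix {e1}" "d = 1 \<or> d = -1" "B *v (A *v (F *v m)) = d *\<^sub>R e2"
    using isometry_to_axis [of "A *v (F *v m)" e2 "{e1}"] qm qe orth' by auto
  define P where "P = B ** (A ** F)"
  have "invertible P" unfolding P_def using isom_fix_inv(2) [OF A(1)] isom_fix_inv(2) [OF B(1)] invF
    by (intro invertible_mult)
  moreover have "q x = quad (P *v x)" for x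
    using isom_fix_form [OF A(1)] isom_fix_form [OF B(1)] qF by (simp add: P_def flip: matrix_vector_mul_assoc)
  moreover have "P *v (c *\<^sub>R l) = e1"
    using A(2,3) B(1) by (auto simp: P_def matrix_vector_mult_scaleR isom_fix_def simp flip: matrix_vector_mul_assoc)
  moreover have "P *v (d *\<^sub>R m) = e2"
    using B(2,3) by (auto simp: P_def matrix_vector_mult_scaleR simp flip: matrix_vector_mul_assoc)
  moreover have "L = span {c *\<^sub>R l}" "M = span {d *\<^sub>R m}"
    using l(1) m(1) A(2) B(2) span_scale_singleton [of c l] span_scale_singleton [of d m] by auto
  ultimately show thesis using that by blast
qed

locale adapted_coordinates =
  fixes q :: "real^5 \<Rightarrow> real" and L M :: "(real^5) set" and P :: "real^5^5" and l m :: "real^5"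
  assumes P: "invertible P" and q: "q x = quad (P *v x)"
    and L: "L = span {l}" and M: "M = span {m}" and l: "P *v l = e1" and m: "P *v m = e2"
begin

abbreviation "Q \<equiv> matrix_inv P"

lemmas Q = matrix_inv_matrix_inv [OF P]

lemma PQ: "P *v (Q *v x) = x" "Q *v (P *v x) = x"
  by (simp_all add: matrix_vector_mul_assoc matrix_inv_both [OF P])

lemma conj_P: "conj_by P A *v (P *v x) = P *v (A *v x)"
proof -
  have "conj_by P A *v (P *v x) = P *v (A *v (Q *v (P *v x)))"
    by (simp add: conj_by_def matrix_vector_mul_assoc matrix_mul_assoc)
  then show ?thesis by (simp add: PQ)
qed

lemma conj_Q: "conj_by Q A *v (Q *v x) = Q *v (A *v x)"
proof -
  have "conj_by Q A *v (Q *v x) = Q *v (A *v (P *v (Q *v x)))"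
    by (simp add: conj_by_def Q(1) matrix_vector_mul_assoc matrix_mul_assoc)
  then show ?thesis by (simp add: PQ)
qed

lemma l_m: "l = Q *v e1" "m = Q *v e2"
  using PQ(2) l m by metis+

lemma isometry_conj: "(\<forall>x. q (A *v x) = q x) \<longleftrightarrow> (\<forall>x. quad (conj_by P A *v x) = quad x)"
proof -
  have "q (A *v x) = quad (conj_by P A *v (P *v x))" "q x = quad (P *v x)" for x
    by (simp_all add: q conj_P)
  then show ?thesis by (metis PQ(1))
qed

text \<open>
  An element of \<open>Iso0_dS q L\<close> maps \<open>l\<close> to \<open>l\<close> or \<open>- l\<close>, and the sign is constant by connectedness, so the component of the
  stabilizer of the line is the component of the stabilizer of the vector.
\<close>

lemma Iso0_conj: "Iso0_dS q L = conj_by Q ` lorentz"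
proof
  let ?I = "Iso0_dS q L"
  have stab: "?I \<subseteq> stab (SO0_2_3 q) L" unfolding Iso0_dS_def by (rule connected_component_subset)
  have iso: "\<forall>x. q (A *v x) = q x" and AL: "act A L = L" if "A \<in> ?I" for A
    using that stab connected_component_subset [of "{A. \<forall>x. q (A *v x) = q x}" "mat 1"]
    by (auto simp: stab_def SO0_2_3_def)
  have one: "mat 1 \<in> ?I" if "?I \<noteq> {}"
    using that unfolding Iso0_dS_def
    by (metis connected_component_eq_empty connected_component_refl mem_Collect_eq)
  have scale: "(P *v (A *v l)) = ((P *v (A *v l)) $ 1) *\<^sub>R e1 \<and> ((P *v (A *v l)) $ 1)\<^sup>2 = 1" if "A \<in> ?I" for A
  proof -
    have "A *v l \<in> span {l}" using AL [OF that] span_base unfolding act_def L by blast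
    then obtain c where c: "A *v l = c *\<^sub>R l" by (auto simp: span_singleton)
    have "q (A *v l) = q l" using iso [OF that] by blast
    then have "c\<^sup>2 = 1" by (simp add: q c l matrix_vector_mult_scaleR form_linear form_axis_axis power2_eq_square)
    then show ?thesis by (simp add: c l matrix_vector_mult_scaleR)
  qed
  have fix_l: "P *v (A *v l) = e1" if A: "A \<in> ?I" for A
  proof -
    let ?f = "\<lambda>A. (P *v (A *v l)) $ 1"
    have "?f A = ?f (mat 1)"
    proof (rule connected_square_constant [where S = "?I" and f = ?f and c = 1])
      show "connected ?I" by (simp add: Iso0_dS_def)
      show "continuous_on ?I ?f"
        by (intro continuous_intros bounded_linear.continuous_on [OF bounded_bilinear.bounded_linear_right
              [OF bounded_bilinear_matrix_vector_mult]] bounded_linear.continuous_on [OF bounded_bilinear.bounded_linear_left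
              [OF bounded_bilinear_matrix_vector_mult]])
    qed (use scale one A in auto)
    then show ?thesis using scale [OF A] by (simp add: l)
  qed
  show "?I \<subseteq> conj_by Q ` lorentz"
  proof
    fix A assume A: "A \<in> ?I"
    have "conj_by P ` ?I \<subseteq> lorentz"
    proof (rule connected_component_maximal)
      show "mat 1 \<in> conj_by P ` ?I" using one A conj_by_one [OF P] by (metis empty_iff image_eqI)
      show "connected (conj_by P ` ?I)" by (rule connected_conj_by) (simp add: Iso0_dS_def)
      show "conj_by P ` ?I \<subseteq> isom_fix {e1}"
      proof
        fix B assume "B \<in> conj_by P ` ?I"
        then obtain A where A: "A \<in> ?I" "B = conj_by P A" by blast
        have "B *v e1 = e1" using conj_P [of A l] fix_l [OF A(1)] by (simp add: A(2) l)
        then show "B \<in> isom_fix {e1}" using iso [OF A(1)] isometry_conj [of A] by (simp add: isom_fix_def A(2))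
      qed
    qed
    then have "conj_by P A \<in> lorentz" using A by blast
    then have "conj_by Q (conj_by P A) \<in> conj_by Q ` lorentz" by blast
    then show "A \<in> conj_by Q ` lorentz" by (simp add: conj_by_cancel [OF P])
  qed
  let ?J = "conj_by Q ` lorentz"
  have one': "mat 1 \<in> ?J" using one_in_lorentz conj_by_one [OF Q(2)] by (metis image_eqI)
  have conn: "connected ?J" by (rule connected_conj_by) simp
  have isoJ: "\<forall>x. q (A *v x) = q x" and fixJ: "A *v l = l" if AJ: "A \<in> ?J" for A
  proof -
    obtain B where B: "B \<in> lorentz" "A = conj_by Q B" using AJ by blast
    have Bi: "B \<in> isom_fix {e1}" using B(1) lorentz_isom_fix by blast
    have "conj_by P A = B" by (simp add: B(2) conj_by_cancel [OF P])
    then show "\<forall>x. q (A *v x) = q x" unfolding isometry_conj using Bi by (simp add: isom_fix_def)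
    show "A *v l = l" using Bi by (simp add: B(2) l_m conj_Q isom_fix_def)
  qed
  have "?J \<subseteq> SO0_2_3 q"
    unfolding SO0_2_3_def by (rule connected_component_maximal [OF one' conn]) (use isoJ in auto)
  then have "?J \<subseteq> stab (SO0_2_3 q) L"
    using fixJ act_span unfolding stab_def L by auto
  then show "?J \<subseteq> ?I" unfolding Iso0_dS_def by (intro connected_component_maximal one' conn)
qed

text \<open>
  The sign with which the line \<open>M\<close> is preserved is positive because \<open>lorentz\<close> preserves the time orientation.
\<close>

lemma SO_3_conj: "SO_3 q L M = conj_by Q ` {A \<in> lorentz. A *v e2 = e2}"
proof -
  have "act (conj_by Q B) M = M \<longleftrightarrow> B *v e2 = e2" if B: "B \<in> lorentz" for B
  proof
    assume "act (conj_by Q B) M = M"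
    then have "conj_by Q B *v m \<in> span {m}" unfolding M act_span using span_base by blast
    then obtain c where c: "conj_by Q B *v m = c *\<^sub>R m" by (auto simp: span_singleton)
    then have "Q *v (B *v e2) = c *\<^sub>R m" by (simp add: l_m conj_Q)
    then have "P *v (Q *v (B *v e2)) = c *\<^sub>R e2" using m by (simp add: matrix_vector_mult_scaleR)
    then have Be: "B *v e2 = c *\<^sub>R e2" by (simp add: PQ)
    have "B \<in> isom_fix {e1}" using B lorentz_isom_fix by blast
    then have "quad (B *v e2) = quad e2" by (simp add: isom_fix_def)
    then have "c\<^sup>2 = 1" by (simp add: Be form_linear form_axis_axis power2_eq_square)
    moreover have "c > 0" using lorentz_e2 [OF B] by (simp add: Be)
    ultimately show "B *v e2 = e2" using Be by (simp add: power2_eq_1_iff)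
  next
    assume "B *v e2 = e2"
    then show "act (conj_by Q B) M = M" by (simp add: M act_span l_m conj_Q)
  qed
  then show ?thesis unfolding SO_3_def stab_def Iso0_conj by blast
qed

lemma lie_pair_Iso0:
  assumes G: "lie_pair G g" "G \<subseteq> Iso0_dS q L"
  shows "(\<exists>p\<in>Ein q. \<forall>A\<in>G. act A p = p)
       \<or> (\<exists>A\<in>Iso0_dS q L. G = (\<lambda>B. A ** B ** matrix_inv A) ` SO_3 q L M)
       \<or> G = Iso0_dS q L"
proof -
  let ?G = "conj_by P ` G"
  have cancel: "conj_by Q ` ?G = G" by (simp add: image_image conj_by_cancel [OF P])
  have sub: "?G \<subseteq> lorentz" using G(2) unfolding Iso0_conj by (auto simp: conj_by_cancel [OF P])
  have inv: "invertible A" if "A \<in> G" for A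
    using G(1) that by (auto simp: lie_pair_def matrix_group_def)
  from lie_pair_lorentz [OF lie_pair_conj_by [OF G(1) P] sub]
  consider n where "n \<noteq> 0" "quad n = 0" "\<forall>A\<in>?G. A *v n \<in> span {n}"
    | B where "B \<in> lorentz" "?G = conj_by B ` {A \<in> lorentz. A *v e2 = e2}" | "?G = lorentz"
    by blast
  then show ?thesis
  proof cases
    case 1
    have "Q *v n \<noteq> 0" using 1(1) PQ(1) [of n] by auto
    moreover have "q (Q *v n) = 0" using 1(2) by (simp add: q PQ)
    ultimately have "span {Q *v n} \<in> Ein q" unfolding Ein_def by blast
    moreover have "act A (span {Q *v n}) = span {Q *v n}" if A: "A \<in> G" for A
    proof -
      have "conj_by P A *v n \<in> span {n}" using 1(3) A by blast
      then obtain c where c: "conj_by P A *v n = c *\<^sub>R n" by (auto simp: span_singleton)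
      have "P *v (A *v (Q *v n)) = c *\<^sub>R n" using conj_P [of A "Q *v n"] by (simp add: PQ c)
      then have "Q *v (P *v (A *v (Q *v n))) = c *\<^sub>R (Q *v n)" by (simp add: matrix_vector_mult_scaleR)
      then have Ac: "A *v (Q *v n) = c *\<^sub>R (Q *v n)" by (simp add: PQ)
      have "c \<noteq> 0"
      proof
        assume "c = 0"
        then have "matrix_inv A *v (A *v (Q *v n)) = 0" using Ac by simp
        moreover have "matrix_inv A *v (A *v x) = x" for x
          by (simp add: matrix_vector_mul_assoc matrix_inv_both [OF inv [OF A]])
        ultimately show False using \<open>Q *v n \<noteq> 0\<close> by metis
      qed
      then show ?thesis by (simp add: act_span Ac span_scale_singleton)
    qed
    ultimately show ?thesis by blast
  next
    case 2
    have iB: "invertible B" using 2(1) lorentz_isom_fix isom_fix_inv(2) by blast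
    have "conj_by Q (conj_by B X) = conj_by (conj_by Q B) (conj_by Q X)" for X
    proof -
      have "conj_by (conj_by Q B) (conj_by Q X) = conj_by Q B ** conj_by Q X ** conj_by Q (matrix_inv B)"
        unfolding conj_by_def [of "conj_by Q B"] by (simp add: conj_by_matrix_inv [OF Q(2) iB])
      then show ?thesis by (simp add: conj_by_mult [OF Q(2)] conj_by_def [of B])
    qed
    then have "G = conj_by (conj_by Q B) ` SO_3 q L M"
      unfolding SO_3_conj by (subst cancel [symmetric]) (simp add: 2(2) image_image)
    then have "G = (\<lambda>X. conj_by Q B ** X ** matrix_inv (conj_by Q B)) ` SO_3 q L M"
      unfolding conj_by_def [of "conj_by Q B", abs_def] .
    moreover have "conj_by Q B \<in> Iso0_dS q L" unfolding Iso0_conj using 2(1) by blast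
    ultimately show ?thesis by blast
  next
    case 3
    then show ?thesis using cancel Iso0_conj by simp
  qed
qed

end

theorem theorem4p1:
  fixes q :: "real^5 \<Rightarrow> real"
    and L M :: "(real^5) set"
    and G :: "(real^5^5) set"
    and T :: "(real^5^5) topology"
  assumes "signature_2_3 q"
    and "timelike_line q L"
    and "timelike_line q M" and "M \<subseteq> orth q L"
    and "G \<subseteq> Iso0_dS q L"
    and "lie_subgroup G T" and "connected_space T"
    and "cohomogeneity_one q G"
  shows "(\<exists>p\<in>Ein q. \<forall>A\<in>G. act A p = p)
       \<or> (\<exists>A\<in>Iso0_dS q L. G = (\<lambda>B. A ** B ** matrix_inv A) ` SO_3 q L M)
       \<or> G = Iso0_dS q L"
proof -
  obtain g where g: "lie_pair G g" using lie_subgroup_imp_lie_pair [OF assms(6,7)] .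
  obtain P l m where "invertible P" "\<And>x. q x = quad (P *v x)" "L = span {l}" "M = span {m}"
    "P *v l = e1" "P *v m = e2"
    by (rule exist_adapted_coordinates [OF assms(1-4)]) (rule that)
  then interpret adapted_coordinates q L M P l m by unfold_locales
  show ?thesis using lie_pair_Iso0 [OF g assms(5)] .
qed

end
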